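(* Let $D\subset\mathbb{C}$ be any simply connected domain, $a\in\partial D$, $b\in D$, and let $\delta>0$ be small enough that the four hexagons within distance $\delta$ of the mid-edge $b_\delta$ all belong to $D_\delta$. Then the radial exploration process $\gamma_\delta$ from $a_\delta$ to $b_\delta$ in $D_\delta$ has the same distribution as the time-reversal of the radial exploration process $\gamma'_\delta$ from $b_\delta$ to $a_\delta$ in $D_\delta$.
   Context: Lattice. $\mathcal{H}_\delta$ is the hexagonal lattice in $\mathbb{C}$ with mesh (edge length) $\delta$. A mid-edge is the centre of an edge of $\mathcal{H}_\delta$. Two distinct mid-edges are within distance $\delta$ of each other exactly when their edges share a vertex. $D_\delta$ is the largest connected component of hexagons of $D\cap\mathcal{H}_\delta$ (hexagons contained in $D$), regarded as a closed set including its boundary edges. $a_\delta$ is a closest mid-edge to $a$ among the mid-edges lying outside $D_\delta$ but within distance $\delta/2$ of the topological boundary $\partial D_\delta$; $b_\delta$ is a closest mid-edge to $b$ in $D_\delta$ (ties broken arbitrarily; both are fixed). A polygonal path is a continuous path using only edges (and half-edges) of $\mathcal{H}_\delta$. Let $e_a$ denote the unique half-edge starting at $a_\delta$ and connected to $D_\delta$. Radial exploration process $\gamma_\delta$ from $a_\delta$ to $b_\delta$ in $D_\delta$. It is a random polygonal path with $\gamma_\delta(k)$ a mid-edge for integer $k$ and $\gamma_\delta(k-1/2)$ the lattice vertex traversed between $\gamma_\delta(k-1)$ and $\gamma_\delta(k)$. Set $\gamma_\delta(0)=a_\delta$ and $\gamma_\delta[0,1/2]=e_a$. Step 1: $\gamma_\delta(1)$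 is one of the two mid-edges in $D_\delta$ within distance $\delta$ of $a_\delta$, each with probability $1/2$. Step $k\ge 2$: let $\gamma_\delta(k-1/2)$ be the endpoint, other than $\gamma_\delta(k-3/2)$, of the edge whose centre is $\gamma_\delta(k-1)$. A mid-edge $m\ne\gamma_\delta(k-1)$ of an edge incident to $\gamma_\delta(k-1/2)$ is called allowable if there is a polygonal path from $m$ to $b_\delta$ contained in $D_\delta$ that does not meet $\gamma_\delta[0,k-1/2]$. There are one or two allowable mid-edges; $\gamma_\delta(k)$ is chosen uniformly among them, independently of previous choices. The process stops on reaching $b_\delta$. Radial exploration process $\gamma'_\delta$ from $b_\delta$ to $a_\delta$ in $D_\delta$. Set $\gamma'_\delta(0)=b_\delta$; $\gamma'_\delta(1)$ is uniform among the 4 mid-edges within distance $\delta$ of $b_\delta$. Step $k\ge2$: with $\gamma'_\delta(k-1/2)$ the endpoint, other than $\gamma'_\delta(k-3/2)$, of the edge with centre $\gamma'_\delta(k-1)$, a mid-edge $m\neq\gamma'_\delta(k-1)$ of an edge incident to $\gamma'_\delta(k-1/2)$ is allowable if there is a polygonal path from $m$ to $a_\delta$ contained in $D_\delta\cup e_a$ that does not meet $\gamma'_\delta[0,k-1/2]$. There are one or two allowable mid-edges; $\gamma'_\delta(k)$ is chosen uniformly among them, independently of previous choices. The process stops on reaching $a_\delta$. *)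

theory Defs
  imports "HOL-Analysis.Analysis" "HOL-Probability.SPMF" "HOL-Library.Equipollence"
begin

section \<open>The hexagonal lattice with edge length \<open>\<delta>\<close>\<close>

text \<open>The lattice is placed so that one hexagon is centred at the origin and has a vertex at
  \<open>\<i> \<delta>\<close>; the centres then form the triangular lattice of spacing \<open>\<delta> \<surd>3\<close> generated by
  \<open>1\<close> and \<open>cis (\<pi>/3)\<close>.\<close>

definition hex_centre :: "real \<Rightarrow> int \<Rightarrow> int \<Rightarrow> complex" where
  "hex_centre \<delta> j k = of_real (\<delta> * sqrt 3) * (of_int j + of_int k * cis (pi / 3))"

definition hex_corners :: "real \<Rightarrow> complex \<Rightarrow> complex set" where
  "hex_corners \<delta> c = {c + of_real \<delta> * cis (pi / 6 + real i * pi / 3) | i :: nat. i < 6}"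

definition hexagons :: "real \<Rightarrow> complex set set" where
  "hexagons \<delta> = {convex hull (hex_corners \<delta> (hex_centre \<delta> j k)) | j k. True}"

definition lattice_vertices :: "real \<Rightarrow> complex set" where
  "lattice_vertices \<delta> = (\<Union>j k. hex_corners \<delta> (hex_centre \<delta> j k))"

text \<open>Two lattice vertices are joined by an edge iff they are nearest neighbours.\<close>

definition lattice_edge :: "real \<Rightarrow> complex \<Rightarrow> complex \<Rightarrow> bool" where
  "lattice_edge \<delta> v w \<longleftrightarrow>
     v \<in> lattice_vertices \<delta> \<and> w \<in> lattice_vertices \<delta> \<and> dist v w = \<delta>"

definition half_edge :: "real \<Rightarrow> complex \<Rightarrow> complex \<Rightarrow> bool" where
  "half_edge \<delta> v m \<longleftrightarrow> (\<exists>w. lattice_edge \<delta> v w \<and> m = midpoint v w)"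

definition mid_edges :: "real \<Rightarrow> complex set" where
  "mid_edges \<delta> = {midpoint v w | v w. lattice_edge \<delta> v w}"


section \<open>The lattice approximation of a domain\<close>

definition hex_adjacent :: "real \<Rightarrow> complex set \<Rightarrow> complex set \<Rightarrow> bool" where
  "hex_adjacent \<delta> h h' \<longleftrightarrow>
     h \<noteq> h' \<and> (\<exists>v w. lattice_edge \<delta> v w \<and> closed_segment v w \<subseteq> h \<inter> h')"

definition hexagons_in :: "real \<Rightarrow> complex set \<Rightarrow> complex set set" where
  "hexagons_in \<delta> D = {h \<in> hexagons \<delta>. h \<subseteq> D}"

definition hex_component :: "real \<Rightarrow> complex set \<Rightarrow> complex set set \<Rightarrow> bool" where
  "hex_component \<delta> D C \<longleftrightarrow>
     (\<exists>h \<in> hexagons_in \<delta> D. C = {h'. (h, h') \<in>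
        {(x, y). x \<in> hexagons_in \<delta> D \<and> y \<in> hexagons_in \<delta> D \<and> hex_adjacent \<delta> x y}\<^sup>*})"

text \<open>Size is compared by injections rather than by \<open>card\<close>, since for unbounded \<open>D\<close>
  components may be infinite. If there are ties, every maximal component qualifies.\<close>

definition largest_hex_component :: "real \<Rightarrow> complex set \<Rightarrow> complex set set \<Rightarrow> bool" where
  "largest_hex_component \<delta> D C \<longleftrightarrow>
     hex_component \<delta> D C \<and> (\<forall>C'. hex_component \<delta> D C' \<longrightarrow> C' \<lesssim> C)"


section \<open>Polygonal paths\<close>

text \<open>A polygonal path is represented by the list of the vertices and mid-edges it visits, in
  order. Consecutive entries span a half-edge, so the underlying curve is determined by the
  list; for an exploration path the list is \<open>[\<gamma>(0), \<gamma>(1/2), \<gamma>(1), \<gamma>(3/2), \<dots>]\<close>.\<close>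

definition polygonal_path :: "real \<Rightarrow> complex list \<Rightarrow> bool" where
  "polygonal_path \<delta> p \<longleftrightarrow>
     p \<noteq> [] \<and> set p \<subseteq> lattice_vertices \<delta> \<union> mid_edges \<delta> \<and>
     (\<forall>i. Suc i < length p \<longrightarrow>
        half_edge \<delta> (p ! i) (p ! Suc i) \<or> half_edge \<delta> (p ! Suc i) (p ! i))"

definition path_trace :: "complex list \<Rightarrow> complex set" where
  "path_trace p = set p \<union> (\<Union>i \<in> {i. Suc i < length p}. closed_segment (p ! i) (p ! Suc i))"


section \<open>Radial exploration\<close>

definition other_end :: "real \<Rightarrow> complex \<Rightarrow> complex \<Rightarrow> complex" where
  "other_end \<delta> m v = (THE w. half_edge \<delta> w m \<and> w \<noteq> v)"

text \<open>Here \<open>h\<close> is the list of \<open>\<gamma>(0), \<dots>, \<gamma>(k - 1)\<close>, \<open>v\<close> is \<open>\<gamma>(k - 1/2)\<close>, \<open>t\<close> is the target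
  and \<open>A\<close> is the set within which the target must remain reachable. The condition
  \<open>closed_segment v m \<subseteq> A\<close> keeps the exploration itself in \<open>A\<close>. If \<open>A\<close> is a union of hexagons it
  follows from \<open>m \<in> A\<close>; if \<open>A\<close> also contains a half-edge \<open>e\<^sub>a\<close> starting at \<open>t\<close>, it only
  excludes reaching \<open>t\<close> through the other half of the same edge, which is impossible anyway
  when \<open>e\<^sub>a\<close> is the only half-edge joining \<open>t\<close> to the hexagons.\<close>

definition allowable ::
  "real \<Rightarrow> complex set \<Rightarrow> complex \<Rightarrow> complex list \<Rightarrow> complex \<Rightarrow> complex set" where
  "allowable \<delta> A t h v =
     {m. half_edge \<delta> v m \<and> m \<noteq> last h \<and> closed_segment v m \<subseteq> A \<and>
         (\<exists>p. polygonal_path \<delta> p \<and> hd p = m \<and> last p = t \<and>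
              path_trace p \<subseteq> A \<and> path_trace p \<inter> path_trace (h @ [v]) = {})}"

text \<open>Steps \<open>k \<ge> 2\<close>. The result is the law of the path stopped on reaching \<open>t\<close>. It is a
  sub-probability mass function because for an unbounded \<open>A\<close> it is not evident that the process
  stops. The missing mass is the probability that it never does (or that no mid-edge is
  allowable, which does not happen for the explorations below in simply connected domains).\<close>

partial_function (spmf) explore ::
  "real \<Rightarrow> complex set \<Rightarrow> complex \<Rightarrow> complex list \<Rightarrow> complex list spmf" where
  "explore \<delta> A t h =
     (if last h = t then return_spmf h
      else let v = other_end \<delta> (last h) (last (butlast h)) in
        bind_spmf (spmf_of_set (allowable \<delta> A t h v)) (\<lambda>m. explore \<delta> A t (h @ [v, m])))"

text \<open>The exploration from \<open>a\<close> to \<open>b\<close> in \<open>Dd\<close>, where \<open>s\<close> is the endpoint of the half-edge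
  \<open>e\<^sub>a\<close> by which \<open>a\<close> is connected to \<open>Dd\<close>. The condition \<open>half_edge \<delta> s m\<close> expresses that the first
  step runs along \<open>e\<^sub>a\<close>; it is redundant when \<open>e\<^sub>a\<close> is the only half-edge joining \<open>a\<close> to
  \<open>Dd\<close>.\<close>

definition radial_exploration ::
  "real \<Rightarrow> complex set \<Rightarrow> complex \<Rightarrow> complex \<Rightarrow> complex \<Rightarrow> complex list spmf" where
  "radial_exploration \<delta> Dd a s b =
     bind_spmf (spmf_of_set {m \<in> mid_edges \<delta>. m \<in> Dd \<and> dist m a \<le> \<delta> \<and> half_edge \<delta> s m})
       (\<lambda>m. explore \<delta> Dd b [a, s, m])"

definition radial_exploration' ::
  "real \<Rightarrow> complex set \<Rightarrow> complex \<Rightarrow> complex \<Rightarrow> complex \<Rightarrow> complex list spmf" where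
  "radial_exploration' \<delta> Dd a s b =
     bind_spmf (spmf_of_set {m \<in> mid_edges \<delta>. m \<noteq> b \<and> dist m b \<le> \<delta>})
       (\<lambda>m. explore \<delta> (Dd \<union> closed_segment a s) a
              [b, (THE v. half_edge \<delta> v b \<and> half_edge \<delta> v m), m])"

end

theory Submission
  imports Defs "HOL-Library.Z2" "HOL-Library.Sublist" "HOL-Complex_Analysis.Riemann_Mapping"
begin

text \<open>Merge all hexagons outside \<open>D\<^sub>\<delta>\<close> into a single face. In either exploration a step offers two
  mid-edges if the face in front of the tip has not been touched by the path before, and one
  otherwise. Hence a self-avoiding path from \<open>a\<^sub>\<delta>\<close> to \<open>b\<^sub>\<delta>\<close> touching \<open>n\<close> faces has probability
  \<open>2\<^sup>1\<^sup>-\<^sup>n\<close> in the exploration from \<open>a\<^sub>\<delta>\<close>, which starts with a choice between two mid-edges and two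
  touched faces, and its reversal has probability \<open>2\<^sup>1\<^sup>-\<^sup>n\<close> in the exploration from \<open>b\<^sub>\<delta>\<close>, which starts
  with a choice between four mid-edges and three touched faces.

  If the face in front has been touched, a path joining the two candidate mid-edges in the
  complement of the past would close up to a lattice cycle modulo \<open>2\<close>. Such a cycle bounds a set of
  faces, and this set contains exactly one of the face in front and the faces touched before. This
  uses that the face outside, having no bounded components as \<open>D\<close> is simply connected, is not in the
  set. If the face in front is new, counting modulo \<open>2\<close> the edges between the past and the set of
  vertices from which the target can be reached shows that this set contains both or none of the
  two candidates.\<close>


section \<open>The hexagonal lattice and its faces\<close>

text \<open>The two laws are compared only through the probability of each finished path. Neither
  termination nor the existence of an allowable mid-edge has to be shown: along a finished path its
  own remaining part proves at every step that the next mid-edge is allowable. The factors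
  telescope, and what is left depends only on the set of visited vertices, which reversal preserves.
  The obstacle is that the two explorations differ at their targets. The target near
  \<open>b\<close> can be entered from both ends of its edge, the one near \<open>a\<close> only
  from one end and through a half-edge that leaves the region. Both are covered by one abstract
  exploration; the condition that makes this work is that a usable half-edge on an edge outside
  \<open>C\<close> occurs only at a tip which is the sole possible entrance. The end vertices of the
  first and the last edge that lie beyond their centres may be visited elsewhere by the path. They
  are therefore kept apart from the list of visited vertices, and turning back is excluded
  separately. Working modulo 2 replaces the Jordan curve theorem: a cycle need be neither simple nor
  oriented.\<close>

text \<open>\<open>Up j k\<close> and \<open>Dn j k\<close> are the corners at angle \<open>\<pi>/6\<close> and \<open>7\<pi>/6\<close> of the hexagon \<open>(j, k)\<close>. Every
  lattice vertex is of exactly one of these forms.\<close>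

datatype vtx = Up int int | Dn int int

fun hexs :: "vtx \<Rightarrow> (int \<times> int) set" where
  "hexs (Up j k) = {(j, k), (j + 1, k), (j, k + 1)}"
| "hexs (Dn j k) = {(j, k), (j - 1, k), (j, k - 1)}"

fun nbrs :: "vtx \<Rightarrow> vtx set" where
  "nbrs (Up j k) = {Dn (j + 1) k, Dn j (k + 1), Dn (j + 1) (k + 1)}"
| "nbrs (Dn j k) = {Up (j - 1) k, Up j (k - 1), Up (j - 1) (k - 1)}"

fun hadj :: "int \<times> int \<Rightarrow> int \<times> int \<Rightarrow> bool" where
  "hadj (j, k) (j', k') \<longleftrightarrow>
     (j', k') \<in> {(j + 1, k), (j - 1, k), (j, k + 1), (j, k - 1), (j + 1, k - 1), (j - 1, k + 1)}"

lemma finite_nbrs [simp]: "finite (nbrs v)" by (cases v) auto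
lemma finite_hexs [simp]: "finite (hexs v)" by (cases v) auto
lemma card_hexs: "card (hexs v) = 3" by (cases v) auto

lemma nbrs_sym: "x \<in> nbrs y \<Longrightarrow> y \<in> nbrs x"
  by (cases y) auto

lemma not_nbrs_self [simp]: "y \<notin> nbrs y"
  by (cases y) auto

text \<open>The local picture at a tip \<open>y\<close> entered from \<open>x\<close>:
  \<open>L\<close> and \<open>R\<close> flank the edge just used, \<open>F\<close> is the face in
  front, and the edges to \<open>l\<close> and \<open>r\<close> separate \<open>F\<close> from
  \<open>L\<close> and from \<open>R\<close>. No orientation is fixed.\<close>

lemma tripod:
  assumes "x \<in> nbrs y"
  obtains L R F l r where "nbrs y = {x, l, r}" "x \<noteq> l" "x \<noteq> r" "l \<noteq> r"
    "hexs y = {L, R, F}" "L \<noteq> R" "L \<noteq> F" "R \<noteq> F"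
    "hexs y \<inter> hexs x = {L, R}" "hexs y \<inter> hexs l = {L, F}" "hexs y \<inter> hexs r = {R, F}"
proof (cases y)
  case (Up j k)
  with assms consider "x = Dn (j + 1) k" | "x = Dn j (k + 1)" | "x = Dn (j + 1) (k + 1)" by auto
  then show thesis
  proof cases
    case 1
    show thesis
      by (rule that[of "Dn j (k + 1)" "Dn (j + 1) (k + 1)" "(j, k)" "(j + 1, k)" "(j, k + 1)"])
        (simp_all add: Up 1 Int_insert_left insert_commute)
  next
    case 2
    show thesis
      by (rule that[of "Dn (j + 1) k" "Dn (j + 1) (k + 1)" "(j, k)" "(j, k + 1)" "(j + 1, k)"])
        (simp_all add: Up 2 Int_insert_left insert_commute)
  next
    case 3
    show thesis
      by (rule that[of "Dn (j + 1) k" "Dn j (k + 1)" "(j + 1, k)" "(j, k + 1)" "(j, k)"])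
        (simp_all add: Up 3 Int_insert_left insert_commute)
  qed
next
  case (Dn j k)
  with assms consider "x = Up (j - 1) k" | "x = Up j (k - 1)" | "x = Up (j - 1) (k - 1)" by auto
  then show thesis
  proof cases
    case 1
    show thesis
      by (rule that[of "Up j (k - 1)" "Up (j - 1) (k - 1)" "(j, k)" "(j - 1, k)" "(j, k - 1)"])
        (simp_all add: Dn 1 Int_insert_left insert_commute)
  next
    case 2
    show thesis
      by (rule that[of "Up (j - 1) k" "Up (j - 1) (k - 1)" "(j, k)" "(j, k - 1)" "(j - 1, k)"])
        (simp_all add: Dn 2 Int_insert_left insert_commute)
  next
    case 3
    show thesis
      by (rule that[of "Up (j - 1) k" "Up j (k - 1)" "(j - 1, k)" "(j, k - 1)" "(j, k)"])
        (simp_all add: Dn 3 Int_insert_left insert_commute)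
  qed
qed

lemma hadj_edge:
  assumes "hadj h h'"
  obtains v w where "w \<in> nbrs v" "hexs v \<inter> hexs w = {h, h'}" "h \<noteq> h'"
proof -
  obtain j k j' k' where h: "h = (j, k)" "h' = (j', k')" by (cases h; cases h')
  from assms consider "j' = j + 1 \<and> k' = k" | "j' = j - 1 \<and> k' = k" | "j' = j \<and> k' = k + 1"
    | "j' = j \<and> k' = k - 1" | "j' = j + 1 \<and> k' = k - 1" | "j' = j - 1 \<and> k' = k + 1"
    unfolding h by auto
  then show thesis
  proof cases
    case 1 show thesis by (rule that[of "Dn (j + 1) k" "Up j k"]) (simp_all add: 1 h Int_insert_left insert_commute)
  next
    case 2 show thesis by (rule that[of "Dn j k" "Up (j - 1) k"]) (simp_all add: 2 h Int_insert_left insert_commute)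
  next
    case 3 show thesis by (rule that[of "Dn j (k + 1)" "Up j k"]) (simp_all add: 3 h Int_insert_left insert_commute)
  next
    case 4 show thesis by (rule that[of "Dn j k" "Up j (k - 1)"]) (simp_all add: 4 h Int_insert_left insert_commute)
  next
    case 5 show thesis by (rule that[of "Dn (j + 1) k" "Up j (k - 1)"]) (simp_all add: 5 h Int_insert_left insert_commute)
  next
    case 6 show thesis by (rule that[of "Dn j (k + 1)" "Up (j - 1) k"]) (simp_all add: 6 h Int_insert_left insert_commute)
  qed
qed

section \<open>Cycles modulo 2 and the sets of faces they bound\<close>

lemma bit_add_self [simp]: "(x :: bit) + x = 0"
  by (cases x) auto

lemma bit_add_eq_0: "(x :: bit) + y = 0 \<longleftrightarrow> x = y"
  by (cases x; cases y) simp_all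

text \<open>Adds the degree equations at the two ends of the edge with value \<open>h\<close>, which
  cancels. This carries the jump rule from one column of hexagons to the next.\<close>

lemma bit_square:
  fixes a b e a' b' e' f g h :: bit
  assumes "a + b = e" "a' + b' = e'" "b + b' = f" "e + (g + h) = 0" "e' + (f + h) = 0"
  shows "a + a' = g"
  using assms(4,5) unfolding assms(1-3)[symmetric]
  by (cases a; cases b; cases a'; cases b'; cases g; cases h; simp)

lemma bit_triangle:
  fixes a b d :: bit
  assumes "a + b = e" "a + d = f" "e + (f + g) = 0"
  shows "b + d = g"
  using assms by (metis (full_types) add.commute add.left_commute add_0_right bit_add_self add.assoc)

text \<open>The vanishing of the first homology of the plane modulo 2, in discrete form:
  \<open>c\<close> is a finite chain of hexagons with boundary \<open>Z\<close>. Its jumps across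
  edges of type \<open>e1\<close> are right by construction, and the degree condition transfers this
  to the other two directions.\<close>

lemma potential:
  fixes Z :: "vtx \<Rightarrow> vtx \<Rightarrow> bit"
  assumes sym: "\<And>v w. Z v w = Z w v" and fin: "finite {v. \<exists>w\<in>nbrs v. Z v w \<noteq> 0}"
    and deg: "\<And>v. sum (Z v) (nbrs v) = 0"
  obtains c :: "int \<times> int \<Rightarrow> bit" where "finite {h. c h \<noteq> 0}"
    "\<And>v w h h'. w \<in> nbrs v \<Longrightarrow> hexs v \<inter> hexs w = {h, h'} \<Longrightarrow> h \<noteq> h' \<Longrightarrow> c h + c h' = Z v w"
proof -
  define crd where "crd v = (case v of Up j k \<Rightarrow> max \<bar>j\<bar> \<bar>k\<bar> | Dn j k \<Rightarrow> max \<bar>j\<bar> \<bar>k\<bar>)" for v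
  have "finite (crd ` {v. \<exists>w\<in>nbrs v. Z v w \<noteq> 0})" using fin by simp
  then obtain N where N: "\<And>v. \<exists>w\<in>nbrs v. Z v w \<noteq> 0 \<Longrightarrow> crd v \<le> N"
    by (metis (mono_tags, lifting) bdd_above.E bdd_above_finite image_eqI mem_Collect_eq)
  define e1 where "e1 j k = Z (Up j k) (Dn (j + 1) k)" for j k
  define e2 where "e2 j k = Z (Up j k) (Dn j (k + 1))" for j k
  define e3 where "e3 j k = Z (Up j k) (Dn (j + 1) (k + 1))" for j k
  have zero: "e1 j k = 0 \<and> e2 j k = 0" if "N < \<bar>j\<bar> \<or> N < \<bar>k\<bar>" for j k
  proof -
    have "\<not> crd (Up j k) \<le> N" using that by (auto simp: crd_def)
    then have "\<forall>w\<in>nbrs (Up j k). Z (Up j k) w = 0" using N by blast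
    then show ?thesis by (simp add: e1_def e2_def)
  qed
  have zeros: "N < j \<Longrightarrow> e1 j k = 0" "N < k \<Longrightarrow> e1 j k = 0" "k < - N \<Longrightarrow> e1 j k = 0"
    "N < j \<Longrightarrow> e2 j k = 0" "j < - N \<Longrightarrow> e2 j k = 0" for j k
    using zero[of j k] by linarith+
  have degU: "e1 j k + (e2 j k + e3 j k) = 0" for j k
    using deg[of "Up j k"] by (simp add: e1_def e2_def e3_def)
  have degD: "e1 j (k + 1) + (e2 (j + 1) k + e3 j k) = 0" for j k
    using deg[of "Dn (j + 1) (k + 1)"] by (simp add: e1_def e2_def e3_def sym[of "Dn _ _"])
  \<comment> \<open>the edges of \<open>Z\<close> crossed by the ray from the hexagon \<open>(j, k)\<close> in direction \<open>(1, 0)\<close>\<close>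
  define c where "c = (\<lambda>(j, k). \<Sum>i\<in>{j..N}. e1 i k)"
  have c0: "c (j, k) = 0" if "N < j" for j k using that by (simp add: c_def)
  have c1: "c (j, k) + c (j + 1, k) = e1 j k" for j k
  proof (cases "j \<le> N")
    case True
    then have "{j..N} = insert j {j + 1..N}" by auto
    then have "c (j, k) = e1 j k + c (j + 1, k)" by (simp add: c_def)
    then show ?thesis by (simp only: add.assoc bit_add_self add_0_right)
  next
    case False
    then have "e1 j k = 0" using zeros by simp
    then show ?thesis using False by (simp add: c_def)
  qed
  \<comment> \<open>Induction downwards from the column \<open>N + 1\<close>, where the rays are
    empty. Each step crosses one edge of type \<open>e1\<close> in each of the rows \<open>k\<close>
    and \<open>k + 1\<close>.\<close>
  have c2: "c (j, k) + c (j, k + 1) = e2 j k" for j k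
  proof (cases "j \<le> N + 1")
    case True
    then show ?thesis
    proof (induction j rule: int_le_induct)
      case base
      show ?case by (simp add: c_def zeros)
    next
      case (step j)
      have 1: "c (j - 1, k) + c (j, k) = e1 (j - 1) k" "c (j - 1, k + 1) + c (j, k + 1) = e1 (j - 1) (k + 1)"
        using c1[of "j - 1"] by simp_all
      have 2: "e1 (j - 1) (k + 1) + (e2 j k + e3 (j - 1) k) = 0"
        using degD[of "j - 1" k] by simp
      show ?case by (rule bit_square[OF 1 step(2) degU 2])
    qed
  qed (simp add: c_def zeros)
  have c3: "c (j + 1, k) + c (j, k + 1) = e3 j k" for j k
    by (rule bit_triangle[OF c1 c2 degU])
  \<comment> \<open>To the left of the support the ray runs through all of it, so \<open>c\<close>
    does not vanish by construction. But no edge of type \<open>e2\<close> in such a column carries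
    \<open>Z\<close>, so \<open>c\<close> is constant along the column, and it is 0 high up.\<close>
  have far: "c (j, k) = 0" if "j < - N" for j k
  proof (cases "k \<le> N + 1")
    case True
    then show ?thesis
    proof (induction k rule: int_le_induct)
      case base
      show ?case by (simp add: c_def zeros)
    next
      case (step k)
      then show ?case using c2[of j "k - 1"] that by (simp add: zeros)
    qed
  qed (simp add: c_def zeros)
  have "{h. c h \<noteq> 0} \<subseteq> {- N..N} \<times> {- N..N}"
  proof clarify
    fix j k assume "c (j, k) \<noteq> 0"
    moreover have "c (j, k) = 0" if "N < k \<or> k < - N" using that by (auto simp: c_def zeros)
    ultimately show "j \<in> {- N..N} \<and> k \<in> {- N..N}"
      using far[of j k] c0[of j k] by force
  qed
  then have "finite {h. c h \<noteq> 0}" by (rule finite_subset) simp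
  moreover have main: "c h + c h' = Z v w"
    if w: "w \<in> nbrs v" and hh: "hexs v \<inter> hexs w = {h, h'}" "h \<noteq> h'" and v: "v = Up j k"
    for v w h h' j k
  proof -
    consider "w = Dn (j + 1) k" | "w = Dn j (k + 1)" | "w = Dn (j + 1) (k + 1)"
      using w unfolding v by auto
    then show ?thesis
    proof cases
      case 1
      have "hexs v \<inter> hexs w = {(j, k), (j + 1, k)}" unfolding 1 v by auto
      then have "{h, h'} = {(j, k), (j + 1, k)}" using hh(1) by simp
      then have "c h + c h' = e1 j k" using c1[of j k] by (metis doubleton_eq_iff add.commute)
      then show ?thesis by (simp only: e1_def 1 v)
    next
      case 2
      have "hexs v \<inter> hexs w = {(j, k), (j, k + 1)}" unfolding 2 v by auto
      then have "{h, h'} = {(j, k), (j, k + 1)}" using hh(1) by simp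
      then have "c h + c h' = e2 j k" using c2[of j k] by (metis doubleton_eq_iff add.commute)
      then show ?thesis by (simp only: e2_def 2 v)
    next
      case 3
      have "hexs v \<inter> hexs w = {(j + 1, k), (j, k + 1)}" unfolding 3 v by auto
      then have "{h, h'} = {(j + 1, k), (j, k + 1)}" using hh(1) by simp
      then have "c h + c h' = e3 j k" using c3[of j k] by (metis doubleton_eq_iff add.commute)
      then show ?thesis by (simp only: e3_def 3 v)
    qed
  qed
  have "c h + c h' = Z v w" if "w \<in> nbrs v" "hexs v \<inter> hexs w = {h, h'}" "h \<noteq> h'" for v w h h'
  proof (cases v)
    case (Up j k)
    then show ?thesis using main that by blast
  next
    case (Dn j k)
    have "\<exists>j' k'. w = Up j' k'" by (cases w) (use that(1) Dn in simp_all)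
    moreover have "v \<in> nbrs w" "hexs w \<inter> hexs v = {h, h'}" using that nbrs_sym by auto
    ultimately show ?thesis using main that(3) sym by metis
  qed
  ultimately show thesis by (rule that)
qed

text \<open>\<open>hexs y \<inter> hexs z\<close> are the two hexagons beside the edge, so this
  places the edge in the closed region, possibly on its boundary.\<close>

definition edge_in :: "(int \<times> int) set \<Rightarrow> vtx \<Rightarrow> vtx \<Rightarrow> bool" where
  "edge_in C y z \<longleftrightarrow> z \<in> nbrs y \<and> hexs y \<inter> hexs z \<inter> C \<noteq> {}"

lemma edge_in_sym: "edge_in C y z \<Longrightarrow> edge_in C z y"
  by (auto simp: edge_in_def nbrs_sym)

text \<open>\<open>None\<close> is the single face into which all hexagons outside \<open>C\<close>
  are merged.\<close>

definition faces :: "(int \<times> int) set \<Rightarrow> vtx set \<Rightarrow> (int \<times> int) option set" where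
  "faces C X = (\<lambda>h. if h \<in> C then Some h else None) ` (\<Union>v\<in>X. hexs v)"

text \<open>The closure is reflexive also at vertices of \<open>X\<close>; this is why
  \<open>reach\<close> excludes these vertices separately.\<close>

definition free_conn :: "(int \<times> int) set \<Rightarrow> vtx set \<Rightarrow> (vtx \<times> vtx) set" where
  "free_conn C X = {(u, w). edge_in C u w \<and> u \<notin> X \<and> w \<notin> X}\<^sup>*"


definition edge_ind :: "vtx \<Rightarrow> vtx \<Rightarrow> vtx \<Rightarrow> vtx \<Rightarrow> bit" where
  "edge_ind a b v w = of_bool (v = a \<and> w = b \<or> v = b \<and> w = a)"

lemma edge_ind_deg:
  assumes "b \<in> nbrs a"
  shows "sum (edge_ind a b v) (nbrs v) = of_bool (v = a) + of_bool (v = b)"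
proof -
  have "a \<noteq> b" using assms by auto
  consider "v = a" | "v = b" | "v \<noteq> a" "v \<noteq> b" by auto
  then show ?thesis
  proof cases
    case 1
    have "edge_ind a b v = (\<lambda>w. if w = b then 1 else 0)"
      using 1 \<open>a \<noteq> b\<close> by (auto simp: edge_ind_def fun_eq_iff)
    then show ?thesis using 1 assms \<open>a \<noteq> b\<close> by simp
  next
    case 2
    have "edge_ind a b v = (\<lambda>w. if w = a then 1 else 0)"
      using 2 \<open>a \<noteq> b\<close> by (auto simp: edge_ind_def fun_eq_iff)
    then show ?thesis using 2 nbrs_sym[OF assms] \<open>a \<noteq> b\<close> by simp
  qed (simp add: edge_ind_def)
qed

lemma edge_ind_sym: "edge_ind a b v w = edge_ind a b w v"
  by (simp add: edge_ind_def disj_commute conj_commute)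

lemma edge_ind_nz: "edge_ind a b v w \<noteq> 0 \<Longrightarrow> v = a \<and> w = b \<or> v = b \<and> w = a"
  by (simp add: edge_ind_def)

text \<open>The sum modulo 2 of the edges of a connecting walk. Repeated edges cancel, so the walk
  need not be simple, and only its two ends can keep an odd degree.\<close>

lemma cycle_chain:
  assumes "(p, q) \<in> free_conn C X"
  obtains Z :: "vtx \<Rightarrow> vtx \<Rightarrow> bit" where "\<And>v w. Z v w = Z w v"
    "\<And>v w. Z v w \<noteq> 0 \<Longrightarrow> edge_in C v w \<and> v \<notin> X \<and> w \<notin> X" "finite {v. \<exists>w. Z v w \<noteq> 0}"
    "\<And>v. sum (Z v) (nbrs v) = of_bool (v = p) + of_bool (v = q)"
proof -
  have "\<exists>Z :: vtx \<Rightarrow> vtx \<Rightarrow> bit. (\<forall>v w. Z v w = Z w v) \<and>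
    (\<forall>v w. Z v w \<noteq> 0 \<longrightarrow> edge_in C v w \<and> v \<notin> X \<and> w \<notin> X) \<and> finite {v. \<exists>w. Z v w \<noteq> 0} \<and>
    (\<forall>v. sum (Z v) (nbrs v) = of_bool (v = p) + of_bool (v = q))"
    using assms unfolding free_conn_def
  proof (induction rule: rtrancl_induct)
    case base
    show ?case by (rule exI[of _ "\<lambda>_ _. 0"]) simp
  next
    case (step q q')
    then obtain Z :: "vtx \<Rightarrow> vtx \<Rightarrow> bit" where Z: "\<And>v w. Z v w = Z w v"
      "\<And>v w. Z v w \<noteq> 0 \<Longrightarrow> edge_in C v w \<and> v \<notin> X \<and> w \<notin> X" "finite {v. \<exists>w. Z v w \<noteq> 0}"
      "\<And>v. sum (Z v) (nbrs v) = of_bool (v = p) + of_bool (v = q)" by blast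
    have e: "edge_in C q q'" "q \<notin> X" "q' \<notin> X" using step(2) by auto
    define Z' where "Z' v w = Z v w + edge_ind q q' v w" for v w
    have "Z' v w = 0" if "Z v w = 0" "edge_ind q q' v w = 0" for v w
      using that by (simp only: Z'_def add_0_left)
    then have nz: "Z v w \<noteq> 0 \<or> edge_ind q q' v w \<noteq> 0" if "Z' v w \<noteq> 0" for v w
      using that by blast
    have "Z' v w = Z' w v" for v w by (simp only: Z'_def Z(1)[of v w] edge_ind_sym[of q q' v w])
    moreover have "edge_in C v w \<and> v \<notin> X \<and> w \<notin> X" if "Z' v w \<noteq> 0" for v w
      using nz[OF that] Z(2)[of v w] edge_ind_nz[of q q' v w] e edge_in_sym[OF e(1)] by blast
    moreover have "finite {v. \<exists>w. Z' v w \<noteq> 0}"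
    proof (rule finite_subset)
      show "{v. \<exists>w. Z' v w \<noteq> 0} \<subseteq> {v. \<exists>w. Z v w \<noteq> 0} \<union> {q, q'}"
        using nz edge_ind_nz by blast
    qed (use Z(3) in simp)
    moreover have "sum (Z' v) (nbrs v) = of_bool (v = p) + of_bool (v = q')" for v
    proof -
      have "q' \<in> nbrs q" using e by (simp add: edge_in_def)
      have "sum (Z' v) (nbrs v) = (of_bool (v = p) + of_bool (v = q)) + (of_bool (v = q) + of_bool (v = q'))"
        unfolding Z'_def sum.distrib Z(4) edge_ind_deg[OF \<open>q' \<in> nbrs q\<close>] by (rule refl)
      also have "\<dots> = of_bool (v = p) + of_bool (v = q')"
        by (metis add.assoc add_0_left bit_add_self)
      finally show ?thesis .
    qed
    ultimately show ?case by blast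
  qed
  then show thesis using that by blast
qed

lemma common_hex:
  assumes "w \<in> nbrs v"
  shows "\<exists>g. g \<in> hexs v \<and> g \<in> hexs w"
proof (rule tripod[OF assms])
  fix L R assume "hexs v \<inter> hexs w = {L, R}"
  then show ?thesis by (metis IntE insertI1)
qed

lemma hex_pair_nbr:
  assumes "g \<in> hexs v" "g' \<in> hexs v" "g \<noteq> g'"
  shows "\<exists>w\<in>nbrs v. hexs v \<inter> hexs w = {g, g'}"
proof -
  obtain u where "u \<in> nbrs v" by (cases v) auto
  then show ?thesis
  proof (rule tripod)
    fix L R F l r
    assume t: "nbrs v = {u, l, r}" "hexs v = {L, R, F}" "hexs v \<inter> hexs u = {L, R}"
      "hexs v \<inter> hexs l = {L, F}" "hexs v \<inter> hexs r = {R, F}"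
    have "{g, g'} = {L, R} \<or> {g, g'} = {L, F} \<or> {g, g'} = {R, F}"
      using assms unfolding t(2) by blast
    then show ?thesis using t(3-5) unfolding t(1) by (metis insertI1 insertI2)
  qed
qed

text \<open>Consecutive vertices share a hexagon, so constancy around each single vertex propagates
  along the walk.\<close>

lemma sep_const:
  assumes "successively (\<lambda>u w. w \<in> nbrs u) xs"
    and "\<And>v h h'. v \<in> set xs \<Longrightarrow> h \<in> hexs v \<Longrightarrow> h' \<in> hexs v \<Longrightarrow> c h = c h'"
  shows "v \<in> set xs \<Longrightarrow> v' \<in> set xs \<Longrightarrow> h \<in> hexs v \<Longrightarrow> h' \<in> hexs v' \<Longrightarrow> c h = c h'"
  using assms
proof (induction xs arbitrary: v v' h h')
  case (Cons x xs)
  show ?case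
  proof (cases xs)
    case Nil
    then show ?thesis using Cons.prems(1-4) Cons.prems(6)[of x h h'] by simp
  next
    case (Cons y ys)
    have xy: "y \<in> nbrs x" "successively (\<lambda>u w. w \<in> nbrs u) xs" using Cons.prems(5) Cons by auto
    obtain g where g: "g \<in> hexs x" "g \<in> hexs y" using common_hex[OF xy(1)] by blast
    have "c f = c g" if "w \<in> set (x # xs)" "f \<in> hexs w" for w f
    proof (cases "w = x")
      case True
      then show ?thesis using Cons.prems(6)[of x f g] g that by simp
    next
      case False
      then have "w \<in> set xs" using that by simp
      moreover have "y \<in> set xs" using Cons by simp
      ultimately show ?thesis
        by (rule Cons.IH[OF _ _ that(2) g(2) xy(2) Cons.prems(6)[OF list.set_intros(2)]])
    qed
    from this[of v h] this[of v' h'] show ?thesis using Cons.prems(1-4) by simp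
  qed
qed simp

text \<open>The connection between \<open>l\<close> and \<open>r\<close> is closed up through
  \<open>y\<close> to the cycle \<open>Z'\<close>, and \<open>c\<close> is its interior. No edge of
  \<open>Z'\<close> ends at a vertex of \<open>xs\<close>, so \<open>c\<close> is constant on the
  faces of the past, to which \<open>L\<close> belongs because of \<open>x\<close>. It changes
  between \<open>L\<close> and \<open>F\<close>, since the edge from \<open>y\<close> to
  \<open>l\<close> belongs to \<open>Z'\<close>.\<close>

lemma separation:
  assumes y: "nbrs y = {x, l, r}" "x \<noteq> l" "x \<noteq> r" "l \<noteq> r"
    and h: "hexs y = {L, R, F}" "L \<noteq> R" "L \<noteq> F" "R \<noteq> F"
      "hexs y \<inter> hexs x = {L, R}" "hexs y \<inter> hexs l = {L, F}" "hexs y \<inter> hexs r = {R, F}"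
    and edge_in: "edge_in C y l" "edge_in C y r" and lr: "(l, r) \<in> free_conn C X" "l \<notin> X" "r \<notin> X"
    and X: "X = insert y (set xs)" "y \<notin> set xs" "x \<in> set xs"
    and xs: "successively (\<lambda>u w. w \<in> nbrs u) xs"
    and esc: "\<And>h. h \<notin> C \<Longrightarrow> infinite {h'. (h, h') \<in> {(a, b). a \<notin> C \<and> b \<notin> C \<and> hadj a b}\<^sup>*}"
  shows "(if F \<in> C then Some F else None) \<notin> faces C (set xs)"
proof
  assume old: "(if F \<in> C then Some F else None) \<in> faces C (set xs)"
  obtain Z :: "vtx \<Rightarrow> vtx \<Rightarrow> bit" where Z: "\<And>v w. Z v w = Z w v"
      "\<And>v w. Z v w \<noteq> 0 \<Longrightarrow> edge_in C v w \<and> v \<notin> X \<and> w \<notin> X" "finite {v. \<exists>w. Z v w \<noteq> 0}"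
      "\<And>v. sum (Z v) (nbrs v) = of_bool (v = l) + of_bool (v = r)"
    using cycle_chain[OF lr(1)] by blast
  define Z' where "Z' v w = Z v w + (edge_ind y l v w + edge_ind y r v w)" for v w
  have "Z' v w = 0" if "Z v w = 0" "edge_ind y l v w = 0" "edge_ind y r v w = 0" for v w
    using that by (simp only: Z'_def add_0_left)
  then have nz: "Z v w \<noteq> 0 \<or> edge_ind y l v w \<noteq> 0 \<or> edge_ind y r v w \<noteq> 0" if "Z' v w \<noteq> 0" for v w
    using that by blast
  have sym: "Z' v w = Z' w v" for v w
    by (simp only: Z'_def Z(1)[of v w] edge_ind_sym[of y l v w] edge_ind_sym[of y r v w])
  have fin: "finite {v. \<exists>w\<in>nbrs v. Z' v w \<noteq> 0}"
  proof (rule finite_subset)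
    show "{v. \<exists>w\<in>nbrs v. Z' v w \<noteq> 0} \<subseteq> {v. \<exists>w. Z v w \<noteq> 0} \<union> {y, l, r}"
      using nz edge_ind_nz by blast
  qed (use Z(3) in simp)
  have ly: "l \<in> nbrs y" "r \<in> nbrs y" using y by auto
  have deg: "sum (Z' v) (nbrs v) = 0" for v
  proof -
    have "sum (Z' v) (nbrs v) = (of_bool (v = l) + of_bool (v = r)) +
        ((of_bool (v = y) + of_bool (v = l)) + (of_bool (v = y) + of_bool (v = r)))"
      unfolding Z'_def sum.distrib Z(4) edge_ind_deg[OF ly(1)] edge_ind_deg[OF ly(2)] by (rule refl)
    also have "\<dots> = 0"
      by (cases "v = l"; cases "v = r"; cases "v = y"; simp)
    finally show ?thesis .
  qed
  obtain c :: "int \<times> int \<Rightarrow> bit" where c: "finite {h. c h \<noteq> 0}"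
    "\<And>v w h h'. w \<in> nbrs v \<Longrightarrow> hexs v \<inter> hexs w = {h, h'} \<Longrightarrow> h \<noteq> h' \<Longrightarrow> c h + c h' = Z' v w"
    using potential[OF sym fin deg] by blast
  have gZ: "edge_in C v w" if "Z' v w \<noteq> 0" for v w
    using nz[OF that] Z(2)[of v w] edge_ind_nz[of y l v w] edge_ind_nz[of y r v w]
      edge_in edge_in_sym[OF edge_in(1)] edge_in_sym[OF edge_in(2)] by blast
  \<comment> \<open>The edge between two adjacent hexagons outside \<open>C\<close> is not in the
    region, hence not in \<open>Z'\<close>. So \<open>c\<close> is constant on the whole outside
    component, which is infinite, whereas its support is finite.\<close>
  have c0: "c h = 0" if "h \<notin> C" for h
  proof -
    have const_step: "c a = c b" if ab: "a \<notin> C" "b \<notin> C" "hadj a b" for a b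
    proof -
      obtain v w where vw: "w \<in> nbrs v" "hexs v \<inter> hexs w = {a, b}" "a \<noteq> b" by (rule hadj_edge[OF ab(3)])
      then have "\<not> edge_in C v w" using ab by (auto simp: edge_in_def)
      then have "Z' v w = 0" using gZ by blast
      then show ?thesis using c(2)[OF vw] by (simp only: bit_add_eq_0)
    qed
    have const_comp: "c h' = c h" if "(h, h') \<in> {(a, b). a \<notin> C \<and> b \<notin> C \<and> hadj a b}\<^sup>*" for h'
      using that
    proof (induction rule: rtrancl_induct)
      case (step b d)
      then have "c b = c d" by (intro const_step) auto
      then show ?case using step.IH by simp
    qed simp
      have "{h'. (h, h') \<in> {(a, b). a \<notin> C \<and> b \<notin> C \<and> hadj a b}\<^sup>*} \<subseteq> {g. c g \<noteq> 0}" if "c h \<noteq> 0"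
    proof
      fix h' assume "h' \<in> {h'. (h, h') \<in> {(a, b). a \<notin> C \<and> b \<notin> C \<and> hadj a b}\<^sup>*}"
      then have "c h' = c h" using const_comp by blast
      with that show "h' \<in> {g. c g \<noteq> 0}" by simp
    qed
    then show ?thesis using esc[OF that] c(1) finite_subset by blast
  qed
  have c1: "c g = c g'" if v: "v \<in> set xs" "g \<in> hexs v" "g' \<in> hexs v" for v g g'
  proof (cases "g = g'")
    case False
    have vX: "v \<in> X" "v \<noteq> y" "v \<noteq> l" "v \<noteq> r" using v X lr by auto
    obtain w where w: "w \<in> nbrs v" "hexs v \<inter> hexs w = {g, g'}"
      using hex_pair_nbr[OF v(2,3) False] by blast
    have "Z v w = 0" using Z(2)[of v w] vX by blast
    moreover have "edge_ind y l v w = 0" "edge_ind y r v w = 0" using edge_ind_nz[of y _ v w] vX by blast+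
    ultimately have "Z' v w = 0" unfolding Z'_def by simp
    then show ?thesis using c(2)[OF w False] by (simp only: bit_add_eq_0)
  qed simp
  have const: "c g = c g'" if "v \<in> set xs" "v' \<in> set xs" "g \<in> hexs v" "g' \<in> hexs v'" for v v' g g'
    by (rule sep_const[where c = c, OF xs c1 that])
  have "Z' y l = 1"
  proof -
    have "Z y l = 0" using Z(2)[of y l] X(1) by blast
    then show ?thesis using y by (auto simp: Z'_def edge_ind_def)
  qed
  then have LF: "c L + c F = 1" using c(2)[OF ly(1) h(6) h(3)] by (simp only:)
  have Lx: "L \<in> hexs x" using h by auto
  obtain v g where vg: "v \<in> set xs" "g \<in> hexs v"
      "(if F \<in> C then Some F else None) = (if g \<in> C then Some g else None)"
    using old unfolding faces_def by blast
  \<comment> \<open>If \<open>F\<close> is outside \<open>C\<close>, then touched only means that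
    some outside hexagon \<open>g\<close> has been touched; \<open>c\<close> is 0 on both.\<close>
  have "c g = c F"
  proof (cases "F \<in> C")
    case True
    then show ?thesis using vg(3) by (auto split: if_splits)
  next
    case False
    then have "g \<notin> C" using vg(3) by (auto split: if_splits)
    then show ?thesis using c0 False by simp
  qed
  moreover have "c L = c g" using const X(3) vg(1,2) Lx by blast
  ultimately have "c L = c F" by (simp only:)
  then show False using LF by (simp only: bit_add_self zero_neq_one)
qed

section \<open>Parity of the edges between the past and the reachable vertices\<close>

lemma bit_add_left_self: "(x :: bit) + (x + y) = y"
  by (cases x; cases y; simp)

text \<open>\<open>f\<close> and \<open>b\<close> are the contributions to a corner from the next
  and from the previous corner of a hexagon. After regrouping by sides every corner value
  \<open>r\<close> occurs twice.\<close>

lemma bit_cycle6: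
  fixes f1 :: bit
  assumes "f1 + b2 = r1 + r2" "f2 + b3 = r2 + r3" "f3 + b4 = r3 + r4"
    "f4 + b5 = r4 + r5" "f5 + b6 = r5 + r6" "f6 + b1 = r6 + r1"
  shows "(b1 + f1) + ((b2 + f2) + ((b3 + f3) + ((b4 + f4) + ((b5 + f5) + (b6 + f6))))) = 0"
proof -
  have "(b1 + f1) + ((b2 + f2) + ((b3 + f3) + ((b4 + f4) + ((b5 + f5) + (b6 + f6))))) =
    (f1 + b2) + ((f2 + b3) + ((f3 + b4) + ((f4 + b5) + ((f5 + b6) + (f6 + b1)))))"
    by (simp only: ac_simps)
  also have "\<dots> = 0"
    unfolding assms by (simp only: ac_simps bit_add_self bit_add_left_self add_0_right)
  finally show ?thesis .
qed

text \<open>For a corner \<open>q\<close> of \<open>h\<close> the sum runs over the two neighbours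
  of \<open>q\<close> on the boundary of \<open>h\<close>: it records whether membership in
  \<open>R\<close> changes when turning about \<open>q\<close> through the hexagon.\<close>

definition rot :: "vtx set \<Rightarrow> vtx \<Rightarrow> int \<times> int \<Rightarrow> bit" where
  "rot R q h = (\<Sum>p\<in>{p \<in> nbrs q. h \<in> hexs p}. of_bool (p \<in> R))"

lemma rot_pair:
  assumes "{p \<in> nbrs q. h \<in> hexs p} = {a, b}" "a \<noteq> b"
  shows "rot R q h = of_bool (a \<in> R) + of_bool (b \<in> R)"
  unfolding rot_def assms(1) using assms(2) by (simp del: sum_of_bool_eq)

text \<open>The sum is the parity of the number of sides of \<open>h\<close> between
  \<open>X\<close> and \<open>R\<close>. By \<open>closed\<close> and \<open>RX\<close> these are
  exactly the sides along which membership in \<open>R\<close> changes, and once around the hexagon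
  the number of changes is even. All sides are in the region because \<open>h\<close> is.\<close>

lemma hexagon_parity:
  assumes X: "finite X" and RX: "R \<inter> X = {}" and h: "h \<in> C"
    and closed: "\<And>p q. edge_in C p q \<Longrightarrow> p \<in> R \<Longrightarrow> q \<notin> X \<Longrightarrow> q \<in> R"
  shows "(\<Sum>q\<in>{q \<in> X. h \<in> hexs q}. rot R q h) = 0"
proof -
  obtain j k where jk: "h = (j, k)" by (cases h)
  define A1 A2 A3 A4 A5 A6
    where A: "A1 = Up j k" "A2 = Dn j (k + 1)" "A3 = Up (j - 1) k"
      "A4 = Dn j k" "A5 = Up j (k - 1)" "A6 = Dn (j + 1) k"
  have corners: "h \<in> hexs q \<longleftrightarrow> q \<in> {A1, A2, A3, A4, A5, A6}" for q
    by (cases q) (auto simp: A jk)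
  have dist: "distinct [A1, A2, A3, A4, A5, A6]" by (simp add: A)
  have nb: "{p \<in> nbrs A1. h \<in> hexs p} = {A6, A2}" "{p \<in> nbrs A2. h \<in> hexs p} = {A1, A3}"
    "{p \<in> nbrs A3. h \<in> hexs p} = {A2, A4}" "{p \<in> nbrs A4. h \<in> hexs p} = {A3, A5}"
    "{p \<in> nbrs A5. h \<in> hexs p} = {A4, A6}" "{p \<in> nbrs A6. h \<in> hexs p} = {A5, A1}"
    unfolding corners by (auto simp: A)
  define r :: "vtx \<Rightarrow> bit" where "r p = of_bool (p \<in> R)" for p
  have rot: "rot R A1 h = r A6 + r A2" "rot R A2 h = r A1 + r A3" "rot R A3 h = r A2 + r A4"
    "rot R A4 h = r A3 + r A5" "rot R A5 h = r A4 + r A6" "rot R A6 h = r A5 + r A1"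
    unfolding rot_def nb r_def using dist by auto
  define on where "on q b = (if q \<in> X then b else 0)" for q and b :: bit
  have on_add: "on q (a + b) = on q a + on q b" for q a b by (simp add: on_def)
  have edge: "on p (r q) + on q (r p) = r p + r q" if "q \<in> nbrs p" "h \<in> hexs p" "h \<in> hexs q" for p q
  proof -
    have "edge_in C p q" "edge_in C q p" using that h nbrs_sym by (auto simp: edge_in_def)
    then have "p \<notin> X \<Longrightarrow> q \<notin> X \<Longrightarrow> p \<in> R \<longleftrightarrow> q \<in> R" using closed by blast
    moreover have "u \<in> X \<Longrightarrow> r u = 0" for u using RX by (auto simp: r_def)
    ultimately show ?thesis
      by (cases "p \<in> X"; cases "q \<in> X") (simp_all add: on_def r_def)
  qed
  have "(\<Sum>q\<in>{q \<in> X. h \<in> hexs q}. rot R q h) = (\<Sum>q\<in>{A1, A2, A3, A4, A5, A6} \<inter> X. rot R q h)"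
    by (rule sum.cong) (use corners in auto)
  also have "\<dots> = (\<Sum>q\<in>{A1, A2, A3, A4, A5, A6}. on q (rot R q h))"
    unfolding on_def by (rule sum.inter_restrict) simp
  also have "\<dots> = on A1 (rot R A1 h) + (on A2 (rot R A2 h) + (on A3 (rot R A3 h) +
      (on A4 (rot R A4 h) + (on A5 (rot R A5 h) + on A6 (rot R A6 h)))))"
    using dist by (simp only: sum.insert finite.intros distinct.simps list.set insert_iff empty_iff
        simp_thms sum.empty add_0_right)
  also have "\<dots> = 0"
    unfolding rot on_add
    by (rule bit_cycle6; rule edge) (simp_all add: A jk)
  finally show ?thesis .
qed

text \<open>Every neighbour of \<open>q\<close> is counted on the two hexagons beside its
  edge.\<close>

lemma rot_sum_hexs: "(\<Sum>h\<in>hexs q. rot R q h) = 0"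
proof -
  obtain u where "u \<in> nbrs q" by (cases q) auto
  then show ?thesis
  proof (rule tripod)
    fix L R' F l r
    assume t: "nbrs q = {u, l, r}" "u \<noteq> l" "u \<noteq> r" "l \<noteq> r"
      "hexs q = {L, R', F}" "L \<noteq> R'" "L \<noteq> F" "R' \<noteq> F"
      "hexs q \<inter> hexs u = {L, R'}" "hexs q \<inter> hexs l = {L, F}" "hexs q \<inter> hexs r = {R', F}"
    have "{p \<in> nbrs q. L \<in> hexs p} = {u, l}" "{p \<in> nbrs q. R' \<in> hexs p} = {u, r}"
      "{p \<in> nbrs q. F \<in> hexs p} = {l, r}"
      using t by auto
    note rots = this[THEN rot_pair, of R]
    have "(\<Sum>h\<in>hexs q. rot R q h) = rot R q L + (rot R q R' + rot R q F)"
      unfolding t(5) using t(6-8) by simp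
    also have "\<dots> = 0"
      unfolding rots(1)[OF t(2)] rots(2)[OF t(3)] rots(3)[OF t(4)]
      by (simp only: ac_simps bit_add_self bit_add_left_self add_0_right)
    finally show ?thesis .
  qed
qed

text \<open>Double counting: sum \<open>rot R q h\<close> over the hexagons \<open>h\<close> of \<open>C\<close> and their corners \<open>q\<close> in
  \<open>X\<close>. Every vertex of \<open>X\<close> which is interior to \<open>C\<close> contributes \<open>0\<close>.\<close>

lemma tip_parity:
  assumes X: "finite X" "y \<in> X" and RX: "R \<inter> X = {}"
    and closed: "\<And>p q. edge_in C p q \<Longrightarrow> p \<in> R \<Longrightarrow> q \<notin> X \<Longrightarrow> q \<in> R"
    and int: "\<And>q. q \<in> X \<Longrightarrow> q \<noteq> y \<Longrightarrow> hexs q \<subseteq> C"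
  shows "(\<Sum>h\<in>hexs y \<inter> C. rot R y h) = 0"
proof -
  define H where "H = (\<Union>q\<in>X. hexs q) \<inter> C"
  have H: "finite H" using X by (simp add: H_def)
  have "0 = (\<Sum>h\<in>H. \<Sum>q\<in>{q \<in> X. h \<in> hexs q}. rot R q h)"
    by (rule sum.neutral[symmetric]) (use hexagon_parity[OF X(1) RX _ closed] in \<open>auto simp: H_def\<close>)
  also have "\<dots> = (\<Sum>q\<in>X. \<Sum>h\<in>{h \<in> H. h \<in> hexs q}. rot R q h)"
    by (rule sum.swap_restrict[OF H X(1)])
  also have "\<dots> = (\<Sum>q\<in>X. if q = y then \<Sum>h\<in>hexs y \<inter> C. rot R y h else 0)"
  proof (rule sum.cong[OF refl])
    fix q assume q: "q \<in> X"
    have eq: "{h \<in> H. h \<in> hexs q} = hexs q \<inter> C" using q by (auto simp: H_def)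
    have "(\<Sum>h\<in>hexs q \<inter> C. rot R q h) = (if q = y then \<Sum>h\<in>hexs y \<inter> C. rot R y h else 0)"
    proof (cases "q = y")
      case False
      then have "hexs q \<inter> C = hexs q" using int q by auto
      then show ?thesis using False rot_sum_hexs by simp
    qed simp
    then show "(\<Sum>h\<in>{h \<in> H. h \<in> hexs q}. rot R q h) = (if q = y then \<Sum>h\<in>hexs y \<inter> C. rot R y h else 0)"
      by (simp only: eq)
  qed
  also have "\<dots> = (\<Sum>h\<in>hexs y \<inter> C. rot R y h)" using X by (simp add: sum.delta)
  finally show ?thesis by simp
qed

section \<open>Reachability and the number of allowed continuations\<close>

definition reach :: "(int \<times> int) set \<Rightarrow> vtx set \<Rightarrow> vtx set \<Rightarrow> vtx set" where
  "reach C T X = {z. z \<notin> X \<and> (\<exists>\<tau>\<in>T. \<tau> \<notin> X \<and> (z, \<tau>) \<in> free_conn C X)}"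

lemma free_conn_sym: "(u, w) \<in> free_conn C X \<Longrightarrow> (w, u) \<in> free_conn C X"
  unfolding free_conn_def
  by (rule symD[OF sym_rtrancl]) (auto simp: sym_def edge_in_sym)

lemma free_conn_trans: "(u, v) \<in> free_conn C X \<Longrightarrow> (v, w) \<in> free_conn C X \<Longrightarrow> (u, w) \<in> free_conn C X"
  unfolding free_conn_def by (rule rtrancl_trans)

lemma free_conn_edge: "edge_in C u w \<Longrightarrow> u \<notin> X \<Longrightarrow> w \<notin> X \<Longrightarrow> (u, w) \<in> free_conn C X"
  unfolding free_conn_def by blast

lemma free_conn_refl: "(u, u) \<in> free_conn C X"
  unfolding free_conn_def by blast

lemma reach_target: "z \<in> T \<Longrightarrow> z \<notin> X \<Longrightarrow> z \<in> reach C T X"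
  using free_conn_refl by (auto simp: reach_def)

lemma reach_step: "edge_in C p q \<Longrightarrow> p \<in> reach C T X \<Longrightarrow> q \<notin> X \<Longrightarrow> q \<in> reach C T X"
  unfolding reach_def
  using free_conn_edge[of C q p X] free_conn_trans edge_in_sym by blast

text \<open>An exploration in which \<open>hA y z\<close> says that the half-edge from \<open>y\<close> towards \<open>z\<close> may be used,
  \<open>isT y z\<close> that the target is the centre of the edge between \<open>y\<close> and \<open>z\<close>, and \<open>T\<close> are the
  vertices from which the target can be entered.\<close>

locale hex_exploration =
  fixes C :: "(int \<times> int) set" and T :: "vtx set" and hA isT :: "vtx \<Rightarrow> vtx \<Rightarrow> bool"
  assumes hA_edge_in: "edge_in C y z \<Longrightarrow> hA y z" and hA_nbrs: "hA y z \<Longrightarrow> z \<in> nbrs y"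
    and T_edge_in: "u \<in> T \<Longrightarrow> w \<in> T \<Longrightarrow> u \<noteq> w \<Longrightarrow> edge_in C u w"
    and isT_edge_in: "isT y z \<Longrightarrow> edge_in C y z \<Longrightarrow> z \<in> T"
    and isT_hA: "isT y z \<Longrightarrow> hA y z \<Longrightarrow> T \<subseteq> {y, z}"
    and isT_unique: "isT y z \<Longrightarrow> isT y z' \<Longrightarrow> z \<in> nbrs y \<Longrightarrow> z' \<in> nbrs y \<Longrightarrow> z = z'"
    and hA_not_edge_in: "hA y z \<Longrightarrow> \<not> edge_in C y z \<Longrightarrow> T \<subseteq> {y}"
    and unbounded_outside:
      "h \<notin> C \<Longrightarrow> infinite {h'. (h, h') \<in> {(a, b). a \<notin> C \<and> b \<notin> C \<and> hadj a b}\<^sup>*}"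
begin

text \<open>\<open>z\<close> stands for the mid-edge between \<open>y\<close> and \<open>z\<close>.
  The alternative \<open>isT y z\<close> is separate because the target may be this very mid-edge
  although \<open>z\<close> itself is already visited or cut off.\<close>

definition allow :: "vtx list \<Rightarrow> vtx \<Rightarrow> vtx set" where
  "allow xs y = {z \<in> nbrs y. z \<noteq> last xs \<and> hA y z \<and> (isT y z \<or> z \<in> reach C T (insert y (set xs)))}"

text \<open>If \<open>z\<close> were allowed only because the target lies on its edge, the entrances
  would be among \<open>y\<close> and \<open>z\<close>. The other candidate reaches an entrance off
  the past, which must be \<open>z\<close>; so \<open>z\<close> is free and an entrance
  itself.\<close>

lemma reach_if_both_allowed:
  assumes z: "z \<in> allow xs y" and w: "w \<in> allow xs y" and "z \<noteq> w"
  shows "z \<in> reach C T (insert y (set xs))"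
proof (rule ccontr)
  assume nz: "z \<notin> reach C T (insert y (set xs))"
  have a: "z \<in> nbrs y" "w \<in> nbrs y" "hA y z" "isT y z"
    "isT y w \<or> w \<in> reach C T (insert y (set xs))"
    using z w nz by (auto simp: allow_def)
  then have "w \<in> reach C T (insert y (set xs))" using isT_unique[of y z w] \<open>z \<noteq> w\<close> by blast
  then obtain u where u: "u \<in> T" "u \<notin> insert y (set xs)" by (auto simp: reach_def)
  then have "u = z" using isT_hA[OF a(4,3)] by blast
  then show False using u nz reach_target by blast
qed

text \<open>\<open>L\<close> and \<open>R\<close> are already touched by \<open>last xs\<close>, so
  \<open>y\<close> adds at most the face \<open>F\<close> and the exponent is 0 or 1. Dead ends are
  excluded by \<open>ne\<close>; for a finished path this is supplied by
  \<open>epath_continue\<close>.\<close>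

theorem card_allow:
  assumes x: "last xs \<in> nbrs y" "xs \<noteq> []" "y \<notin> set xs" "successively (\<lambda>u w. w \<in> nbrs u) xs"
    and ne: "allow xs y \<noteq> {}"
  shows "card (allow xs y) = 2 ^ (card (faces C (insert y (set xs))) - card (faces C (set xs)))"
proof (rule tripod[OF x(1)])
  fix L R F l r
  assume n: "nbrs y = {last xs, l, r}" "last xs \<noteq> l" "last xs \<noteq> r" "l \<noteq> r"
    and h: "hexs y = {L, R, F}" "L \<noteq> R" "L \<noteq> F" "R \<noteq> F"
      "hexs y \<inter> hexs (last xs) = {L, R}" "hexs y \<inter> hexs l = {L, F}" "hexs y \<inter> hexs r = {R, F}"
  let ?X = "insert y (set xs)"
  let ?fc = "\<lambda>h. if h \<in> C then Some h else None"
  have last: "last xs \<in> set xs" using x(2) by simp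
  have LRx: "L \<in> hexs (last xs)" "R \<in> hexs (last xs)" using h(5) by auto
  have faces_X: "faces C ?X = insert (?fc F) (faces C (set xs))"
    using h(1) LRx last by (auto simp: faces_def image_Un)
  have sub: "allow xs y \<subseteq> {l, r}" using n(1) by (auto simp: allow_def)
  have finf: "finite (faces C (set xs))" by (simp add: faces_def)
  show ?thesis
  proof (cases "?fc F \<in> faces C (set xs)")
    case True
    have "\<not> (l \<in> allow xs y \<and> r \<in> allow xs y)"
    proof
      assume lr: "l \<in> allow xs y \<and> r \<in> allow xs y"
      have reach: "l \<in> reach C T ?X" "r \<in> reach C T ?X" using reach_if_both_allowed lr n(4) by blast+
      then obtain u w where uw: "u \<in> T" "u \<notin> ?X" "(l, u) \<in> free_conn C ?X"
        "w \<in> T" "w \<notin> ?X" "(r, w) \<in> free_conn C ?X" by (auto simp: reach_def)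
      \<comment> \<open>Two different entrances are joined by an edge of the region, so the
        connections from \<open>l\<close> and from \<open>r\<close> can be linked.\<close>
      have "(u, w) \<in> free_conn C ?X"
        using T_edge_in[OF uw(1,4)] free_conn_edge[OF _ uw(2,5)] free_conn_refl by metis
      then have conn: "(l, r) \<in> free_conn C ?X"
        using uw(3,6) free_conn_sym free_conn_trans by blast
      have "\<not> T \<subseteq> {y}" using uw by blast
      then have "edge_in C y l" "edge_in C y r" using hA_not_edge_in lr by (auto simp: allow_def)
      moreover have "l \<notin> ?X" "r \<notin> ?X" using reach by (auto simp: reach_def)
      ultimately show False
        using separation[OF n h _ _ conn _ _ refl x(3) last x(4) unbounded_outside] True by blast
    qed
    then have "allow xs y = {l} \<or> allow xs y = {r}" using sub ne by blast
    then have "card (allow xs y) = 1" by auto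
    moreover have "faces C ?X = faces C (set xs)" using faces_X True by auto
    ultimately show ?thesis by simp
  next
    case False
    have edge_in: "edge_in C y l" "edge_in C y r"
    proof -
      \<comment> \<open>If \<open>L\<close> or \<open>R\<close> is outside \<open>C\<close>, the
        outer face has been touched, and the untouched \<open>F\<close> cannot be part of
        it.\<close>
      have "F \<in> C \<or> L \<in> C \<and> R \<in> C"
      proof (rule disjCI)
        assume "\<not> (L \<in> C \<and> R \<in> C)"
        then have "None \<in> faces C (set xs)" using LRx last unfolding faces_def by force
        then show "F \<in> C" using False by (auto split: if_splits)
      qed
      then have "hexs y \<inter> hexs l \<inter> C \<noteq> {}" "hexs y \<inter> hexs r \<inter> C \<noteq> {}"
        unfolding h(6) h(7) by auto
      then show "edge_in C y l" "edge_in C y r" using n(1) by (auto simp: edge_in_def)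
    qed
    have newF: "v \<notin> set xs" if "F \<in> hexs v" for v
      using False that unfolding faces_def by blast
    have notX: "l \<notin> ?X" "r \<notin> ?X"
    proof -
      have "F \<in> hexs l" "F \<in> hexs r" using h by auto
      then have "l \<notin> set xs" "r \<notin> set xs" using newF by blast+
      moreover have "y \<noteq> l" "y \<noteq> r" using n(1) not_nbrs_self[of y] by auto
      ultimately show "l \<notin> ?X" "r \<notin> ?X" by auto
    qed
    let ?R = "reach C T ?X"
    have RX: "?R \<inter> ?X = {}" by (auto simp: reach_def)
    have rotF: "rot ?R y F = of_bool (l \<in> ?R) + of_bool (r \<in> ?R)"
    proof -
      have "{p \<in> nbrs y. F \<in> hexs p} = {l, r}" using n h by auto
      then show ?thesis using n(4) by (rule rot_pair)
    qed
    \<comment> \<open>If \<open>F\<close> is in \<open>C\<close>, the tip is the only vertex of the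
      past on \<open>F\<close> and one application of \<open>hexagon_parity\<close> suffices. If
      not, the outer face is untouched, so all earlier vertices are interior, and the value at
      \<open>F\<close> follows from the sum over \<open>L\<close> and \<open>R\<close>.\<close>
    have rot0: "rot ?R y F = 0"
    proof (cases "F \<in> C")
      case True
      have "{q \<in> ?X. F \<in> hexs q} = {y}" using h(1) newF by auto
      moreover have "(\<Sum>q\<in>{q \<in> ?X. F \<in> hexs q}. rot ?R q F) = 0"
        by (rule hexagon_parity[OF _ RX True reach_step]) auto
      ultimately show ?thesis by simp
    next
      case FC: False
      then have inC: "hexs q \<subseteq> C" if "q \<in> set xs" for q
        using False that by (force simp: faces_def)
      then have "hexs y \<inter> C = {L, R}" using h(1) FC LRx last by blast
      moreover have "(\<Sum>h\<in>hexs y \<inter> C. rot ?R y h) = 0"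
        by (rule tip_parity[OF _ _ RX reach_step]) (use inC in auto)
      moreover have "(\<Sum>h\<in>{L, R, F}. rot ?R y h) = 0" using rot_sum_hexs[of ?R y] h(1) by simp
      ultimately show ?thesis using h(2-4)
        by (cases "rot ?R y L"; cases "rot ?R y R"; cases "rot ?R y F"; simp)
    qed
    have "l \<in> ?R \<longleftrightarrow> r \<in> ?R" using rotF rot0 by (simp add: of_bool_def split: if_splits)
    \<comment> \<open>If \<open>z\<close> is allowed as the target edge, this edge is in the region;
      its far end \<open>z\<close> is then a free entrance and counts as reachable.\<close>
    moreover have "z \<in> ?R" if "z \<in> allow xs y" for z
    proof -
      have z: "z = l \<or> z = r" using sub that by blast
      then have "edge_in C y z" "z \<notin> ?X" using edge_in notX by auto
      then show ?thesis using that isT_edge_in[of y z] reach_target by (auto simp: allow_def)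
    qed
    then have "l \<in> ?R \<or> r \<in> ?R" using ne sub by blast
    ultimately have "l \<in> allow xs y" "r \<in> allow xs y"
      using n hA_edge_in[OF edge_in(1)] hA_edge_in[OF edge_in(2)] by (auto simp: allow_def)
    then have "allow xs y = {l, r}" using sub by blast
    then have "card (allow xs y) = 2" using n(4) by simp
    moreover have "card (faces C ?X) = Suc (card (faces C (set xs)))"
      unfolding faces_X using False finf by simp
    ultimately show ?thesis by simp
  qed
qed

end

section \<open>Coordinates\<close>

text \<open>In the coordinates \<open>(a, b)\<close> below the lattice vertices and the hexagon centres are the points
  of \<open>\<int>\<^sup>2\<close>, the centres being those with \<open>3 dvd a + b\<close>, and the hexagon around \<open>0\<close> is
  \<open>\<bar>a\<bar> \<le> 1, \<bar>b\<bar> \<le> 1, \<bar>a - b\<bar> \<le> 1\<close>.\<close>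

definition tri :: "real \<Rightarrow> real \<Rightarrow> real \<Rightarrow> complex" where
  "tri \<delta> a b = Complex (\<delta> * (sqrt 3 / 2 * a)) (\<delta> * (b - a / 2))"

definition crdA :: "real \<Rightarrow> complex \<Rightarrow> real" where "crdA \<delta> z = 2 * Re z / (sqrt 3 * \<delta>)"
definition crdB :: "real \<Rightarrow> complex \<Rightarrow> real" where "crdB \<delta> z = Im z / \<delta> + crdA \<delta> z / 2"

fun va :: "vtx \<Rightarrow> int" where "va (Up j k) = 2 * j + k + 1" | "va (Dn j k) = 2 * j + k - 1"
fun vb :: "vtx \<Rightarrow> int" where "vb (Up j k) = j + 2 * k + 1" | "vb (Dn j k) = j + 2 * k - 1"
fun ha :: "int \<times> int \<Rightarrow> int" where "ha (j, k) = 2 * j + k"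
fun hb :: "int \<times> int \<Rightarrow> int" where "hb (j, k) = j + 2 * k"

definition pos :: "real \<Rightarrow> vtx \<Rightarrow> complex" where "pos \<delta> v = tri \<delta> (va v) (vb v)"
definition mid :: "real \<Rightarrow> vtx \<Rightarrow> vtx \<Rightarrow> complex" where "mid \<delta> v w = midpoint (pos \<delta> v) (pos \<delta> w)"
definition hexset :: "real \<Rightarrow> int \<times> int \<Rightarrow> complex set" where
  "hexset \<delta> h = convex hull (hex_corners \<delta> (hex_centre \<delta> (fst h) (snd h)))"

lemma crd_tri [simp]: "\<delta> \<noteq> 0 \<Longrightarrow> crdA \<delta> (tri \<delta> a b) = a" "\<delta> \<noteq> 0 \<Longrightarrow> crdB \<delta> (tri \<delta> a b) = b"
  by (simp_all add: crdA_def crdB_def tri_def field_simps)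

lemma tri_crd: "\<delta> \<noteq> 0 \<Longrightarrow> tri \<delta> (crdA \<delta> z) (crdB \<delta> z) = z"
  by (simp add: crdA_def crdB_def tri_def complex_eq_iff field_simps)

lemma tri_inj: "\<delta> \<noteq> 0 \<Longrightarrow> tri \<delta> a b = tri \<delta> a' b' \<longleftrightarrow> a = a' \<and> b = b'"
  by (metis crd_tri)

lemma tri_diff: "tri \<delta> a b - tri \<delta> a' b' = tri \<delta> (a - a') (b - b')"
  by (simp add: tri_def complex_eq_iff field_simps)

lemma norm_tri: "(norm (tri \<delta> a b))\<^sup>2 = \<delta>\<^sup>2 * (a\<^sup>2 - a * b + b\<^sup>2)"
proof -
  have "(\<delta> * (sqrt 3 / 2 * a))\<^sup>2 = \<delta>\<^sup>2 * (3 / 4 * a\<^sup>2)"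
    by (simp add: power_mult_distrib power_divide)
  then show ?thesis
    unfolding tri_def cmod_power2 complex.sel by (simp add: power2_eq_square field_simps)
qed

lemma hex_centre_tri: "hex_centre \<delta> j k = tri \<delta> (ha (j, k)) (hb (j, k))"
  by (simp add: hex_centre_def tri_def complex_eq_iff cos_60 sin_60 field_simps)

lemma hex_corners_tri:
  "hex_corners \<delta> (tri \<delta> a b) = {tri \<delta> (a + 1) (b + 1), tri \<delta> a (b + 1), tri \<delta> (a - 1) b,
     tri \<delta> (a - 1) (b - 1), tri \<delta> a (b - 1), tri \<delta> (a + 1) b}"
proof -
  have angle: "pi / 6 + real 1 * pi / 3 = pi / 2" "pi / 6 + real 2 * pi / 3 = pi - pi / 6"
    "pi / 6 + real 3 * pi / 3 = pi / 6 + pi" "pi / 6 + real 4 * pi / 3 = pi / 2 + pi"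
    "pi / 6 + real 5 * pi / 3 = 2 * pi - pi / 6"
    by (simp_all add: field_simps)
  have "hex_corners \<delta> (tri \<delta> a b) =
      (\<lambda>i. tri \<delta> a b + of_real \<delta> * cis (pi / 6 + real i * pi / 3)) ` {..<6}"
    by (auto simp: hex_corners_def)
  also have "{..<6::nat} = {0, 1, 2, 3, 4, 5}" by auto
  finally have "hex_corners \<delta> (tri \<delta> a b) = (\<lambda>i. tri \<delta> a b + of_real \<delta> * cis (pi / 6 + real i * pi / 3)) `
      {0, 1, 2, 3, 4, 5}" .
  moreover have "cis (pi / 6 + real 0 * pi / 3) = tri 1 1 1"
    by (simp add: cis.ctr cos_30 sin_30 tri_def)
  moreover have "cis (pi / 6 + real 1 * pi / 3) = tri 1 0 1"
    unfolding angle by (simp add: cis.ctr tri_def)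
  moreover have "cis (pi / 6 + real 2 * pi / 3) = tri 1 (- 1) 0"
    unfolding angle cis.ctr cos_pi_minus sin_pi_minus cos_30 sin_30 by (simp add: tri_def)
  moreover have "cis (pi / 6 + real 3 * pi / 3) = tri 1 (- 1) (- 1)"
    unfolding angle cis.ctr cos_periodic_pi sin_periodic_pi cos_30 sin_30 by (simp add: tri_def)
  moreover have "cis (pi / 6 + real 4 * pi / 3) = tri 1 0 (- 1)"
    unfolding angle cis.ctr cos_periodic_pi sin_periodic_pi by (simp add: tri_def)
  moreover have "cis (pi / 6 + real 5 * pi / 3) = tri 1 1 0"
    unfolding angle cis.ctr cos_2pi_minus sin_2pi_minus cos_30 sin_30 by (simp add: tri_def)
  moreover have "tri \<delta> a b + of_real \<delta> * tri 1 c d = tri \<delta> (a + c) (b + d)" for c d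
    by (simp add: tri_def complex_eq_iff field_simps)
  ultimately show ?thesis by (simp del: cis_pi cis_pi_half)
qed

lemma crd_lin:
  "crdA \<delta> (u *\<^sub>R x + v *\<^sub>R y) = u * crdA \<delta> x + v * crdA \<delta> y"
  "crdB \<delta> (u *\<^sub>R x + v *\<^sub>R y) = u * crdB \<delta> x + v * crdB \<delta> y"
  by (simp_all add: crdA_def crdB_def add_divide_distrib algebra_simps)

lemma abs_convex_le:
  fixes p q c u v :: real
  assumes "\<bar>p - c\<bar> \<le> 1" "\<bar>q - c\<bar> \<le> 1" "0 \<le> u" "0 \<le> v" "u + v = 1"
  shows "\<bar>u * p + v * q - c\<bar> \<le> 1"
proof -
  have "u * p + v * q - c = u * (p - c) + v * (q - c)"
  proof -
    have "u * (p - c) + v * (q - c) = u * p + v * q - (u + v) * c" by (simp add: algebra_simps)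
    then show ?thesis using assms(5) by simp
  qed
  also have "\<bar>\<dots>\<bar> \<le> u * \<bar>p - c\<bar> + v * \<bar>q - c\<bar>"
    using assms(3,4) by (metis abs_mult abs_of_nonneg abs_triangle_ineq)
  also have "\<dots> \<le> u * 1 + v * 1" using assms by (intro add_mono mult_left_mono) auto
  finally show ?thesis using assms(5) by simp
qed

definition hexball :: "real \<Rightarrow> real \<Rightarrow> bool" where
  "hexball a b \<longleftrightarrow> \<bar>a\<bar> \<le> 1 \<and> \<bar>b\<bar> \<le> 1 \<and> \<bar>a - b\<bar> \<le> 1"

lemma hexset_hull:
  "hexset \<delta> h = convex hull {tri \<delta> (ha h + 1) (hb h + 1), tri \<delta> (ha h) (hb h + 1), tri \<delta> (ha h - 1) (hb h),
     tri \<delta> (ha h - 1) (hb h - 1), tri \<delta> (ha h) (hb h - 1), tri \<delta> (ha h + 1) (hb h)}"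
  unfolding hexset_def hex_centre_tri prod.collapse hex_corners_tri by simp

lemma convex_combine3:
  assumes "convex S" "tri \<delta> a b \<in> S" "tri \<delta> (a + a1) (b + b1) \<in> S" "tri \<delta> (a + a2) (b + b2) \<in> S"
    "0 \<le> s" "0 \<le> t" "s + t \<le> 1"
  shows "tri \<delta> (a + s * a1 + t * a2) (b + s * b1 + t * b2) \<in> S"
proof -
  have "tri \<delta> (a + s * a1 + t * a2) (b + s * b1 + t * b2) =
    (1 - s - t) *\<^sub>R tri \<delta> a b + s *\<^sub>R tri \<delta> (a + a1) (b + b1) + t *\<^sub>R tri \<delta> (a + a2) (b + b2)"
    by (simp add: tri_def complex_eq_iff field_simps)
  moreover have "0 \<le> 1 - s - t" "1 - s - t + s + t = 1" using assms(7) by simp_all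
  ultimately have "tri \<delta> (a + s * a1 + t * a2) (b + s * b1 + t * b2) \<in>
      convex hull {tri \<delta> a b, tri \<delta> (a + a1) (b + b1), tri \<delta> (a + a2) (b + b2)}"
    unfolding convex_hull_3 using assms(5,6) by blast
  moreover have "convex hull {tri \<delta> a b, tri \<delta> (a + a1) (b + b1), tri \<delta> (a + a2) (b + b2)} \<subseteq> S"
    by (rule hull_minimal) (use assms in auto)
  ultimately show ?thesis by blast
qed

lemma mem_hexset:
  assumes "\<delta> > 0"
  shows "z \<in> hexset \<delta> h \<longleftrightarrow> hexball (crdA \<delta> z - ha h) (crdB \<delta> z - hb h)"
proof
  let ?S = "{z. hexball (crdA \<delta> z - ha h) (crdB \<delta> z - hb h)}"
  have "hexset \<delta> h \<subseteq> ?S"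
    unfolding hexset_hull
  proof (rule hull_minimal)
    show "convex ?S"
    proof (rule convexI)
      fix x y :: complex and u v :: real
      assume *: "x \<in> ?S" "y \<in> ?S" "0 \<le> u" "0 \<le> v" "u + v = 1"
      have "\<bar>u * (crdA \<delta> x - crdB \<delta> x) + v * (crdA \<delta> y - crdB \<delta> y) - (ha h - hb h)\<bar> \<le> 1"
        by (rule abs_convex_le) (use * in \<open>auto simp: hexball_def algebra_simps\<close>)
      moreover have "\<bar>u * crdA \<delta> x + v * crdA \<delta> y - ha h\<bar> \<le> 1"
        by (rule abs_convex_le) (use * in \<open>auto simp: hexball_def\<close>)
      moreover have "\<bar>u * crdB \<delta> x + v * crdB \<delta> y - hb h\<bar> \<le> 1"
        by (rule abs_convex_le) (use * in \<open>auto simp: hexball_def\<close>)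
      ultimately show "u *\<^sub>R x + v *\<^sub>R y \<in> ?S"
        by (simp add: hexball_def crd_lin algebra_simps)
    qed
  qed (use assms in \<open>auto simp: hexball_def\<close>)
  then show "z \<in> hexset \<delta> h \<Longrightarrow> hexball (crdA \<delta> z - ha h) (crdB \<delta> z - hb h)" by auto
next
  define a where "a = crdA \<delta> z - ha h"
  define b where "b = crdB \<delta> z - hb h"
  let ?t = "\<lambda>x y :: real. tri \<delta> (of_int (ha h) + x) (of_int (hb h) + y)"
  assume "hexball (crdA \<delta> z - ha h) (crdB \<delta> z - hb h)"
  then have ab: "\<bar>a\<bar> \<le> 1" "\<bar>b\<bar> \<le> 1" "\<bar>a - b\<bar> \<le> 1" by (simp_all add: hexball_def a_def b_def)
  have z: "z = ?t a b" using assms by (simp add: a_def b_def tri_crd)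
  have S: "convex (hexset \<delta> h)" by (simp add: hexset_def)
  have c: "?t 1 1 \<in> hexset \<delta> h" "?t 0 1 \<in> hexset \<delta> h" "?t (- 1) 0 \<in> hexset \<delta> h"
    "?t (- 1) (- 1) \<in> hexset \<delta> h" "?t 0 (- 1) \<in> hexset \<delta> h" "?t 1 0 \<in> hexset \<delta> h"
    unfolding hexset_hull by (rule hull_inc; simp)+
  have "tri \<delta> (ha h) (hb h) = (1 / 2) *\<^sub>R ?t 1 1 + (1 / 2) *\<^sub>R ?t (- 1) (- 1)"
    by (simp add: tri_def complex_eq_iff field_simps)
  then have c0: "tri \<delta> (ha h) (hb h) \<in> hexset \<delta> h" using convexD[OF S c(1,4)] by simp
  note comb = convex_combine3[OF S c0]
  \<comment> \<open>The six triangles between the centre and two neighbouring corners. In each of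
    them the weights of the two corners can be read off from \<open>a\<close> and
    \<open>b\<close>.\<close>
  consider "a \<ge> b" "b \<ge> 0" | "b \<ge> a" "a \<ge> 0" | "a \<le> 0" "0 \<le> b" | "a \<ge> 0" "0 \<ge> b" | "0 \<ge> a" "a \<ge> b" | "0 \<ge> b" "b \<ge> a"
    by linarith
  then show "z \<in> hexset \<delta> h"
  proof cases
    case 1 then show ?thesis using comb[OF c(6) c(1), of "a - b" b] ab z by simp
  next
    case 2 then show ?thesis using comb[OF c(2) c(1), of "b - a" a] ab z by simp
  next
    case 3 then show ?thesis using comb[OF c(2) c(3), of b "- a"] ab z by simp
  next
    case 4 then show ?thesis using comb[OF c(6) c(5), of a "- b"] ab z by simp
  next
    case 5 then show ?thesis using comb[OF c(4) c(5), of "- a" "a - b"] ab z by simp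
  next
    case 6 then show ?thesis using comb[OF c(4) c(3), of "- b" "b - a"] ab z by simp
  qed
qed

lemma crd_pos [simp]: "\<delta> \<noteq> 0 \<Longrightarrow> crdA \<delta> (pos \<delta> v) = va v" "\<delta> \<noteq> 0 \<Longrightarrow> crdB \<delta> (pos \<delta> v) = vb v"
  by (simp_all add: pos_def)

lemma v_coord_inj:
  assumes "va v = va w" "vb v = vb w"
  shows "v = w"
proof -
  \<comment> \<open>The sum of the equations is \<open>3 * (m + n) = 4\<close>. The reason behind
    it: \<open>va v + vb v\<close> is 2 modulo 3 for \<open>Up\<close>, 1 for \<open>Dn\<close>, and
    the remaining class consists of the centres.\<close>
  have ne: False if "2 * m + n = 2" "m + 2 * n = 2" for m n :: int
  proof -
    have "m \<le> 0 \<or> 1 \<le> m" by linarith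
    then show False using that by (elim disjE; linarith)
  qed
  show ?thesis
  proof (cases v)
    case v: (Up j k)
    show ?thesis
    proof (cases w)
      case (Up j' k')
      then show ?thesis using assms v by simp
    next
      case (Dn j' k')
      then show ?thesis using assms v ne[of "j' - j" "k' - k"] by simp
    qed
  next
    case v: (Dn j k)
    show ?thesis
    proof (cases w)
      case (Up j' k')
      then show ?thesis using assms v ne[of "j - j'" "k - k'"] by simp
    next
      case (Dn j' k')
      then show ?thesis using assms v by simp
    qed
  qed
qed

lemma h_coord_inj: "ha g = ha h \<Longrightarrow> hb g = hb h \<Longrightarrow> g = h"
  by (cases g; cases h; simp)

lemma pos_inj: "\<delta> \<noteq> 0 \<Longrightarrow> pos \<delta> v = pos \<delta> w \<longleftrightarrow> v = w"
  using v_coord_inj by (auto simp: pos_def tri_inj)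

lemma hexs_coord:
  "h \<in> hexs v \<longleftrightarrow> \<bar>va v - ha h\<bar> \<le> 1 \<and> \<bar>vb v - hb h\<bar> \<le> 1 \<and> \<bar>(va v - ha h) - (vb v - hb h)\<bar> \<le> 1"
proof -
  have key: "m = 0 \<and> n = 0 \<or> m = 1 \<and> n = 0 \<or> m = 0 \<and> n = 1 \<longleftrightarrow>
      \<bar>1 - 2 * m - n\<bar> \<le> 1 \<and> \<bar>1 - m - 2 * n\<bar> \<le> 1 \<and> \<bar>n - m\<bar> \<le> 1" (is "?l \<longleftrightarrow> ?r") for m n :: int
  proof
    assume r: ?r
    then have "0 \<le> m" "m \<le> 1" "0 \<le> n" "n \<le> 1" by linarith+
    then have "m = 0 \<or> m = 1" "n = 0 \<or> n = 1" by linarith+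
    then show ?l using r by (elim disjE) simp_all
  qed auto
  obtain j' k' where h: "h = (j', k')" by (cases h)
  show ?thesis
  proof (cases v)
    case (Up j k)
    have "h \<in> hexs v \<longleftrightarrow> (let m = j' - j; n = k' - k in m = 0 \<and> n = 0 \<or> m = 1 \<and> n = 0 \<or> m = 0 \<and> n = 1)"
      unfolding Up h Let_def by auto
    also have "\<dots> \<longleftrightarrow> \<bar>va v - ha h\<bar> \<le> 1 \<and> \<bar>vb v - hb h\<bar> \<le> 1 \<and> \<bar>(va v - ha h) - (vb v - hb h)\<bar> \<le> 1"
      unfolding Let_def key unfolding Up h by (simp add: algebra_simps)
    finally show ?thesis .
  next
    case (Dn j k)
    have "h \<in> hexs v \<longleftrightarrow> (let m = j - j'; n = k - k' in m = 0 \<and> n = 0 \<or> m = 1 \<and> n = 0 \<or> m = 0 \<and> n = 1)"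
      unfolding Dn h Let_def by auto
    also have "\<dots> \<longleftrightarrow> \<bar>va v - ha h\<bar> \<le> 1 \<and> \<bar>vb v - hb h\<bar> \<le> 1 \<and> \<bar>(va v - ha h) - (vb v - hb h)\<bar> \<le> 1"
      unfolding Let_def key unfolding Dn h by (simp, linarith)
    finally show ?thesis .
  qed
qed

lemma nbrs_coord:
  "w \<in> nbrs v \<longleftrightarrow> v \<noteq> w \<and> \<bar>va w - va v\<bar> \<le> 1 \<and> \<bar>vb w - vb v\<bar> \<le> 1 \<and> \<bar>(va w - va v) - (vb w - vb v)\<bar> \<le> 1"
proof -
  have key: "m = 1 \<and> n = 0 \<or> m = 0 \<and> n = 1 \<or> m = 1 \<and> n = 1 \<longleftrightarrow>
      \<bar>2 * m + n - 2\<bar> \<le> 1 \<and> \<bar>m + 2 * n - 2\<bar> \<le> 1 \<and> \<bar>m - n\<bar> \<le> 1" (is "?l \<longleftrightarrow> ?r") for m n :: int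
  proof
    assume r: ?r
    then have "0 \<le> m" "m \<le> 1" "0 \<le> n" "n \<le> 1" by linarith+
    then have "m = 0 \<or> m = 1" "n = 0 \<or> n = 1" by linarith+
    then show ?l using r by (elim disjE) simp_all
  qed auto
  have same: "m = 0 \<and> n = 0"
    if r: "\<bar>2 * m + n\<bar> \<le> 1" "\<bar>m + 2 * n\<bar> \<le> 1" "\<bar>m - n\<bar> \<le> 1" for m n :: int
  proof -
    have "-1 \<le> m" "m \<le> 1" "-1 \<le> n" "n \<le> 1" using r by linarith+
    then have "m = -1 \<or> m = 0 \<or> m = 1" "n = -1 \<or> n = 0 \<or> n = 1" by linarith+
    then show ?thesis using r by (elim disjE) simp_all
  qed
  show ?thesis
  proof (cases v)
    case v: (Up j k)
    show ?thesis
    proof (cases w)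
      case (Up j' k')
      then show ?thesis using v same[of "j' - j" "k' - k"] by (auto simp: algebra_simps)
    next
      case w: (Dn j' k')
      have "w \<in> nbrs v \<longleftrightarrow> (let m = j' - j; n = k' - k in m = 1 \<and> n = 0 \<or> m = 0 \<and> n = 1 \<or> m = 1 \<and> n = 1)"
        unfolding v w Let_def by auto
      then show ?thesis unfolding Let_def key unfolding v w by (simp add: algebra_simps)
    qed
  next
    case v: (Dn j k)
    show ?thesis
    proof (cases w)
      case w: (Up j' k')
      have "w \<in> nbrs v \<longleftrightarrow> (let m = j - j'; n = k - k' in m = 1 \<and> n = 0 \<or> m = 0 \<and> n = 1 \<or> m = 1 \<and> n = 1)"
        unfolding v w Let_def by auto
      moreover have "va w - va v = - (2 * (j - j') + (k - k') - 2)" "vb w - vb v = - ((j - j') + 2 * (k - k') - 2)"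
        "(va w - va v) - (vb w - vb v) = - ((j - j') - (k - k'))" by (simp_all add: v w)
      moreover have "v \<noteq> w" by (simp add: v w)
      ultimately show ?thesis unfolding Let_def key by (simp only: abs_minus_cancel simp_thms)
    next
      case (Dn j' k')
      then show ?thesis using v same[of "j' - j" "k' - k"] by (auto simp: algebra_simps)
    qed
  qed
qed

text \<open>The norm form of the Eisenstein integers: the squared length, in units of the mesh, of
  the vector with coordinates \<open>(a, b)\<close>.\<close>

definition eis :: "int \<Rightarrow> int \<Rightarrow> int" where "eis a b = a * a - a * b + b * b"

lemma eis_bound: "3 * b\<^sup>2 \<le> 4 * eis a b" "3 * a\<^sup>2 \<le> 4 * eis a b"
proof -
  have "4 * eis a b - 3 * b\<^sup>2 = (2 * a - b)\<^sup>2" "4 * eis a b - 3 * a\<^sup>2 = (2 * b - a)\<^sup>2"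
    by (simp_all add: eis_def power2_eq_square algebra_simps)
  then show "3 * b\<^sup>2 \<le> 4 * eis a b" "3 * a\<^sup>2 \<le> 4 * eis a b"
    by (metis diff_ge_0_iff_ge zero_le_power2)+
qed

text \<open>The bound 4 is the one needed for mid-edges: their coordinates have to be doubled to
  become integers, which turns a squared distance of 1 into 4.\<close>

lemma eis_small:
  assumes "eis a b \<le> 4"
  shows "a \<in> {-2, -1, 0, 1, 2}" "b \<in> {-2, -1, 0, 1, 2}"
proof -
  have *: "x \<in> {-2, -1, 0, 1, 2}" if "3 * x\<^sup>2 \<le> 4 * eis a b" for x :: int
  proof -
    have "x\<^sup>2 < 3\<^sup>2" using that assms by simp
    then have "\<bar>x\<bar> < 3" using power2_less_imp_less[of "\<bar>x\<bar>" 3] by simp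
    then show ?thesis by auto
  qed
  show "a \<in> {-2, -1, 0, 1, 2}" "b \<in> {-2, -1, 0, 1, 2}" using eis_bound * by blast+
qed

lemma dist_tri:
  assumes "\<delta> > 0"
  shows "(dist (tri \<delta> a b) (tri \<delta> a' b'))\<^sup>2 = \<delta>\<^sup>2 * ((a - a')\<^sup>2 - (a - a') * (b - b') + (b - b')\<^sup>2)"
  unfolding dist_norm tri_diff norm_tri ..

lemma dist_pos:
  assumes "\<delta> > 0"
  shows "(dist (pos \<delta> v) (pos \<delta> w))\<^sup>2 = \<delta>\<^sup>2 * eis (va v - va w) (vb v - vb w)"
  unfolding pos_def dist_tri[OF assms] eis_def by (simp add: power2_eq_square)

lemma dist_pos_eq:
  assumes "\<delta> > 0"
  shows "dist (pos \<delta> v) (pos \<delta> w) = \<delta> \<longleftrightarrow> w \<in> nbrs v"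
proof -
  have "dist (pos \<delta> v) (pos \<delta> w) = \<delta> \<longleftrightarrow> (dist (pos \<delta> v) (pos \<delta> w))\<^sup>2 = \<delta>\<^sup>2"
    using assms by (simp add: power2_eq_iff_nonneg)
  also have "\<dots> \<longleftrightarrow> eis (va v - va w) (vb v - vb w) = 1"
    unfolding dist_pos[OF assms] using assms by simp
  also have "\<dots> \<longleftrightarrow> w \<in> nbrs v"
  proof
    assume e: "eis (va v - va w) (vb v - vb w) = 1"
    then have "va v - va w \<in> {-2, -1, 0, 1, 2}" "vb v - vb w \<in> {-2, -1, 0, 1, 2}"
      using eis_small[of "va v - va w" "vb v - vb w"] by auto
    moreover have "v \<noteq> w" using e by (auto simp: eis_def)
    ultimately show "w \<in> nbrs v" using e unfolding nbrs_coord by (auto simp: eis_def)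
  next
    assume "w \<in> nbrs v"
    then have "v \<noteq> w" and r: "va v - va w \<in> {-1, 0, 1}" "vb v - vb w \<in> {-1, 0, 1}"
      "\<bar>(va v - va w) - (vb v - vb w)\<bar> \<le> 1" unfolding nbrs_coord by auto
    then have "\<not> (va v - va w = 0 \<and> vb v - vb w = 0)" using v_coord_inj by force
    then show "eis (va v - va w) (vb v - vb w) = 1" using r by (auto simp: eis_def)
  qed
  finally show ?thesis .
qed

lemma dist_pos_ge:
  assumes "\<delta> > 0" "v \<noteq> w"
  shows "\<delta> \<le> dist (pos \<delta> v) (pos \<delta> w)"
proof -
  let ?e = "eis (va v - va w) (vb v - vb w)"
  have "\<not> (va v - va w = 0 \<and> vb v - vb w = 0)" using v_coord_inj assms(2) by force
  then have "?e \<noteq> 0" using eis_bound[where a = "va v - va w" and b = "vb v - vb w"] by auto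
  moreover have "0 \<le> ?e"
    using eis_bound(1)[where a = "va v - va w" and b = "vb v - vb w"] zero_le_power2[of "vb v - vb w"] by linarith
  ultimately have "1 \<le> real_of_int ?e" by linarith
  then have "\<delta>\<^sup>2 \<le> (dist (pos \<delta> v) (pos \<delta> w))\<^sup>2" unfolding dist_pos[OF assms(1)]
    using mult_left_mono[of 1 "real_of_int ?e" "\<delta>\<^sup>2"] by simp
  then show ?thesis by (rule power2_le_imp_le) simp
qed

text \<open>The parallelogram law for the vectors from \<open>p\<close> to the two vertices: their
  difference has length at least \<delta> and each is at most half as long, so their sum is
  0.\<close>

lemma pos_close:
  assumes "\<delta> > 0" "v \<noteq> w" "dist (pos \<delta> v) p \<le> \<delta> / 2" "dist (pos \<delta> w) p \<le> \<delta> / 2"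
  shows "p = midpoint (pos \<delta> v) (pos \<delta> w)"
proof -
  let ?a = "pos \<delta> v - p" and ?b = "pos \<delta> w - p"
  have "\<delta>\<^sup>2 \<le> (norm (?a - ?b))\<^sup>2"
    using dist_pos_ge[OF assms(1,2)] assms(1) by (intro power_mono) (auto simp: dist_norm)
  moreover have "(norm ?a)\<^sup>2 \<le> (\<delta> / 2)\<^sup>2" "(norm ?b)\<^sup>2 \<le> (\<delta> / 2)\<^sup>2"
    using assms(3,4) by (auto simp: dist_norm intro!: power_mono)
  moreover have "(norm (?a + ?b))\<^sup>2 + (norm (?a - ?b))\<^sup>2 = 2 * (norm ?a)\<^sup>2 + 2 * (norm ?b)\<^sup>2"
    by (simp only: cmod_power2 plus_complex.sel minus_complex.sel) (simp add: power2_eq_square algebra_simps)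
  moreover have "(\<delta> / 2)\<^sup>2 = \<delta>\<^sup>2 / 4" by (simp add: power_divide)
  ultimately have "(norm (?a + ?b))\<^sup>2 \<le> 0" by linarith
  then have "?a + ?b = 0" by simp
  then have "pos \<delta> v + pos \<delta> w = 2 * p" by (simp add: algebra_simps)
  then show ?thesis by (simp add: midpoint_def scaleR_conv_of_real)
qed

lemma hexball_of_int:
  "hexball (real_of_int a - real_of_int c) (real_of_int b - real_of_int d) \<longleftrightarrow>
     \<bar>a - c\<bar> \<le> 1 \<and> \<bar>b - d\<bar> \<le> 1 \<and> \<bar>(a - c) - (b - d)\<bar> \<le> 1"
  unfolding hexball_def by linarith

lemma pos_mem_hexset: "\<delta> > 0 \<Longrightarrow> pos \<delta> v \<in> hexset \<delta> h \<longleftrightarrow> h \<in> hexs v"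
  by (simp add: mem_hexset hexball_of_int hexs_coord)

text \<open>No integer lies strictly between \<open>p\<close> and \<open>p + d\<close>, so the bound
  1 can be crossed only at an end. Applied to the three inequalities of \<open>hexball\<close> along
  an edge.\<close>

lemma abs_between:
  fixes p d :: int and t :: real
  assumes "\<bar>d\<bar> \<le> 1" "0 < t" "t < 1"
  shows "\<bar>real_of_int p + t * real_of_int d\<bar> \<le> 1 \<longleftrightarrow> \<bar>p\<bar> \<le> 1 \<and> \<bar>p + d\<bar> \<le> 1"
proof -
  have "d = -1 \<or> d = 0 \<or> d = 1" using assms(1) by auto
  then show ?thesis using assms(2,3) by (elim disjE; simp; linarith)
qed

lemma edge_point_hexset:
  assumes "\<delta> > 0" "w \<in> nbrs v" "0 < t" "t < 1"
  shows "(1 - t) *\<^sub>R pos \<delta> v + t *\<^sub>R pos \<delta> w \<in> hexset \<delta> h \<longleftrightarrow> h \<in> hexs v \<inter> hexs w"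
proof -
  have d: "\<bar>va w - va v\<bar> \<le> 1" "\<bar>vb w - vb v\<bar> \<le> 1" "\<bar>(va w - va v) - (vb w - vb v)\<bar> \<le> 1"
    using assms(2) nbrs_coord by auto
  have e: "(1 - t) * real_of_int p + t * real_of_int q - real_of_int c
    = real_of_int (p - c) + t * real_of_int (q - p)" for p q c
    by (simp add: algebra_simps)
  have f: "(1 - t) * real_of_int p + t * real_of_int q - real_of_int c -
      ((1 - t) * real_of_int p' + t * real_of_int q' - real_of_int c')
    = real_of_int ((p - c) - (p' - c')) + t * real_of_int ((q - p) - (q' - p'))" for p q c p' q' c'
    by (simp add: algebra_simps)
  have "hexball (crdA \<delta> ((1 - t) *\<^sub>R pos \<delta> v + t *\<^sub>R pos \<delta> w) - ha h)
      (crdB \<delta> ((1 - t) *\<^sub>R pos \<delta> v + t *\<^sub>R pos \<delta> w) - hb h) \<longleftrightarrow>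
    \<bar>(1 - t) * va v + t * va w - ha h\<bar> \<le> 1 \<and> \<bar>(1 - t) * vb v + t * vb w - hb h\<bar> \<le> 1 \<and>
    \<bar>(1 - t) * va v + t * va w - ha h - ((1 - t) * vb v + t * vb w - hb h)\<bar> \<le> 1"
    using assms(1) by (simp add: hexball_def crd_lin)
  also have "\<dots> \<longleftrightarrow> h \<in> hexs v \<inter> hexs w"
    unfolding f
    unfolding e abs_between[OF d(1) assms(3,4)] abs_between[OF d(2) assms(3,4)]
      abs_between[OF d(3) assms(3,4)] Int_iff hexs_coord by (auto simp: algebra_simps)
  finally show ?thesis unfolding mem_hexset[OF assms(1)] .
qed

lemma mid_mem_hexset:
  assumes "\<delta> > 0" "w \<in> nbrs v"
  shows "mid \<delta> v w \<in> hexset \<delta> h \<longleftrightarrow> h \<in> hexs v \<inter> hexs w"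
proof -
  have "mid \<delta> v w = (1 - 1 / 2) *\<^sub>R pos \<delta> v + (1 / 2) *\<^sub>R pos \<delta> w"
    by (simp add: mid_def midpoint_def scaleR_add_right)
  then show ?thesis using edge_point_hexset[OF assms, of "1 / 2" h] by simp
qed

lemma hex_corners_pos: "hex_corners \<delta> (hex_centre \<delta> j k) =
   pos \<delta> ` {Up j k, Dn j (k + 1), Up (j - 1) k, Dn j k, Up j (k - 1), Dn (j + 1) k}"
  unfolding hex_centre_tri hex_corners_tri by (simp add: pos_def algebra_simps)

lemma lattice_vertices_pos: "lattice_vertices \<delta> = range (pos \<delta>)"
proof -
  have "pos \<delta> v \<in> lattice_vertices \<delta>" for v
  proof (cases v)
    case (Up j k)
    then have "pos \<delta> v \<in> hex_corners \<delta> (hex_centre \<delta> j k)" unfolding hex_corners_pos by simp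
    then show ?thesis unfolding lattice_vertices_def by blast
  next
    case (Dn j k)
    then have "pos \<delta> v \<in> hex_corners \<delta> (hex_centre \<delta> j k)" unfolding hex_corners_pos by simp
    then show ?thesis unfolding lattice_vertices_def by blast
  qed
  then show ?thesis unfolding lattice_vertices_def hex_corners_pos by blast
qed

lemma mid_sym: "mid \<delta> v w = mid \<delta> w v"
  by (simp add: mid_def midpoint_sym)

lemma lattice_edge_iff:
  "\<delta> > 0 \<Longrightarrow> lattice_edge \<delta> x y \<longleftrightarrow> (\<exists>v w. w \<in> nbrs v \<and> x = pos \<delta> v \<and> y = pos \<delta> w)"
  unfolding lattice_edge_def lattice_vertices_pos by (auto simp: dist_pos_eq) blast

lemma half_edge_iff:
  "\<delta> > 0 \<Longrightarrow> half_edge \<delta> x m \<longleftrightarrow> (\<exists>v w. w \<in> nbrs v \<and> x = pos \<delta> v \<and> m = mid \<delta> v w)"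
  unfolding half_edge_def by (auto simp: lattice_edge_iff mid_def)

lemma mid_edges_iff:
  "\<delta> > 0 \<Longrightarrow> m \<in> mid_edges \<delta> \<longleftrightarrow> (\<exists>v w. w \<in> nbrs v \<and> m = mid \<delta> v w)"
  unfolding mid_edges_def by (auto simp: lattice_edge_iff mid_def)

context
  fixes \<delta> :: real
  assumes \<delta>: "\<delta> > 0"
begin

lemma dist_mid: "w \<in> nbrs v \<Longrightarrow> dist (pos \<delta> v) (mid \<delta> v w) = \<delta> / 2"
  using dist_pos_eq[OF \<delta>] by (simp add: mid_def dist_midpoint)

lemma dist_half_edge:
  assumes "w \<in> nbrs v" "p \<in> closed_segment (pos \<delta> v) (mid \<delta> v w)"
  shows "dist (pos \<delta> v) p \<le> \<delta> / 2"
proof -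
  have "closed_segment (pos \<delta> v) (mid \<delta> v w) \<subseteq> cball (pos \<delta> v) (\<delta> / 2)"
    by (rule closed_segment_subset) (use \<delta> dist_mid[OF assms(1)] in auto)
  then show ?thesis using assms(2) by auto
qed

lemma half_edge_end:
  assumes "w \<in> nbrs v" "p \<in> closed_segment (pos \<delta> v) (mid \<delta> v w)" "\<delta> / 2 \<le> dist (pos \<delta> v) p"
  shows "p = mid \<delta> v w"
proof -
  obtain u where u: "0 \<le> u" "u \<le> 1" "p = (1 - u) *\<^sub>R pos \<delta> v + u *\<^sub>R mid \<delta> v w"
    using assms(2) by (auto simp: closed_segment_def)
  have "p - pos \<delta> v = u *\<^sub>R (mid \<delta> v w - pos \<delta> v)" unfolding u(3) by (simp add: algebra_simps)
  then have "dist (pos \<delta> v) p = u * (\<delta> / 2)"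
    using u(1) dist_mid[OF assms(1)] by (simp add: dist_norm norm_minus_commute)
  then have "\<delta> / 2 \<le> u * (\<delta> / 2)" using assms(3) by simp
  then have "1 \<le> u" using \<delta> by simp
  then show ?thesis using u by simp
qed

lemma half_edges_meet:
  assumes "w \<in> nbrs v" "w' \<in> nbrs v'" "v \<noteq> v'"
    "p \<in> closed_segment (pos \<delta> v) (mid \<delta> v w)" "p \<in> closed_segment (pos \<delta> v') (mid \<delta> v' w')"
  shows "p = mid \<delta> v w" "p = mid \<delta> v' w'"
proof -
  have "p = midpoint (pos \<delta> v) (pos \<delta> v')"
    by (rule pos_close[OF \<delta> assms(3)]) (use assms dist_half_edge in auto)
  then have "\<delta> / 2 \<le> dist (pos \<delta> v) p" "\<delta> / 2 \<le> dist (pos \<delta> v') p"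
    using dist_pos_ge[OF \<delta> assms(3)] by (auto simp: dist_midpoint dist_commute)
  then show "p = mid \<delta> v w" "p = mid \<delta> v' w'" using half_edge_end assms by auto
qed

lemma pos_on_half_edge:
  assumes "w \<in> nbrs v" "pos \<delta> x \<in> closed_segment (pos \<delta> v) (mid \<delta> v w)"
  shows "x = v"
  using dist_half_edge[OF assms] dist_pos_ge[OF \<delta>, of v x] \<delta> by fastforce

lemma mid_on_half_edge:
  assumes "w \<in> nbrs v" "y \<in> nbrs x" "mid \<delta> x y \<in> closed_segment (pos \<delta> v) (mid \<delta> v w)"
  shows "mid \<delta> x y = mid \<delta> v w"
proof (cases "v = x")
  case True
  then show ?thesis using half_edge_end[OF assms(1,3)] dist_mid[OF assms(2)] by simp
next
  case False
  then show ?thesis using half_edges_meet(1)[OF assms(1,2) _ assms(3)] by simp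
qed

lemma mid_neq_pos: "w \<in> nbrs v \<Longrightarrow> mid \<delta> v w \<noteq> pos \<delta> x"
  using pos_on_half_edge[of w v x] dist_mid[of w v] \<delta> by force

lemma mid_inj:
  assumes "w \<in> nbrs v" "w' \<in> nbrs v'" "mid \<delta> v w = mid \<delta> v' w'"
  shows "v = v' \<and> w = w' \<or> v = w' \<and> w = v'"
proof -
  have other: "w = w'" if "w \<in> nbrs v" "mid \<delta> v w = mid \<delta> v w'" for v w w'
    using that \<delta> by (simp add: mid_def midpoint_eq_iff midpoint_def pos_inj)
  show ?thesis
  proof (cases "v = v'")
    case True
    then show ?thesis using other assms by metis
  next
    case False
    have "mid \<delta> v w = midpoint (pos \<delta> v) (pos \<delta> v')"
      by (rule pos_close[OF \<delta> False]) (use dist_mid[OF assms(1)] dist_mid[OF assms(2)] assms(3) in auto)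
    then have "w = v'" using other[OF assms(1), of v'] by (simp add: mid_def)
    moreover have "mid \<delta> v' w' = mid \<delta> v' v" using assms(3) calculation mid_sym by metis
    then have "w' = v" using other[OF assms(2)] by simp
    ultimately show ?thesis by simp
  qed
qed

lemma mid_inj2: "w \<in> nbrs v \<Longrightarrow> w' \<in> nbrs v \<Longrightarrow> mid \<delta> v w = mid \<delta> v w' \<longleftrightarrow> w = w'"
  using mid_inj[of w v w' v] by auto

text \<open>With both edges written from their \<open>Up\<close> end, only the offset of the two
  \<open>Up\<close> vertices and the two choices of a neighbour are left, a finite check.
  \<open>?a\<close> and \<open>?b\<close> are doubled coordinates of the difference.\<close>

lemma near_mids_aux:
  assumes "dist (mid \<delta> (Up j k) y) (mid \<delta> (Up j' k') w) \<le> \<delta>" "y \<in> nbrs (Up j k)" "w \<in> nbrs (Up j' k')"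
  shows "Up j k = Up j' k' \<or> y = w"
proof -
  let ?a = "va (Up j k) + va y - va (Up j' k') - va w"
  let ?b = "vb (Up j k) + vb y - vb (Up j' k') - vb w"
  have mt: "mid \<delta> x y = tri \<delta> ((va x + va y) / 2) ((vb x + vb y) / 2)" for x y
    by (simp add: mid_def midpoint_def pos_def tri_def complex_eq_iff field_simps)
  have "(dist (mid \<delta> (Up j k) y) (mid \<delta> (Up j' k') w))\<^sup>2 = \<delta>\<^sup>2 * (eis ?a ?b / 4)"
    unfolding mt dist_tri[OF \<delta>] eis_def by (simp add: power2_eq_square field_simps)
  moreover have "(dist (mid \<delta> (Up j k) y) (mid \<delta> (Up j' k') w))\<^sup>2 \<le> \<delta>\<^sup>2"
    using assms(1) by (intro power_mono) auto
  ultimately have "\<delta>\<^sup>2 * (eis ?a ?b / 4) \<le> \<delta>\<^sup>2 * 1" by simp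
  then have "real_of_int (eis ?a ?b) / 4 \<le> 1" using \<delta> by (subst (asm) mult_le_cancel_left_pos) auto
  then have e: "eis ?a ?b \<le> 4" by simp
  from eis_small[OF e] have s: "\<bar>?a\<bar> \<le> 2" "\<bar>?b\<bar> \<le> 2" by auto
  define m n where "m = j - j'" and "n = k - k'"
  have jk: "j = j' + m" "k = k' + n" by (simp_all add: m_def n_def)
  have "m \<in> {-1, 0, 1} \<and> n \<in> {-1, 0, 1}"
    using assms(2,3) s unfolding jk by auto
  then show ?thesis using assms(2,3) e unfolding jk by (auto simp: eis_def)
qed

end

lemma near_mids:
  assumes "\<delta> > 0" "y \<in> nbrs x" "w \<in> nbrs v"
  shows "dist (mid \<delta> x y) (mid \<delta> v w) \<le> \<delta> \<longleftrightarrow> x = v \<or> x = w \<or> y = v \<or> y = w"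
proof
  have up: "\<exists>j k z. z \<in> nbrs (Up j k) \<and> (x = Up j k \<and> y = z \<or> x = z \<and> y = Up j k)" if "y \<in> nbrs x" for x y
    using that nbrs_sym[OF that] by (cases x; cases y; simp; blast)
  assume d: "dist (mid \<delta> x y) (mid \<delta> v w) \<le> \<delta>"
  obtain j k z where z: "z \<in> nbrs (Up j k)" "x = Up j k \<and> y = z \<or> x = z \<and> y = Up j k"
    using up assms(2) by blast
  obtain j' k' z' where z': "z' \<in> nbrs (Up j' k')" "v = Up j' k' \<and> w = z' \<or> v = z' \<and> w = Up j' k'"
    using up assms(3) by blast
  have "mid \<delta> x y = mid \<delta> (Up j k) z" "mid \<delta> v w = mid \<delta> (Up j' k') z'"
    using z(2) z'(2) by (auto simp only: mid_sym)
  then have "dist (mid \<delta> (Up j k) z) (mid \<delta> (Up j' k') z') \<le> \<delta>" using d by simp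
  then show "x = v \<or> x = w \<or> y = v \<or> y = w"
    using near_mids_aux[OF assms(1) _ z(1) z'(1)] z(2) z'(2) by blast
next
  have near: "dist (mid \<delta> p q) (mid \<delta> p r) \<le> \<delta>" if "q \<in> nbrs p" "r \<in> nbrs p" for p q r
    using dist_triangle2[of "mid \<delta> p q" "mid \<delta> p r" "pos \<delta> p"]
      dist_mid[OF assms(1) that(1)] dist_mid[OF assms(1) that(2)] by (simp add: dist_commute)
  assume "x = v \<or> x = w \<or> y = v \<or> y = w"
  then show "dist (mid \<delta> x y) (mid \<delta> v w) \<le> \<delta>"
    using near[of y x w] near[of y x v] near[of x y w] near[of x y v] assms(2,3)
      nbrs_sym[OF assms(2)] nbrs_sym[OF assms(3)]
    by (elim disjE) (simp_all add: mid_sym)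
qed

section \<open>The tiling by hexagons and the outside of a component\<close>

lemma centre_ex:
  assumes "(3::int) dvd p + q"
  shows "\<exists>h. ha h = p \<and> hb h = q"
proof -
  obtain r where "p + q = 3 * r" using assms by (rule dvdE)
  then show ?thesis by (intro exI[of _ "(p - r, q - r)"]) simp
qed

text \<open>Take the unit cell of \<open>z\<close> in the coordinates. Depending on
  \<open>i + l\<close> modulo 3, either a corner on the main diagonal is a centre, and its hexagon
  contains the cell, or both other corners are, and their hexagons share the cell along the
  diagonal.\<close>

lemma hexset_cover:
  assumes "\<delta> > 0"
  obtains h where "z \<in> hexset \<delta> h"
proof -
  define i l where "i = \<lfloor>crdA \<delta> z\<rfloor>" and "l = \<lfloor>crdB \<delta> z\<rfloor>"
  have f: "0 \<le> crdA \<delta> z - i" "crdA \<delta> z - i < 1" "0 \<le> crdB \<delta> z - l" "crdB \<delta> z - l < 1"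
    unfolding i_def l_def by linarith+
  have "\<exists>p q. 3 dvd p + q \<and> hexball (crdA \<delta> z - real_of_int p) (crdB \<delta> z - real_of_int q)"
  proof -
    have "3 dvd i + l \<or> 3 dvd (i + 1) + (l + 1) \<or> 3 dvd (i + 1) + l \<and> 3 dvd i + (l + 1)"
    proof -
      define q r where "q = (i + l) div 3" and "r = (i + l) mod 3"
      have e: "i + l = 3 * q + r" by (simp add: q_def r_def)
      have "r = 0 \<or> r = 1 \<or> r = 2"
        using pos_mod_sign[of 3 "i + l"] pos_mod_bound[of 3 "i + l"] unfolding r_def by linarith
      then consider "i + l = 3 * q" | "(i + 1) + (l + 1) = 3 * (q + 1)"
        | "(i + 1) + l = 3 * (q + 1)" "i + (l + 1) = 3 * (q + 1)" using e by fastforce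
      then show ?thesis
      proof cases
        case 1
        from dvdI[OF this] show ?thesis by blast
      next
        case 2
        from dvdI[OF this] show ?thesis by blast
      next
        case 3
        from dvdI[OF this(1)] dvdI[OF this(2)] show ?thesis by blast
      qed
    qed
    moreover have "hexball (crdA \<delta> z - real_of_int i) (crdB \<delta> z - real_of_int l)"
      "hexball (crdA \<delta> z - real_of_int (i + 1)) (crdB \<delta> z - real_of_int (l + 1))"
      using f unfolding hexball_def by auto
    moreover have "hexball (crdA \<delta> z - real_of_int (i + 1)) (crdB \<delta> z - real_of_int l) \<or>
      hexball (crdA \<delta> z - real_of_int i) (crdB \<delta> z - real_of_int (l + 1))"
      using f unfolding hexball_def by (cases "crdA \<delta> z - i \<ge> crdB \<delta> z - l") auto
    ultimately show ?thesis by blast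
  qed
  then obtain h where "hexball (crdA \<delta> z - ha h) (crdB \<delta> z - hb h)" using centre_ex by metis
  then show thesis using that mem_hexset[OF assms] by blast
qed

text \<open>Only three hexagons meet at a corner, so touching at a point already forces a common
  side. This identifies topological contact with adjacency.\<close>

lemma hexset_meet:
  assumes "\<delta> > 0" "z \<in> hexset \<delta> g" "z \<in> hexset \<delta> h" "g \<noteq> h"
  shows "hadj g h"
proof -
  obtain j k j' k' where gh: "g = (j, k)" "h = (j', k')" by (cases g; cases h)
  have a: "\<bar>ha g - ha h\<bar> \<le> 2" "\<bar>hb g - hb h\<bar> \<le> 2" "\<bar>(ha g - ha h) - (hb g - hb h)\<bar> \<le> 2"
    using assms(2,3) unfolding mem_hexset[OF assms(1)] hexball_def by linarith+
  define m n where "m = j' - j" and "n = k' - k"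
  have mn: "j' = j + m" "k' = k + n" by (simp_all add: m_def n_def)
  have b: "\<bar>2 * m + n\<bar> \<le> 2" "\<bar>m + 2 * n\<bar> \<le> 2" "\<bar>m - n\<bar> \<le> 2"
    using a unfolding gh mn by simp_all
  then have "m \<in> {-1, 0, 1} \<and> n \<in> {-1, 0, 1}" by auto
  then show ?thesis using b assms(4) unfolding gh mn by auto
qed

lemma hadj_sym: "hadj g h \<Longrightarrow> hadj h g"
  by (cases g; cases h) auto

lemma hexset_inj: "\<delta> > 0 \<Longrightarrow> hexset \<delta> g = hexset \<delta> h \<Longrightarrow> g = h"
proof -
  assume \<delta>: "\<delta> > 0" and eq: "hexset \<delta> g = hexset \<delta> h"
  have m: "v \<in> hexset \<delta> g \<longleftrightarrow> v \<in> hexset \<delta> h" for v using eq by simp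
  obtain j k j' k' where gh: "g = (j, k)" "h = (j', k')" by (cases g; cases h)
  have "g \<in> hexs v \<longleftrightarrow> h \<in> hexs v" for v
    using m[of "pos \<delta> v"] pos_mem_hexset[OF \<delta>] by simp
  from this[of "Up j k"] this[of "Dn j k"] show "g = h" unfolding gh by auto
qed

lemma hexagons_hexset: "hexagons \<delta> = range (hexset \<delta>)"
  unfolding hexagons_def hexset_def by (auto simp: image_iff) blast

lemma convex_hexset: "convex (hexset \<delta> h)" by (simp add: hexset_def)

lemma compact_hexset: "compact (hexset \<delta> h)"
  unfolding hexset_hull by (intro finite_imp_compact_convex_hull) simp

lemma hadj_hex_adjacent:
  assumes "\<delta> > 0" "hadj g h"
  shows "hex_adjacent \<delta> (hexset \<delta> g) (hexset \<delta> h)"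
proof -
  obtain v w where vw: "w \<in> nbrs v" "hexs v \<inter> hexs w = {g, h}" "g \<noteq> h"
    by (rule hadj_edge[OF assms(2)])
  have "closed_segment (pos \<delta> v) (pos \<delta> w) \<subseteq> hexset \<delta> f" if "f \<in> {g, h}" for f
  proof (rule closed_segment_subset)
    have "f \<in> hexs v" "f \<in> hexs w" using that vw(2) by auto
    then show "pos \<delta> v \<in> hexset \<delta> f" "pos \<delta> w \<in> hexset \<delta> f" using pos_mem_hexset[OF assms(1)] by auto
  qed (rule convex_hexset)
  moreover have "lattice_edge \<delta> (pos \<delta> v) (pos \<delta> w)" using vw(1) lattice_edge_iff[OF assms(1)] by blast
  moreover have "hexset \<delta> g \<noteq> hexset \<delta> h" using hexset_inj[OF assms(1)] vw(3) by blast
  ultimately show ?thesis unfolding hex_adjacent_def by blast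
qed

lemma finite_hexsets_near:
  assumes "\<delta> > 0"
  shows "finite {h. hexset \<delta> h \<inter> cball w 1 \<noteq> {}}"
proof -
  have "continuous_on (cball w 1) (crdA \<delta>)" "continuous_on (cball w 1) (crdB \<delta>)"
    unfolding crdA_def crdB_def by (intro continuous_intros; use assms in simp)+
  then have "bounded (crdA \<delta> ` cball w 1)" "bounded (crdB \<delta> ` cball w 1)"
    by (intro compact_imp_bounded compact_continuous_image compact_cball; simp)+
  then obtain M M' where M: "\<forall>p\<in>cball w 1. \<bar>crdA \<delta> p\<bar> \<le> M" "\<forall>p\<in>cball w 1. \<bar>crdB \<delta> p\<bar> \<le> M'"
    unfolding bounded_iff by auto
  define N where "N = \<lceil>M\<rceil> + 1"
  define N' where "N' = \<lceil>M'\<rceil> + 1"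
  have "(\<lambda>h. (ha h, hb h)) ` {h. hexset \<delta> h \<inter> cball w 1 \<noteq> {}} \<subseteq> {-N..N} \<times> {-N'..N'}"
  proof (rule image_subsetI)
    fix h assume "h \<in> {h. hexset \<delta> h \<inter> cball w 1 \<noteq> {}}"
    then obtain p where "p \<in> hexset \<delta> h" "p \<in> cball w 1" by blast
    then have "\<bar>crdA \<delta> p - ha h\<bar> \<le> 1" "\<bar>crdB \<delta> p - hb h\<bar> \<le> 1" "\<bar>crdA \<delta> p\<bar> \<le> M" "\<bar>crdB \<delta> p\<bar> \<le> M'"
      using M by (auto simp: mem_hexset[OF assms] hexball_def)
    then have "\<bar>ha h\<bar> \<le> N" "\<bar>hb h\<bar> \<le> N'"
      unfolding N_def N'_def by linarith+
    then show "(ha h, hb h) \<in> {-N..N} \<times> {-N'..N'}" by auto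
  qed
  then have "finite ((\<lambda>h. (ha h, hb h)) ` {h. hexset \<delta> h \<inter> cball w 1 \<noteq> {}})"
    by (rule finite_subset) simp
  moreover have "inj_on (\<lambda>h. (ha h, hb h)) {h. hexset \<delta> h \<inter> cball w 1 \<noteq> {}}"
    using h_coord_inj by (auto simp: inj_on_def)
  ultimately show ?thesis by (rule finite_imageD)
qed

lemma hex_component_hexagons:
  assumes "hex_component \<delta> D Cx" "x \<in> Cx"
  shows "x \<in> hexagons_in \<delta> D"
  using assms unfolding hex_component_def by (auto elim: rtranclE)

lemma hex_component_step:
  assumes "hex_component \<delta> D Cx" "x \<in> Cx" "y \<in> hexagons_in \<delta> D" "hex_adjacent \<delta> x y"
  shows "y \<in> Cx"
proof -
  let ?r = "{(x, y). x \<in> hexagons_in \<delta> D \<and> y \<in> hexagons_in \<delta> D \<and> hex_adjacent \<delta> x y}"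
  obtain h where h: "Cx = {h'. (h, h') \<in> ?r\<^sup>*}" using assms(1) unfolding hex_component_def by blast
  have "(x, y) \<in> ?r" using assms hex_component_hexagons by blast
  then show ?thesis using assms(2) unfolding h by (auto intro: rtrancl_into_rtrancl)
qed

text \<open>A bounded set of hexagons cut off by \<open>C\<close> contains a point outside \<open>D\<close>, whose component in
  the complement of \<open>D\<close> is unbounded and hence crosses the surrounding hexagons of \<open>C\<close>.\<close>

lemma unbounded_outside_component:
  assumes \<delta>: "\<delta> > 0" and D: "open D" "simply_connected D" and comp: "hex_component \<delta> D Cx"
    and C: "C = {h. hexset \<delta> h \<in> Cx}" and h: "h \<notin> C"
  shows "infinite {h'. (h, h') \<in> {(a, b). a \<notin> C \<and> b \<notin> C \<and> hadj a b}\<^sup>*}" (is "infinite ?K")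
proof
  assume fin: "finite ?K"
  have K_step: "b \<in> ?K" if "a \<in> ?K" "hadj a b" "b \<notin> C" for a b
  proof -
    have "a \<notin> C" using that(1) h by (auto elim: rtranclE)
    then show ?thesis using that by (auto intro: rtrancl_into_rtrancl)
  qed
  have CD: "hexset \<delta> c \<subseteq> D" if "c \<in> C" for c
    using hex_component_hexagons[OF comp] that unfolding C hexagons_in_def by blast
  \<comment> \<open>Otherwise the row starting at \<open>h\<close> would never meet \<open>C\<close>
    and would lie in \<open>?K\<close> entirely.\<close>
  have "\<exists>k\<in>?K. \<exists>c\<in>C. hadj k c"
  proof (rule ccontr)
    assume no: "\<not> ?thesis"
    obtain j k where jk: "h = (j, k)" by (cases h)
    have "(j + int n, k) \<in> ?K" for n
    proof (induction n)
      case (Suc n)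
      have ad: "hadj (j + int n, k) (j + int (Suc n), k)" by simp
      then have "(j + int (Suc n), k) \<notin> C" using Suc no by blast
      then show ?case using K_step[OF Suc ad] by blast
    qed (simp add: jk)
    then have "(\<lambda>n. (j + int n, k)) ` UNIV \<subseteq> ?K" by blast
    moreover have "infinite ((\<lambda>n. (j + int n, k)) ` UNIV)"
      by (rule range_inj_infinite) (auto simp: inj_on_def)
    ultimately show False using fin finite_subset by blast
  qed
  then obtain k c where kc: "k \<in> ?K" "c \<in> C" "hadj k c" by blast
  have kC: "k \<notin> C" using kc(1) h by (auto elim: rtranclE)
  \<comment> \<open>A hexagon inside \<open>D\<close> that is adjacent to one of the component
    belongs to the component.\<close>
  have "\<not> hexset \<delta> k \<subseteq> D"
  proof
    assume "hexset \<delta> k \<subseteq> D"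
    then have "hexset \<delta> k \<in> hexagons_in \<delta> D" by (auto simp: hexagons_in_def hexagons_hexset)
    then have "hexset \<delta> k \<in> Cx"
      using hex_component_step[OF comp _ _ hadj_hex_adjacent[OF \<delta> hadj_sym[OF kc(3)]]] kc(2) C by blast
    then show False using kC C by blast
  qed
  then obtain z where z: "z \<in> hexset \<delta> k" "z \<notin> D" by blast
  define Q where "Q = connected_component_set (- D) z"
  have "Q \<in> components (- D)" using z(2) unfolding Q_def components_def by blast
  \<comment> \<open>The place where simple connectivity enters: the complement of \<open>D\<close>
    has no bounded component.\<close>
  then have unb: "\<not> bounded Q"
    using D simply_connected_eq_unbounded_complement_components by blast
  have QD: "Q \<subseteq> - D" unfolding Q_def by (rule connected_component_subset)
  have zQ: "z \<in> Q" unfolding Q_def using z(2) by simp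
  define S where "S = (\<Union>h\<in>?K. hexset \<delta> h)"
  have S: "compact S" unfolding S_def by (rule compact_UN[OF fin compact_hexset])
  have "Q \<inter> frontier S \<noteq> {}"
  proof (rule connected_Int_frontier)
    show "connected Q" unfolding Q_def by simp
    show "Q \<inter> S \<noteq> {}" using zQ z(1) kc(1) unfolding S_def by blast
    show "Q - S \<noteq> {}" using unb compact_imp_bounded[OF S] bounded_subset by blast
  qed
  then obtain w where w: "w \<in> Q" "w \<in> frontier S" by blast
  then have "w \<in> S" using compact_imp_closed[OF S] frontier_subset_closed by blast
  then obtain k' where k': "k' \<in> ?K" "w \<in> hexset \<delta> k'" unfolding S_def by blast
  \<comment> \<open>By local finiteness the nearby hexagons that are not in \<open>?K\<close> form a
    closed set. If \<open>w\<close> were in none of them, a whole neighbourhood of \<open>w\<close>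
    would be covered by \<open>S\<close>, and \<open>w\<close> would not be a frontier
    point.\<close>
  have "\<exists>h'. h' \<notin> ?K \<and> w \<in> hexset \<delta> h'"
  proof (rule ccontr)
    assume all: "\<not> ?thesis"
    define N where "N = {h. hexset \<delta> h \<inter> cball w 1 \<noteq> {}}"
    define M where "M = (\<Union>h\<in>N - ?K. hexset \<delta> h)"
    have "finite (N - ?K)" unfolding N_def using finite_hexsets_near[OF \<delta>] by simp
    then have "closed M" unfolding M_def by (intro closed_UN ballI compact_imp_closed compact_hexset)
    then have "open (ball w 1 - M)" by (simp add: open_Diff)
    moreover have "w \<in> ball w 1 - M" using all unfolding M_def by auto
    moreover have "ball w 1 - M \<subseteq> S"
    proof
      fix p assume p: "p \<in> ball w 1 - M"
      obtain f where f: "p \<in> hexset \<delta> f" by (rule hexset_cover[OF \<delta>])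
      have "p \<in> cball w 1" using p by auto
      then have "f \<in> N" using f unfolding N_def by blast
      then have "f \<in> ?K" using p f unfolding M_def by blast
      then show "p \<in> S" using f unfolding S_def by blast
    qed
    ultimately have "w \<in> interior S" by (rule interiorI)
    then show False using w(2) by (simp add: frontier_def)
  qed
  then obtain h' where h': "h' \<notin> ?K" "w \<in> hexset \<delta> h'" by blast
  then have "k' \<noteq> h'" using k'(1) by blast
  then have "hadj k' h'" by (rule hexset_meet[OF \<delta> k'(2) h'(2)])
  then have "h' \<in> C" using K_step[OF k'(1)] h'(1) by blast
  then show False using CD h'(2) w(1) QD by blast
qed

section \<open>Paths as lists of points\<close>

text \<open>The list of mid-edges and vertices visited by a path which runs from the centre of the first
  to the centre of the last edge of a lattice walk.\<close>

fun lift :: "real \<Rightarrow> vtx list \<Rightarrow> complex list" where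
  "lift \<delta> (x # y # z # us) = mid \<delta> x y # pos \<delta> y # lift \<delta> (y # z # us)"
| "lift \<delta> [x, y] = [mid \<delta> x y]"
| "lift \<delta> us = []"

lemma lift_snoc: "lift \<delta> (us @ [x, y, z]) = lift \<delta> (us @ [x, y]) @ [pos \<delta> y, mid \<delta> y z]"
proof (induction us)
  case (Cons u us)
  then show ?case
  proof (cases us)
    case (Cons w ws)
    then show ?thesis using Cons.IH by (cases ws) auto
  qed simp
qed simp

lemma rev_lift: "rev (lift \<delta> us) = lift \<delta> (rev us)"
proof (induction \<delta> us rule: lift.induct)
  case (1 \<delta> x y z us)
  have "lift \<delta> (rev (x # y # z # us)) = lift \<delta> (rev (z # us) @ [y]) @ [pos \<delta> y, mid \<delta> y x]"
    using lift_snoc[of \<delta> "rev us" z y x] by simp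
  then show ?case using 1 by (simp add: mid_sym)
qed (simp_all add: mid_sym)

text \<open>\<open>w0\<close> and \<open>y\<close> are not visited as ends of the path; they only
  name its first and its last mid-edge.\<close>

definition path_list :: "real \<Rightarrow> vtx \<Rightarrow> vtx list \<Rightarrow> vtx \<Rightarrow> complex list" where
  "path_list \<delta> w0 xs y = lift \<delta> (w0 # xs @ [y])"

lemma path_list_Nil: "path_list \<delta> w0 [] y = [mid \<delta> w0 y]"
  by (simp add: path_list_def)

lemma path_list_snoc: "path_list \<delta> w0 (xs @ [x]) y = path_list \<delta> w0 xs x @ [pos \<delta> x, mid \<delta> x y]"
proof (cases xs rule: rev_cases)
  case (snoc ys z)
  then show ?thesis using lift_snoc[of \<delta> "w0 # ys" z x y] by (simp add: path_list_def)
qed (simp add: path_list_def)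

lemma length_path_list: "length (path_list \<delta> w0 xs y) = 2 * length xs + 1"
  by (induction xs arbitrary: y rule: rev_induct) (simp_all add: path_list_Nil path_list_snoc)

lemma path_list_not_Nil [simp]: "path_list \<delta> w0 xs y \<noteq> []"
  using length_path_list[of \<delta> w0 xs y] by auto

lemma last_path_list: "xs \<noteq> [] \<Longrightarrow> last (path_list \<delta> w0 xs y) = mid \<delta> (last xs) y"
  by (cases xs rule: rev_cases) (simp_all add: path_list_snoc)

lemma last_butlast_path_list: "xs \<noteq> [] \<Longrightarrow> last (butlast (path_list \<delta> w0 xs y)) = pos \<delta> (last xs)"
  by (cases xs rule: rev_cases) (simp_all add: path_list_snoc butlast_append)

lemma rev_path_list: "rev (path_list \<delta> w0 xs y) = path_list \<delta> y (rev xs) w0"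
  by (simp add: path_list_def rev_lift)

definition linked :: "real \<Rightarrow> complex \<Rightarrow> complex \<Rightarrow> bool" where
  "linked \<delta> p q \<longleftrightarrow> half_edge \<delta> p q \<or> half_edge \<delta> q p"

lemma polygonal_path_iff:
  "polygonal_path \<delta> p \<longleftrightarrow>
     p \<noteq> [] \<and> set p \<subseteq> lattice_vertices \<delta> \<union> mid_edges \<delta> \<and> successively (linked \<delta>) p"
  by (simp add: polygonal_path_def successively_conv_nth linked_def)

lemma path_trace_single [simp]: "path_trace [a] = {a}"
  by (simp add: path_trace_def)

lemma path_trace_Cons: "path_trace (a # b # p) = closed_segment a b \<union> path_trace (b # p)"
proof -
  have "{i. Suc i < length (a # b # p)} = insert 0 (Suc ` {i. Suc i < length (b # p)})"
    by (auto simp: image_iff gr0_conv_Suc) (metis Suc_less_eq not0_implies_Suc)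
  then have "(\<Union>i\<in>{i. Suc i < length (a # b # p)}. closed_segment ((a # b # p) ! i) ((a # b # p) ! Suc i)) =
      closed_segment a b \<union> (\<Union>i\<in>{i. Suc i < length (b # p)}. closed_segment ((b # p) ! i) ((b # p) ! Suc i))"
    by (simp only: UN_insert) simp
  moreover have "{a, b} \<subseteq> closed_segment a b" by simp
  ultimately show ?thesis unfolding path_trace_def by auto
qed

lemma set_subset_path_trace: "set p \<subseteq> path_trace p"
  by (simp add: path_trace_def)

context
  fixes \<delta> :: real
  assumes \<delta>: "\<delta> > 0"
begin

lemma half_edgeE:
  assumes "half_edge \<delta> p q"
  obtains v w where "w \<in> nbrs v" "p = pos \<delta> v" "q = mid \<delta> v w"
  using assms half_edge_iff[OF \<delta>] by blast

lemma half_edge_pos_mid: "w \<in> nbrs v \<Longrightarrow> half_edge \<delta> (pos \<delta> v) (mid \<delta> v w)"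
  using half_edge_iff[OF \<delta>] by blast

lemma half_edge_pos_iff:
  "half_edge \<delta> (pos \<delta> v) q \<longleftrightarrow> (\<exists>w\<in>nbrs v. q = mid \<delta> v w)"
  using half_edge_iff[OF \<delta>] pos_inj[of \<delta>] \<delta> by auto

lemma half_edge_mid_iff:
  "w \<in> nbrs v \<Longrightarrow> half_edge \<delta> q (mid \<delta> v w) \<longleftrightarrow> q = pos \<delta> v \<or> q = pos \<delta> w"
  unfolding half_edge_iff[OF \<delta>] using mid_inj[OF \<delta>, of w v] nbrs_sym mid_sym[of \<delta> v w] by blast

lemma path_traceE:
  assumes "successively (linked \<delta>) p" "x \<in> path_trace p"
  shows "x \<in> set p \<or> (\<exists>v w. w \<in> nbrs v \<and> pos \<delta> v \<in> set p \<and> mid \<delta> v w \<in> set p \<and>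
    x \<in> closed_segment (pos \<delta> v) (mid \<delta> v w))"
  using assms
proof (induction p rule: induct_list012)
  case (3 a b p)
  show ?case
  proof (cases "x \<in> closed_segment a b")
    case True
    have "linked \<delta> a b" using 3 by simp
    then consider "half_edge \<delta> a b" | "half_edge \<delta> b a" unfolding linked_def by blast
    then show ?thesis
    proof cases
      case 1
      then obtain v w where "w \<in> nbrs v" "a = pos \<delta> v" "b = mid \<delta> v w" by (rule half_edgeE)
      then show ?thesis using True by auto
    next
      case 2
      then obtain v w where "w \<in> nbrs v" "b = pos \<delta> v" "a = mid \<delta> v w" by (rule half_edgeE)
      then show ?thesis using True by (auto simp: closed_segment_commute)
    qed
  next
    case False
    then have "x \<in> path_trace (b # p)" "successively (linked \<delta>) (b # p)"
      using 3 by (auto simp: path_trace_Cons)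
    then show ?thesis using 3 by (metis list.set_intros(2))
  qed
qed (auto simp: path_trace_def)

lemma lattice_point_on_half_edge:
  assumes "x \<in> lattice_vertices \<delta> \<union> mid_edges \<delta>" "w \<in> nbrs v"
    "x \<in> closed_segment (pos \<delta> v) (mid \<delta> v w)"
  shows "x = pos \<delta> v \<or> x = mid \<delta> v w"
  using assms pos_on_half_edge[OF \<delta> assms(2)] mid_on_half_edge[OF \<delta> assms(2)]
  unfolding lattice_vertices_pos by (auto simp: mid_edges_iff[OF \<delta>])

text \<open>Half-edges at the same vertex share a listed vertex. Half-edges at different vertices
  meet at most in a common mid-edge, which is listed as well.\<close>

lemma path_trace_disjoint:
  assumes p: "successively (linked \<delta>) p" "set p \<subseteq> lattice_vertices \<delta> \<union> mid_edges \<delta>"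
    and q: "successively (linked \<delta>) q" "set q \<subseteq> lattice_vertices \<delta> \<union> mid_edges \<delta>"
    and disj: "set p \<inter> set q = {}"
  shows "path_trace p \<inter> path_trace q = {}"
proof (rule ccontr)
  assume "path_trace p \<inter> path_trace q \<noteq> {}"
  then obtain x where x: "x \<in> path_trace p" "x \<in> path_trace q" by blast
  consider (a) "x \<in> set p" | (b) v w where "w \<in> nbrs v" "pos \<delta> v \<in> set p" "mid \<delta> v w \<in> set p"
      "x \<in> closed_segment (pos \<delta> v) (mid \<delta> v w)"
    using path_traceE[OF p(1) x(1)] by blast
  then show False
  proof cases
    case a
    consider (c) "x \<in> set q" | (d) v w where "w \<in> nbrs v" "pos \<delta> v \<in> set q" "mid \<delta> v w \<in> set q"
        "x \<in> closed_segment (pos \<delta> v) (mid \<delta> v w)"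
      using path_traceE[OF q(1) x(2)] by blast
    then show False
    proof cases
      case d
      then show False using lattice_point_on_half_edge[of x w v] a p(2) disj by blast
    qed (use a disj in blast)
  next
    case b
    consider (c) "x \<in> set q" | (d) v' w' where "w' \<in> nbrs v'" "pos \<delta> v' \<in> set q" "mid \<delta> v' w' \<in> set q"
        "x \<in> closed_segment (pos \<delta> v') (mid \<delta> v' w')"
      using path_traceE[OF q(1) x(2)] by blast
    then show False
    proof cases
      case c
      then show False using lattice_point_on_half_edge[of x w v] b q(2) disj by blast
    next
      case d
      then have "v \<noteq> v'" using b disj by blast
      then have "mid \<delta> v w = mid \<delta> v' w'"
        using half_edges_meet[OF \<delta> b(1) d(1) _ b(4) d(4)] by simp
      then show False using b(3) d(3) disj by auto
    qed
  qed
qed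

lemma other_end_mid:
  assumes "w \<in> nbrs v"
  shows "other_end \<delta> (mid \<delta> v w) (pos \<delta> v) = pos \<delta> w"
  unfolding other_end_def half_edge_mid_iff[OF assms]
  by (rule the_equality) (use assms pos_inj[of \<delta>] \<delta> in auto)

end

section \<open>Explorations within a subset of the plane\<close>

text \<open>\<open>A\<close> is the set in which paths must stay. \<open>hA\<close> is directed and
  refers to the half of the edge next to its first argument; \<open>hA_both\<close> says that only
  edges of the region can be crossed from end to end.\<close>

locale lattice_exploration =
  hex_exploration C T hA "\<lambda>y z. mid \<delta> y z = t" for C T hA and \<delta> :: real and t :: complex +
  fixes A :: "complex set"
  assumes \<delta>: "\<delta> > 0"
    and hA_iff: "z \<in> nbrs y \<Longrightarrow> closed_segment (pos \<delta> y) (mid \<delta> y z) \<subseteq> A \<longleftrightarrow> hA y z"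
    and T_iff: "u \<in> T \<longleftrightarrow> (\<exists>w. hA u w \<and> mid \<delta> u w = t)"
    and hA_both: "hA y z \<Longrightarrow> hA z y \<Longrightarrow> edge_in C y z"
    and t_mid: "t \<in> mid_edges \<delta>"
begin

lemma hA_seg: "hA y z \<Longrightarrow> closed_segment (pos \<delta> y) (mid \<delta> y z) \<subseteq> A"
  using hA_iff hA_nbrs by blast

lemma target_not_pos: "t \<noteq> pos \<delta> u"
  using t_mid mid_neq_pos[OF \<delta>] by (auto simp: mid_edges_iff[OF \<delta>])

text \<open>Induction from the front of the path. At a mid-edge it is open which half comes next,
  hence the disjunction. Where the path crosses an edge, both halves lie in \<open>A\<close>, so the
  edge is in the region.\<close>

lemma path_imp_reach:
  assumes "polygonal_path \<delta> p" "path_trace p \<subseteq> A" "set p \<inter> pos \<delta> ` X = {}" "last p = t"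
  shows "(\<forall>u. hd p = pos \<delta> u \<longrightarrow> u \<in> reach C T X) \<and>
    (\<forall>u w. w \<in> nbrs u \<longrightarrow> hd p = mid \<delta> u w \<longrightarrow>
       mid \<delta> u w = t \<or> u \<in> reach C T X \<and> hA u w \<or> w \<in> reach C T X \<and> hA w u)"
  using assms
proof (induction p rule: induct_list012)
  case (2 e)
  then show ?case using target_not_pos by auto
next
  case (3 e f q)
  have tail: "polygonal_path \<delta> (f # q)" "path_trace (f # q) \<subseteq> A" "set (f # q) \<inter> pos \<delta> ` X = {}"
    "last (f # q) = t" and seg: "closed_segment e f \<subseteq> A" and ef: "linked \<delta> e f"
    using 3(3-6) by (auto simp: polygonal_path_iff path_trace_Cons)
  note IH = 3(2)[OF tail]
  have "u \<in> reach C T X" if u: "e = pos \<delta> u" for u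
  proof -
    have uX: "u \<notin> X" using 3(5) u by auto
    have "half_edge \<delta> e f"
      using ef unfolding linked_def u by (metis half_edgeE[OF \<delta>] mid_neq_pos[OF \<delta>])
    then obtain w where w: "w \<in> nbrs u" "f = mid \<delta> u w"
      unfolding u half_edge_pos_iff[OF \<delta>] by blast
    have hA: "hA u w" using seg hA_iff[OF w(1)] unfolding u w(2) by simp
    from IH w have "mid \<delta> u w = t \<or> u \<in> reach C T X \<or> w \<in> reach C T X \<and> hA w u" by auto
    then show ?thesis
    proof (elim disjE)
      assume "mid \<delta> u w = t"
      then have "u \<in> T" using T_iff hA by blast
      then show ?thesis using uX by (rule reach_target)
    next
      assume "w \<in> reach C T X \<and> hA w u"
      then show ?thesis using reach_step[of C w u] hA_both hA uX edge_in_sym by blast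
    qed
  qed
  moreover have "u \<in> reach C T X \<and> hA u w \<or> w \<in> reach C T X \<and> hA w u"
    if u: "w \<in> nbrs u" "e = mid \<delta> u w" for u w
  proof -
    have "half_edge \<delta> f e"
      using ef unfolding linked_def u(2) by (metis half_edgeE[OF \<delta>] mid_neq_pos[OF \<delta> u(1)])
    then consider "f = pos \<delta> u" | "f = pos \<delta> w"
      unfolding u(2) half_edge_mid_iff[OF \<delta> u(1)] by blast
    then show ?thesis
    proof cases
      case 1
      then have "u \<in> reach C T X" using IH by simp
      moreover have "hA u w" using seg hA_iff[OF u(1)] unfolding u 1 by (simp add: closed_segment_commute)
      ultimately show ?thesis by blast
    next
      case 2
      then have "w \<in> reach C T X" using IH by simp
      moreover have "hA w u"
        using seg hA_iff[OF nbrs_sym[OF u(1)]] unfolding u 2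
        by (simp add: closed_segment_commute mid_sym)
      ultimately show ?thesis by blast
    qed
  qed
  ultimately show ?case by auto
qed (simp add: polygonal_path_def)

text \<open>The points a witness may use without meeting a past with vertices \<open>X\<close>:
  every mid-edge listed in the past has an end in \<open>X\<close>, and the target has not been met
  yet.\<close>

definition clear :: "vtx set \<Rightarrow> complex set" where
  "clear X = {pos \<delta> u | u. u \<notin> X} \<union> {mid \<delta> u w | u w. w \<in> nbrs u \<and> u \<notin> X \<and> w \<notin> X} \<union> {t}"

lemma reach_imp_path:
  assumes "u \<in> reach C T X"
  shows "\<exists>p. polygonal_path \<delta> p \<and> hd p = pos \<delta> u \<and> last p = t \<and> path_trace p \<subseteq> A \<and> set p \<subseteq> clear X"
proof -
  obtain v where v: "v \<in> T" "v \<notin> X" and uv: "(u, v) \<in> free_conn C X"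
    using assms by (auto simp: reach_def)
  show ?thesis
    using uv unfolding free_conn_def
  proof (induction rule: converse_rtrancl_induct)
    case base
    obtain w where w: "hA v w" "mid \<delta> v w = t" using v T_iff by blast
    have nb: "w \<in> nbrs v" using hA_nbrs[OF w(1)] .
    have "polygonal_path \<delta> [pos \<delta> v, t]"
      using half_edge_pos_mid[OF \<delta> nb] w(2) t_mid
      by (auto simp: polygonal_path_iff linked_def lattice_vertices_pos)
    moreover have "path_trace [pos \<delta> v, t] \<subseteq> A"
      using hA_seg[OF w(1)] w(2) ends_in_segment(2)[of "pos \<delta> v" t] by (auto simp: path_trace_Cons)
    ultimately show ?case using v(2) by (intro exI[of _ "[pos \<delta> v, t]"]) (auto simp: clear_def)
  next
    case (step u u')
    then obtain p where p: "polygonal_path \<delta> p" "hd p = pos \<delta> u'" "last p = t" "path_trace p \<subseteq> A"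
      "set p \<subseteq> clear X" by blast
    have e: "edge_in C u u'" "u \<notin> X" "u' \<notin> X" using step(1) by auto
    have nb: "u' \<in> nbrs u" using e by (simp add: edge_in_def)
    have seg: "closed_segment (pos \<delta> u) (mid \<delta> u u') \<subseteq> A" "closed_segment (mid \<delta> u u') (pos \<delta> u') \<subseteq> A"
      using hA_seg[OF hA_edge_in[OF e(1)]] hA_seg[OF hA_edge_in[OF edge_in_sym[OF e(1)]]]
      by (simp_all add: mid_sym closed_segment_commute)
    obtain p' where p': "p = pos \<delta> u' # p'" using p(1,2) by (cases p) (auto simp: polygonal_path_iff)
    let ?p = "pos \<delta> u # mid \<delta> u u' # p"
    have "linked \<delta> (pos \<delta> u) (mid \<delta> u u')" "linked \<delta> (mid \<delta> u u') (pos \<delta> u')"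
      using half_edge_pos_mid[OF \<delta> nb] half_edge_pos_mid[OF \<delta> nbrs_sym[OF nb]]
      by (simp_all add: linked_def mid_sym)
    moreover have "mid \<delta> u u' \<in> mid_edges \<delta>" using nb mid_edges_iff[OF \<delta>] by blast
    ultimately have "polygonal_path \<delta> ?p"
      using p(1) by (auto simp: polygonal_path_iff lattice_vertices_pos p')
    moreover have "path_trace ?p \<subseteq> A"
      using p(4) seg unfolding p' path_trace_Cons by simp
    moreover have "set ?p \<subseteq> clear X" using p(5) e nb by (auto simp: clear_def)
    ultimately show ?case using p(3) by (intro exI[of _ ?p]) (simp add: p')
  qed
qed

end

context lattice_exploration
begin

text \<open>\<open>epath w0 v1 xs y\<close>: the path from the centre of the edge \<open>{w0, v1}\<close> through the vertices \<open>xs\<close>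
  to the centre of the last edge, which leads from \<open>last xs\<close> towards \<open>y\<close>, is self-avoiding and
  meets the target at most in its last point.\<close>

inductive epath :: "vtx \<Rightarrow> vtx \<Rightarrow> vtx list \<Rightarrow> vtx \<Rightarrow> bool" for w0 v1 where
  start: "v1 \<in> nbrs w0 \<Longrightarrow> mid \<delta> w0 v1 \<noteq> t \<Longrightarrow> hA v1 z \<Longrightarrow> z \<noteq> w0 \<Longrightarrow> epath w0 v1 [v1] z"
| step: "epath w0 v1 xs y \<Longrightarrow> mid \<delta> (last xs) y \<noteq> t \<Longrightarrow> y \<notin> set xs \<Longrightarrow> hA y z \<Longrightarrow> z \<noteq> last xs \<Longrightarrow>
    epath w0 v1 (xs @ [y]) z"

lemma epath_props:
  assumes "epath w0 v1 xs y"
  shows "xs \<noteq> [] \<and> hd xs = v1 \<and> distinct xs \<and> successively hA (xs @ [y]) \<and> v1 \<in> nbrs w0 \<and> mid \<delta> w0 v1 \<noteq> t"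
  using assms
proof induction
  case (step xs y z)
  then show ?case by (auto simp: successively_append_iff)
qed auto

lemma epath_walk:
  assumes "epath w0 v1 xs y"
  shows "successively (\<lambda>u w. w \<in> nbrs u) (xs @ [y])"
  by (rule successively_mono[of hA]) (use epath_props[OF assms] hA_nbrs in auto)

lemma epath_last: "epath w0 v1 xs y \<Longrightarrow> hA (last xs) y"
  by (induction rule: epath.induct) auto

lemma epath_prefix:
  assumes "epath w0 v1 xs' y'" "prefix (xs @ [y]) (xs' @ [y'])" "xs \<noteq> []"
  shows "epath w0 v1 xs y \<and>
    (xs = xs' \<and> y = y' \<or> prefix (xs @ [y]) xs' \<and> mid \<delta> (last xs) y \<noteq> t \<and> y \<notin> set xs)"
  using assms
proof induction
  case (start z)
  then have "xs = [v1]" "y = z" by (cases xs; auto simp: prefix_Cons)+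
  then show ?case using epath.start start.hyps by blast
next
  case (step us u z)
  from step.prems(1) consider "xs @ [y] = us @ [u] @ [z]" | "prefix (xs @ [y]) (us @ [u])"
    unfolding prefix_snoc by auto
  then show ?case
  proof cases
    case 1
    then have "xs = us @ [u]" "y = z" by auto
    then show ?thesis using epath.step step.hyps by blast
  next
    case 2
    have IH: "epath w0 v1 xs y \<and>
      (xs = us \<and> y = u \<or> prefix (xs @ [y]) us \<and> mid \<delta> (last xs) y \<noteq> t \<and> y \<notin> set xs)"
      using step.IH[OF 2 step.prems(2)] .
    then show ?thesis using 2 step.hyps by auto
  qed
qed

text \<open>A usable half-edge from \<open>z\<close> on an edge which is not in \<open>C\<close> forces \<open>T \<subseteq> {z}\<close>. The path goes on
  to another vertex of \<open>T\<close>, so all its edges are in \<open>C\<close>.\<close>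

lemma reach_along:
  assumes "successively hA (z # us)" "distinct (z # us)" "last (z # us) \<in> T" "set (z # us) \<inter> X = {}"
  shows "z \<in> reach C T X"
  using assms
proof (induction us arbitrary: z)
  case Nil
  then show ?case using reach_target by auto
next
  case (Cons u us)
  have "last (u # us) \<in> T" "last (u # us) \<noteq> z"
    using Cons.prems by (auto split: if_splits)
  then have "\<not> T \<subseteq> {z}" by blast
  moreover have "hA z u" using Cons.prems(1) by simp
  ultimately have "edge_in C z u" using hA_not_edge_in by blast
  moreover have "u \<in> reach C T X" by (rule Cons.IH) (use Cons.prems in auto)
  ultimately show ?case using reach_step[of C u z] edge_in_sym Cons.prems(4) by auto
qed

lemma set_path_list:
  assumes "epath w0 v1 xs y"
  shows "m \<in> set (path_list \<delta> w0 xs y) \<Longrightarrow> m \<in> pos \<delta> ` set xs \<or> m = mid \<delta> w0 v1 \<or>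
    (\<exists>u v. u \<in> set xs \<and> v \<in> set xs \<and> v \<in> nbrs u \<and> m = mid \<delta> u v \<and> m \<noteq> t) \<or> m = mid \<delta> (last xs) y"
  using assms
proof (induction arbitrary: m rule: epath.induct)
  case (start z)
  then show ?case using path_list_snoc[of \<delta> w0 "[]" v1 z] by (auto simp: path_list_Nil)
next
  case (step xs y z)
  have "xs \<noteq> []" using epath_props[OF step.hyps(1)] by blast
  then have l: "last xs \<in> set xs" by simp
  have "y \<in> nbrs (last xs)" using hA_nbrs[OF epath_last[OF step.hyps(1)]] .
  moreover have "m \<in> set (path_list \<delta> w0 xs y) \<or> m = pos \<delta> y \<or> m = mid \<delta> y z"
    using step.prems by (auto simp: path_list_snoc)
  ultimately show ?case using step.IH[of m] step.hyps(2) l by auto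
qed

lemma mid_in_path_list:
  assumes e: "epath w0 v1 xs y" and uv: "v \<in> nbrs u" and m: "mid \<delta> u v \<in> set (path_list \<delta> w0 xs y)"
  shows "u = w0 \<and> v = v1 \<or> u = v1 \<and> v = w0 \<or> u \<in> set xs \<and> v \<in> set xs \<or>
    u = last xs \<and> v = y \<or> u = y \<and> v = last xs"
proof -
  have w0: "v1 \<in> nbrs w0" using epath_props[OF e] by blast
  have yl: "y \<in> nbrs (last xs)" using hA_nbrs[OF epath_last[OF e]] .
  from set_path_list[OF e m] show ?thesis
  proof (elim disjE)
    assume "mid \<delta> u v \<in> pos \<delta> ` set xs"
    then show ?thesis using mid_neq_pos[OF \<delta> uv] by auto
  next
    assume "mid \<delta> u v = mid \<delta> w0 v1"
    from mid_inj[OF \<delta> uv w0 this] show ?thesis by argo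
  next
    assume "\<exists>u' v'. u' \<in> set xs \<and> v' \<in> set xs \<and> v' \<in> nbrs u' \<and> mid \<delta> u v = mid \<delta> u' v' \<and> mid \<delta> u v \<noteq> t"
    then obtain u' v' where *: "u' \<in> set xs" "v' \<in> set xs" "v' \<in> nbrs u'" "mid \<delta> u v = mid \<delta> u' v'" by blast
    from mid_inj[OF \<delta> uv *(3,4)] show ?thesis using *(1,2) by auto
  next
    assume "mid \<delta> u v = mid \<delta> (last xs) y"
    from mid_inj[OF \<delta> uv yl this] show ?thesis by argo
  qed
qed

lemma pos_in_path_list: "epath w0 v1 xs y \<Longrightarrow> pos \<delta> u \<in> set (path_list \<delta> w0 xs y) \<longleftrightarrow> u \<in> set xs"
proof (induction rule: epath.induct)
  case (start z)
  then show ?case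
    using path_list_snoc[of \<delta> w0 "[]" v1 z] mid_neq_pos[OF \<delta>] hA_nbrs[of v1 z] pos_inj[of \<delta>] \<delta>
    by (auto simp: path_list_Nil dest: sym)
next
  case (step xs y z)
  then show ?case
    using mid_neq_pos[OF \<delta> hA_nbrs[OF step.hyps(4)]] pos_inj[of \<delta>] \<delta>
    by (auto simp: path_list_snoc dest: sym)
qed

lemma path_list_path:
  assumes "epath w0 v1 xs y"
  shows "successively (linked \<delta>) (path_list \<delta> w0 xs y) \<and> set (path_list \<delta> w0 xs y) \<subseteq> lattice_vertices \<delta> \<union> mid_edges \<delta>"
  using assms
proof (induction rule: epath.induct)
  case (start z)
  have "z \<in> nbrs v1" using hA_nbrs start by blast
  then have "linked \<delta> (mid \<delta> w0 v1) (pos \<delta> v1)" "linked \<delta> (pos \<delta> v1) (mid \<delta> v1 z)"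
    using half_edge_mid_iff[OF \<delta> start(1)] half_edge_pos_mid[OF \<delta>] by (auto simp: linked_def)
  then show ?case
    using path_list_snoc[of \<delta> w0 "[]" v1 z] start(1) \<open>z \<in> nbrs v1\<close>
    by (auto simp: path_list_Nil lattice_vertices_pos mid_edges_iff[OF \<delta>])
next
  case (step xs y z)
  have ne: "xs \<noteq> []" using epath_props[OF step.hyps(1)] by blast
  have nb: "y \<in> nbrs (last xs)" "z \<in> nbrs y" using hA_nbrs epath_last step.hyps by blast+
  then have "linked \<delta> (mid \<delta> (last xs) y) (pos \<delta> y)" "linked \<delta> (pos \<delta> y) (mid \<delta> y z)"
    using half_edge_mid_iff[OF \<delta> nb(1)] half_edge_pos_mid[OF \<delta>] by (auto simp: linked_def)
  then show ?case
    using step.IH nb(2) last_path_list[OF ne, of \<delta> w0 y]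
    by (auto simp: path_list_snoc successively_append_iff lattice_vertices_pos mid_edges_iff[OF \<delta>])
qed

text \<open>The bridge between the geometric and the combinatorial exploration. By
  \<open>path_trace_disjoint\<close> it suffices that the witness and the history have no listed
  point in common.\<close>

lemma allowable_path_list:
  assumes e: "epath w0 v1 xs y" and nt: "mid \<delta> (last xs) y \<noteq> t" and yx: "y \<notin> set xs"
  shows "allowable \<delta> A t (path_list \<delta> w0 xs y) (pos \<delta> y) = mid \<delta> y ` allow xs y"
proof -
  let ?X = "insert y (set xs)" and ?h = "path_list \<delta> w0 xs y @ [pos \<delta> y]"
  have xs: "xs \<noteq> []" "hd xs = v1" "v1 \<in> nbrs w0" "mid \<delta> w0 v1 \<noteq> t" using epath_props[OF e] by auto
  have lx: "last xs \<in> set xs" "v1 \<in> set xs" using xs by auto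
  have yl: "y \<in> nbrs (last xs)" using hA_nbrs[OF epath_last[OF e]] .
  have last: "last (path_list \<delta> w0 xs y) = mid \<delta> y (last xs)" using last_path_list[OF xs(1)] mid_sym by metis
  have h: "successively (linked \<delta>) ?h" "set ?h \<subseteq> lattice_vertices \<delta> \<union> mid_edges \<delta>"
    using path_list_path[OF e] half_edge_pos_mid[OF \<delta> nbrs_sym[OF yl]] last
    by (auto simp: successively_append_iff linked_def lattice_vertices_pos)
  have X: "pos \<delta> ` ?X \<subseteq> set ?h" using pos_in_path_list[OF e] by auto
  show ?thesis
  proof (intro equalityI subsetI)
    fix m assume "m \<in> allowable \<delta> A t (path_list \<delta> w0 xs y) (pos \<delta> y)"
    then obtain p where m: "half_edge \<delta> (pos \<delta> y) m" "m \<noteq> mid \<delta> y (last xs)"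
        "closed_segment (pos \<delta> y) m \<subseteq> A"
      and p: "polygonal_path \<delta> p" "hd p = m" "last p = t" "path_trace p \<subseteq> A"
        "path_trace p \<inter> path_trace ?h = {}"
      unfolding allowable_def last by blast
    obtain z where z: "z \<in> nbrs y" "m = mid \<delta> y z" using m(1) half_edge_pos_iff[OF \<delta>] by blast
    have "set p \<inter> pos \<delta> ` ?X = {}"
      using p(5) X set_subset_path_trace[of p] set_subset_path_trace[of ?h] by blast
    then have "mid \<delta> y z = t \<or> y \<in> reach C T ?X \<and> hA y z \<or> z \<in> reach C T ?X \<and> hA z y"
      using path_imp_reach[OF p(1,4) _ p(3), of ?X] z p(2) by simp
    \<comment> \<open>\<open>y\<close> belongs to the past, so the witness cannot turn back through
      it.\<close>
    then have "mid \<delta> y z = t \<or> z \<in> reach C T ?X" by (auto simp: reach_def)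
    moreover have "hA y z" using m(3) hA_iff[OF z(1)] z(2) by simp
    moreover have "z \<noteq> last xs" using m(2) z(2) by auto
    ultimately show "m \<in> mid \<delta> y ` allow xs y" using z by (auto simp: allow_def)
  next
    fix m assume "m \<in> mid \<delta> y ` allow xs y"
    then obtain z where m: "m = mid \<delta> y z" and z: "z \<in> nbrs y" "z \<noteq> last xs" "hA y z"
      "mid \<delta> y z = t \<or> z \<in> reach C T ?X" by (auto simp: allow_def)
    have t_h: "t \<notin> set ?h"
    proof
      assume "t \<in> set ?h"
      then have "t \<in> set (path_list \<delta> w0 xs y)" using target_not_pos by auto
      from set_path_list[OF e this] show False using target_not_pos xs(4) nt by auto
    qed
    have mids_h: "u \<in> ?X \<or> v \<in> ?X" if "v \<in> nbrs u" "mid \<delta> u v \<in> set ?h" for u v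
    proof -
      have "mid \<delta> u v \<in> set (path_list \<delta> w0 xs y)" using that mid_neq_pos[OF \<delta>] by auto
      from mid_in_path_list[OF e that(1) this] show ?thesis using lx by auto
    qed
    have "\<exists>p. polygonal_path \<delta> p \<and> hd p = m \<and> last p = t \<and> path_trace p \<subseteq> A \<and> set p \<inter> set ?h = {}"
    proof (cases "mid \<delta> y z = t")
      case True
      have "t \<in> A" using hA_seg[OF z(3)] True by auto
      then show ?thesis
        using True m t_mid t_h by (intro exI[of _ "[t]"]) (auto simp: polygonal_path_iff)
    next
      case False
      then have r: "z \<in> reach C T ?X" using z(4) by blast
      then have zX: "z \<notin> ?X" by (simp add: reach_def)
      from reach_imp_path[OF r] obtain p where p: "polygonal_path \<delta> p" "hd p = pos \<delta> z"
        "last p = t" "path_trace p \<subseteq> A" "set p \<subseteq> clear ?X" by blast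
      obtain p' where p': "p = pos \<delta> z # p'" using p(1,2) by (cases p) (auto simp: polygonal_path_iff)
      \<comment> \<open>\<open>z\<close> reaches an entrance while avoiding \<open>y\<close>. So the
        edge to \<open>z\<close> lies in the region, and the witness may start along its far
        half.\<close>
      have "\<not> T \<subseteq> {y}" using r by (auto simp: reach_def)
      then have edge_in: "edge_in C y z" using hA_not_edge_in z(3) by blast
      have seg: "closed_segment (mid \<delta> y z) (pos \<delta> z) \<subseteq> A"
        using hA_seg[OF hA_edge_in[OF edge_in_sym[OF edge_in]]] by (simp add: mid_sym closed_segment_commute)
      have "polygonal_path \<delta> (m # p)"
        using p(1) half_edge_pos_mid[OF \<delta> nbrs_sym[OF z(1)]] z(1)
        by (auto simp: polygonal_path_iff p' m linked_def mid_sym mid_edges_iff[OF \<delta>])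
      moreover have "path_trace (m # p) \<subseteq> A" using p(4) seg unfolding p' path_trace_Cons m by simp
      moreover have "set p \<inter> set ?h = {}"
      proof -
        have "pos \<delta> u \<notin> set ?h" if "u \<notin> ?X" for u
          using that pos_in_path_list[OF e] pos_inj[of \<delta>] \<delta> by auto
        then show ?thesis using p(5) mids_h t_h unfolding clear_def by blast
      qed
      moreover have "m \<notin> set ?h"
      proof
        assume "m \<in> set ?h"
        then have "mid \<delta> y z \<in> set (path_list \<delta> w0 xs y)" using m mid_neq_pos[OF \<delta> z(1)] by auto
        from mid_in_path_list[OF e z(1) this] show False using lx zX yx z(2) by auto
      qed
      ultimately show ?thesis
        using p(3) by (intro exI[of _ "m # p"]) (auto simp: p')
    qed
    then obtain p where p: "polygonal_path \<delta> p" "hd p = m" "last p = t" "path_trace p \<subseteq> A"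
      "set p \<inter> set ?h = {}" by blast
    have "path_trace p \<inter> path_trace ?h = {}"
      by (rule path_trace_disjoint[OF \<delta> _ _ h p(5)]) (use p(1) in \<open>auto simp: polygonal_path_iff\<close>)
    then have "\<exists>p. polygonal_path \<delta> p \<and> hd p = m \<and> last p = t \<and> path_trace p \<subseteq> A \<and>
        path_trace p \<inter> path_trace ?h = {}"
      using p(1-4) by (intro exI[of _ p] conjI)
    moreover have "m \<noteq> mid \<delta> y (last xs)"
      unfolding m mid_inj2[OF \<delta> z(1) nbrs_sym[OF yl]] by (rule z(2))
    ultimately show "m \<in> allowable \<delta> A t (path_list \<delta> w0 xs y) (pos \<delta> y)"
      unfolding allowable_def last mem_Collect_eq m
      by (intro conjI half_edge_pos_mid[OF \<delta> z(1)] hA_seg[OF z(3)])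
  qed
qed

end

section \<open>The probability of a finished path\<close>

text \<open>Fixed-point induction: the history is only extended. This anchors the induction in
  \<open>spmf_explore_path_list\<close>, where no termination is available.\<close>

lemma explore_length: "p \<in> set_spmf (explore \<delta> A t h) \<Longrightarrow> length h \<le> length p"
proof -
  have "\<forall>\<delta> A t h. \<forall>p\<in>set_spmf (explore \<delta> A t h). length h \<le> length p"
  proof (induction rule: explore.fixp_induct)
    case 1
    show ?case unfolding curry_def by (intro cont_intro)
  next
    case 2
    show ?case by simp
  next
    case (3 f)
    show ?case
    proof (intro allI ballI)
      fix \<delta> A t h p
      let ?v = "other_end \<delta> (last h) (last (butlast h))"
      assume p: "p \<in> set_spmf (if last h = t then return_spmf h else let v = ?v in
        spmf_of_set (allowable \<delta> A t h v) \<bind> (\<lambda>m. f \<delta> A t (h @ [v, m])))"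
      show "length h \<le> length p"
      proof (cases "last h = t")
        case False
        then obtain m where "p \<in> set_spmf (f \<delta> A t (h @ [?v, m]))" using p by (auto simp: Let_def set_bind_spmf)
        then have "length (h @ [?v, m]) \<le> length p" using 3 by blast
        then show ?thesis by simp
      qed (use p in simp)
    qed
  qed
  then show "p \<in> set_spmf (explore \<delta> A t h) \<Longrightarrow> length h \<le> length p" by blast
qed

text \<open>Depends only on the set of points of the list, hence agrees on \<open>p\<close> and
  \<open>rev p\<close>.\<close>

definition face_count :: "real \<Rightarrow> (int \<times> int) set \<Rightarrow> complex list \<Rightarrow> nat" where
  "face_count \<delta> C p = card (faces C {v. pos \<delta> v \<in> set p})"

lemma faces_mono: "X \<subseteq> Y \<Longrightarrow> faces C X \<subseteq> faces C Y"
  by (auto simp: faces_def)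

lemma finite_faces: "finite X \<Longrightarrow> finite (faces C X)"
  by (simp add: faces_def)

lemma path_list_prefix:
  "prefix (xs @ [y]) (xs' @ [y']) \<Longrightarrow> prefix (path_list \<delta> w0 xs y) (path_list \<delta> w0 xs' y')"
proof (induction xs' arbitrary: y' rule: rev_induct)
  case Nil
  then show ?case by (cases xs) auto
next
  case (snoc u us)
  from snoc.prems consider "xs @ [y] = (us @ [u]) @ [y']" | "prefix (xs @ [y]) (us @ [u])"
    unfolding prefix_snoc by blast
  then show ?case
  proof cases
    case 2
    then show ?thesis using snoc.IH[OF 2] by (simp add: path_list_snoc)
  qed simp
qed

lemma spmf_explore:
  "spmf (explore \<delta> A t h) p = (if last h = t then of_bool (h = p) else
     (\<Sum>m\<in>allowable \<delta> A t h (other_end \<delta> (last h) (last (butlast h))).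
        spmf (explore \<delta> A t (h @ [other_end \<delta> (last h) (last (butlast h)), m])) p) /
     real (card (allowable \<delta> A t h (other_end \<delta> (last h) (last (butlast h))))))"
  by (subst explore.simps) (simp add: Let_def spmf_bind integral_spmf_of_set indicator_def)

context lattice_exploration
begin

definition ends_at :: "complex list \<Rightarrow> vtx \<Rightarrow> vtx \<Rightarrow> vtx list \<Rightarrow> vtx \<Rightarrow> bool" where
  "ends_at p w0 v1 xs y \<longleftrightarrow> (\<exists>xs' y'. p = path_list \<delta> w0 xs' y' \<and> epath w0 v1 xs' y' \<and>
     mid \<delta> (last xs') y' = t \<and> prefix (xs @ [y]) (xs' @ [y']))"

lemma face_count_path_list: "epath w0 v1 xs y \<Longrightarrow> face_count \<delta> C (path_list \<delta> w0 xs y) = card (faces C (set xs))"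
  using pos_in_path_list by (simp add: face_count_def)

text \<open>The rest of a finished path is itself a connection to an entrance of the target that
  avoids the past, unless the very next mid-edge is the target. This is why dead ends never have to
  be ruled out.\<close>

lemma epath_continue:
  assumes e: "epath w0 v1 xs' y'" "mid \<delta> (last xs') y' = t"
    and pre: "prefix (xs @ [y, z]) (xs' @ [y'])" "xs \<noteq> []"
  shows "z \<in> allow xs y" "insert y (set xs) \<subseteq> set xs'"
proof -
  have pre': "prefix ((xs @ [y]) @ [z]) (xs' @ [y'])" using pre by simp
  from epath_prefix[OF e(1) pre'] have ez: "epath w0 v1 (xs @ [y]) z"
    and cases: "xs @ [y] = xs' \<and> z = y' \<or> prefix ((xs @ [y]) @ [z]) xs'" by auto
  have hA: "hA y z" using epath_last[OF ez] by simp
  have nb: "z \<noteq> last xs" using ez pre(2) by (cases rule: epath.cases) auto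
  have "insert y (set xs) \<subseteq> set xs' \<and> (mid \<delta> y z = t \<or> z \<in> reach C T (insert y (set xs)))"
    using cases
  proof
    assume "xs @ [y] = xs' \<and> z = y'"
    then show ?thesis using e(2) by auto
  next
    assume "prefix ((xs @ [y]) @ [z]) xs'"
    then obtain us where us: "xs' = (xs @ [y]) @ z # us" by (auto simp: prefix_def)
    have p: "distinct xs'" "successively hA (xs' @ [y'])" using epath_props[OF e(1)] by auto
    have "last xs' \<in> T" using T_iff epath_last[OF e(1)] e(2) by blast
    moreover have "successively hA (z # us)"
      using p(2) unfolding us by (simp only: successively_append_iff)
    ultimately have "z \<in> reach C T (insert y (set xs))"
      by (intro reach_along[of z us]) (use p(1) us in auto)
    then show ?thesis using us by auto
  qed
  then show "z \<in> allow xs y" "insert y (set xs) \<subseteq> set xs'"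
    using hA nb hA_nbrs[OF hA] by (auto simp: allow_def)
qed

text \<open>Each step contributes the inverse of \<open>card_allow\<close>, one factor 1/2 per newly
  touched face, and the product telescopes. The final \<open>y\<close> may be a visited vertex if
  the target is reached, so freshness is assumed only otherwise.\<close>

theorem spmf_explore_path_list:
  assumes "epath w0 v1 xs y" "mid \<delta> (last xs) y \<noteq> t \<Longrightarrow> y \<notin> set xs"
  shows "spmf (explore \<delta> A t (path_list \<delta> w0 xs y)) p =
    (if ends_at p w0 v1 xs y then (1 / 2) ^ (face_count \<delta> C p - card (faces C (set xs))) else 0)"
proof -
  \<comment> \<open>\<open>n\<close> bounds the number of steps still missing, two list entries
    each. For \<open>n = 0\<close> the list \<open>p\<close> is shorter than the history and both
    sides are 0.\<close>
  have "length p < length (path_list \<delta> w0 xs y) + 2 * n \<Longrightarrow> epath w0 v1 xs y \<Longrightarrow>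
      (mid \<delta> (last xs) y \<noteq> t \<Longrightarrow> y \<notin> set xs) \<Longrightarrow> ?thesis" for n
  proof (induction n arbitrary: xs y)
    case 0
    then have "p \<notin> set_spmf (explore \<delta> A t (path_list \<delta> w0 xs y))" using explore_length by fastforce
    moreover have "\<not> ends_at p w0 v1 xs y"
    proof
      assume "ends_at p w0 v1 xs y"
      then obtain xs' y' where "p = path_list \<delta> w0 xs' y'" "prefix (xs @ [y]) (xs' @ [y'])"
        by (auto simp: ends_at_def)
      then have "length (path_list \<delta> w0 xs y) \<le> length p" using path_list_prefix prefix_length_le by blast
      then show False using 0 by simp
    qed
    ultimately show ?case by (simp add: spmf_eq_0_set_spmf)
  next
    case (Suc n)
    note e = Suc.prems(2)
    have ne: "xs \<noteq> []" using epath_props[OF e] by blast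
    show ?case
    proof (cases "mid \<delta> (last xs) y = t")
      case True
      have "ends_at p w0 v1 xs y \<longleftrightarrow> path_list \<delta> w0 xs y = p"
      proof
        assume "ends_at p w0 v1 xs y"
        then obtain xs' y' where p: "p = path_list \<delta> w0 xs' y'" "epath w0 v1 xs' y'" "prefix (xs @ [y]) (xs' @ [y'])"
          by (auto simp: ends_at_def)
        from epath_prefix[OF p(2,3) ne] True have "xs = xs'" "y = y'" by auto
        then show "path_list \<delta> w0 xs y = p" using p(1) by simp
      next
        assume "path_list \<delta> w0 xs y = p"
        then show "ends_at p w0 v1 xs y" using True e unfolding ends_at_def by blast
      qed
      then show ?thesis
        using True face_count_path_list[OF e] by (subst spmf_explore) (auto simp: last_path_list[OF ne])
    next
      case False
      have yx: "y \<notin> set xs" using Suc.prems(3) False .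
      have yl: "y \<in> nbrs (last xs)" using hA_nbrs[OF epath_last[OF e]] .
      let ?al = "allow xs y"
      have oe: "other_end \<delta> (last (path_list \<delta> w0 xs y)) (last (butlast (path_list \<delta> w0 xs y))) = pos \<delta> y"
        unfolding last_path_list[OF ne] last_butlast_path_list[OF ne] by (rule other_end_mid[OF \<delta> yl])
      have alnb: "?al \<subseteq> nbrs y" by (auto simp: allow_def)
      have inj: "inj_on (mid \<delta> y) ?al"
      proof (rule inj_onI)
        fix z w assume "z \<in> ?al" "w \<in> ?al" "mid \<delta> y z = mid \<delta> y w"
        then show "z = w" using mid_inj2[OF \<delta>, of z y w] subsetD[OF alnb] by simp
      qed
      let ?c = "card (faces C (set xs))" and ?c' = "card (faces C (insert y (set xs)))"
      have "spmf (explore \<delta> A t (path_list \<delta> w0 xs y)) p =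
          (\<Sum>z\<in>?al. spmf (explore \<delta> A t (path_list \<delta> w0 (xs @ [y]) z)) p) / real (card ?al)"
        using False unfolding spmf_explore[of \<delta> A t "path_list \<delta> w0 xs y"] oe allowable_path_list[OF e False yx]
        by (simp add: last_path_list[OF ne] sum.reindex[OF inj] card_image[OF inj] path_list_snoc)
      also have "(\<Sum>z\<in>?al. spmf (explore \<delta> A t (path_list \<delta> w0 (xs @ [y]) z)) p) =
          (\<Sum>z\<in>?al. if ends_at p w0 v1 (xs @ [y]) z then (1 / 2) ^ (face_count \<delta> C p - ?c') else 0)"
      proof (rule sum.cong[OF refl])
        fix z assume z: "z \<in> ?al"
        have "epath w0 v1 (xs @ [y]) z"
          by (rule epath.step[OF e False yx]) (use z in \<open>auto simp: allow_def\<close>)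
        moreover have "mid \<delta> (last (xs @ [y])) z \<noteq> t \<Longrightarrow> z \<notin> set (xs @ [y])"
          using z by (auto simp: allow_def reach_def)
        moreover have "length p < length (path_list \<delta> w0 (xs @ [y]) z) + 2 * n"
          using Suc.prems(1) by (simp add: path_list_snoc)
        ultimately show "spmf (explore \<delta> A t (path_list \<delta> w0 (xs @ [y]) z)) p =
            (if ends_at p w0 v1 (xs @ [y]) z then (1 / 2) ^ (face_count \<delta> C p - ?c') else 0)"
          using Suc.IH[of "xs @ [y]" z] by simp
      qed
      finally have sum: "spmf (explore \<delta> A t (path_list \<delta> w0 xs y)) p =
          (\<Sum>z\<in>?al. if ends_at p w0 v1 (xs @ [y]) z then (1 / 2) ^ (face_count \<delta> C p - ?c') else 0) /
          real (card ?al)" .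
      show ?thesis
      proof (cases "ends_at p w0 v1 xs y")
        case True
        then obtain xs' y' where p: "p = path_list \<delta> w0 xs' y'" "epath w0 v1 xs' y'" "mid \<delta> (last xs') y' = t"
          "prefix (xs @ [y]) (xs' @ [y'])" by (auto simp: ends_at_def)
        have "prefix (xs @ [y]) xs'" using epath_prefix[OF p(2,4) ne] p(3) False by blast
        then obtain us where us: "xs' = (xs @ [y]) @ us" by (auto simp: prefix_def)
        obtain z us' where "us @ [y'] = z # us'" by (cases us) auto
        then have pre: "prefix (xs @ [y, z]) (xs' @ [y'])" by (auto simp: us)
        have z: "z \<in> ?al" "insert y (set xs) \<subseteq> set xs'"
          using epath_continue[OF p(2,3) pre ne] by auto
        \<comment> \<open>\<open>p\<close> determines its next mid-edge and thereby the next vertex,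
          so exactly one summand survives.\<close>
        have uniq: "ends_at p w0 v1 (xs @ [y]) w \<longleftrightarrow> w = z" if "w \<in> ?al" for w
        proof
          assume "ends_at p w0 v1 (xs @ [y]) w"
          then obtain xs'' y'' where q: "p = path_list \<delta> w0 xs'' y''" "prefix ((xs @ [y]) @ [w]) (xs'' @ [y''])"
            by (auto simp: ends_at_def)
          have a: "prefix (path_list \<delta> w0 (xs @ [y]) w) p" using path_list_prefix[OF q(2)] q(1) by simp
          have b: "prefix (path_list \<delta> w0 (xs @ [y]) z) p" using path_list_prefix[of "xs @ [y]" z xs' y'] pre p(1) by simp
          have "length (path_list \<delta> w0 (xs @ [y]) w) = length (path_list \<delta> w0 (xs @ [y]) z)"
            by (simp add: length_path_list)
          then have "path_list \<delta> w0 (xs @ [y]) w = path_list \<delta> w0 (xs @ [y]) z"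
            using prefix_order.antisym[OF prefix_length_prefix[OF a b] prefix_length_prefix[OF b a]]
            by simp
          then have "mid \<delta> y w = mid \<delta> y z" by (simp add: path_list_snoc)
          then show "w = z"
            using mid_inj2[OF \<delta> subsetD[OF alnb that] subsetD[OF alnb z(1)]] by simp
        next
          assume "w = z"
          then show "ends_at p w0 v1 (xs @ [y]) w"
            using p(1-3) pre unfolding ends_at_def by (intro exI[of _ xs'] exI[of _ y']) simp
        qed
        have fin: "finite ?al" by (rule finite_subset[OF alnb]) simp
        have "(\<Sum>w\<in>?al. if ends_at p w0 v1 (xs @ [y]) w then (1 / 2) ^ (face_count \<delta> C p - ?c') else 0) =
            (\<Sum>w\<in>?al. if w = z then (1 / 2) ^ (face_count \<delta> C p - ?c') else (0::real))"
          by (rule sum.cong) (use uniq in auto)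
        also have "\<dots> = (1 / 2) ^ (face_count \<delta> C p - ?c')" using z(1) fin by simp
        finally have "spmf (explore \<delta> A t (path_list \<delta> w0 xs y)) p =
            (1 / 2) ^ (face_count \<delta> C p - ?c') / real (card ?al)" using sum by simp
        also have "real (card ?al) = 2 ^ (?c' - ?c)"
        proof -
          have w: "successively (\<lambda>u w. w \<in> nbrs u) xs"
            using epath_walk[OF e] by (simp add: successively_append_iff)
          have "card ?al = 2 ^ (?c' - ?c)"
            by (rule card_allow[OF nbrs_sym[OF yl] ne yx w]) (use z(1) in auto)
          then show ?thesis by simp
        qed
        also have "(1 / 2) ^ (face_count \<delta> C p - ?c') / 2 ^ (?c' - ?c) =
            (1 / 2 :: real) ^ (face_count \<delta> C p - ?c' + (?c' - ?c))"
          by (simp add: power_add power_divide)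
        \<comment> \<open>The subtractions are truncated, but the faces only increase from
          \<open>xs\<close> over \<open>y\<close> to all of \<open>p\<close>.\<close>
        also have "face_count \<delta> C p - ?c' + (?c' - ?c) = face_count \<delta> C p - ?c"
        proof -
          have "?c \<le> ?c'" by (intro card_mono faces_mono finite_faces) auto
          moreover have "?c' \<le> face_count \<delta> C p"
            unfolding p(1) face_count_path_list[OF p(2)] using z(2) by (intro card_mono faces_mono finite_faces) auto
          ultimately show ?thesis by simp
        qed
        finally show ?thesis using True by simp
      next
        case not_end: False
        have "\<not> ends_at p w0 v1 (xs @ [y]) z" for z
        proof
          assume "ends_at p w0 v1 (xs @ [y]) z"
          then have "ends_at p w0 v1 xs y" unfolding ends_at_def by (metis append_prefixD)
          then show False using not_end by blast
        qed
        then show ?thesis using sum not_end by simp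
      qed
    qed
  qed
  from this[of "Suc (length p)"] assms show ?thesis by simp
qed

end

section \<open>Self-avoiding paths and their reversal\<close>

text \<open>Turning back is not excluded by distinct visited vertices alone, because the outer
  vertices \<open>w0\<close> and \<open>y\<close> may occur among them. This form is symmetric under
  reversal.\<close>

definition straight :: "'a list \<Rightarrow> bool" where
  "straight us \<longleftrightarrow> (\<nexists>l u v r. us = l @ [u, v, u] @ r)"

lemma straight_rev: "straight (rev us) \<longleftrightarrow> straight us"
proof -
  have *: "straight us" if "straight (rev us)" for us :: "'a list"
    unfolding straight_def
  proof
    assume "\<exists>l u v r. us = l @ [u, v, u] @ r"
    then obtain l u v r where "us = l @ [u, v, u] @ r" by blast
    then have "rev us = rev r @ [u, v, u] @ rev l" by simp
    then show False using that unfolding straight_def by blast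
  qed
  show ?thesis using *[of us] *[of "rev us"] by auto
qed

lemma straight_snoc:
  assumes "straight (us @ [u, v])" "w \<noteq> u"
  shows "straight (us @ [u, v, w])"
  unfolding straight_def
proof
  assume "\<exists>l x y r. us @ [u, v, w] = l @ [x, y, x] @ r"
  then obtain l x y r where e: "us @ [u, v, w] = l @ [x, y, x] @ r" by blast
  show False
  proof (cases r rule: rev_cases)
    case Nil
    then show False using e assms(2) by simp
  next
    case (snoc r' z)
    then have "(us @ [u, v]) @ [w] = (l @ [x, y, x] @ r') @ [z]" using e by simp
    then have "us @ [u, v] = l @ [x, y, x] @ r'" by blast
    then show False using assms(1) unfolding straight_def by blast
  qed
qed

lemma straight_snocD:
  assumes "straight (us @ [u, v, w])"
  shows "straight (us @ [u, v])" "w \<noteq> u"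
proof -
  show "straight (us @ [u, v])"
    unfolding straight_def
  proof
    assume "\<exists>l x y r. us @ [u, v] = l @ [x, y, x] @ r"
    then obtain l x y r where "us @ [u, v] = l @ [x, y, x] @ r" by blast
    then have "us @ [u, v, w] = l @ [x, y, x] @ (r @ [w])"
      by (metis append.assoc append_Cons append_Nil)
    then show False using assms unfolding straight_def by blast
  qed
  show "w \<noteq> u"
  proof
    assume "w = u"
    then have "us @ [u, v, w] = us @ [u, v, u] @ []" by simp
    then show False using assms unfolding straight_def by blast
  qed
qed

lemma not_successivelyE:
  assumes "\<not> successively P xs"
  obtains l u v r where "xs = l @ [u, v] @ r" "\<not> P u v"
proof -
  obtain i where i: "Suc i < length xs" "\<not> P (xs ! i) (xs ! Suc i)"
    using assms unfolding successively_conv_nth by blast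
  have "xs = take i xs @ [xs ! i, xs ! Suc i] @ drop (Suc (Suc i)) xs"
    using i(1) by (simp add: Cons_nth_drop_Suc Suc_lessD)
  then show thesis using that i(2) by blast
qed

text \<open>Meant for reversed paths: the only usable step that is not in the region starts at
  \<open>S\<close>, and \<open>S\<close> is the last vertex.\<close>

lemma successively_butlast_cong:
  assumes "successively P xs" "distinct xs" "\<And>u v. P u v \<Longrightarrow> u \<noteq> last xs \<Longrightarrow> Q u v"
  shows "successively Q xs"
proof (rule ccontr)
  assume "\<not> successively Q xs"
  then obtain l u v r where xs: "xs = l @ [u, v] @ r" "\<not> Q u v" by (rule not_successivelyE)
  have "P u v" using assms(1) unfolding xs by (simp add: successively_append_iff)
  moreover have "u \<noteq> last xs" using assms(2) unfolding xs by (cases r rule: rev_cases) auto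
  ultimately show False using assms(3) xs(2) by blast
qed

lemma sum_if_unique:
  fixes K :: real
  assumes "finite I" "\<And>i j. i \<in> I \<Longrightarrow> j \<in> I \<Longrightarrow> Q i \<Longrightarrow> Q j \<Longrightarrow> i = j"
  shows "(\<Sum>i\<in>I. if Q i then K else 0) = (if \<exists>i\<in>I. Q i then K else 0)"
proof (cases "\<exists>i\<in>I. Q i")
  case True
  then obtain i where i: "i \<in> I" "Q i" by blast
  have "(\<Sum>j\<in>I. if Q j then K else 0) = (\<Sum>j\<in>I. if j = i then K else 0)"
    by (rule sum.cong) (use assms(2) i in auto)
  then show ?thesis using i assms(1) True by simp
qed simp

context lattice_exploration
begin

lemma epath_straight: "epath w0 v1 xs y \<Longrightarrow> straight (w0 # xs @ [y])"
proof (induction rule: epath.induct)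
  case (start z)
  then show ?case using straight_snoc[of "[]" w0 v1 z] by (simp add: straight_def)
next
  case (step xs y z)
  obtain ys x where xs: "xs = ys @ [x]" using epath_props[OF step.hyps(1)] by (cases xs rule: rev_cases) auto
  then show ?case using straight_snoc[of "w0 # ys" x y z] step by simp
qed

text \<open>Conditions on the whole list in place of the inductive rules, so that they can be
  checked for a reversed path.\<close>

lemma straight_epath:
  assumes "straight (w0 # xs @ [y])" "xs \<noteq> []" "hd xs = v1" "distinct xs" "successively hA (xs @ [y])"
    "v1 \<in> nbrs w0" "mid \<delta> w0 v1 \<noteq> t" "successively (\<lambda>u v. mid \<delta> u v \<noteq> t) xs"
  shows "epath w0 v1 xs y"
  using assms
proof (induction xs arbitrary: y rule: rev_induct)
  case (snoc x xs)
  have hA: "hA x y" using snoc.prems(5) by (simp add: successively_append_iff)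
  show ?case
  proof (cases xs rule: rev_cases)
    case Nil
    then have "y \<noteq> w0" using straight_snocD(2)[of "[]" w0 x y] snoc.prems(1) by simp
    then show ?thesis using epath.start hA snoc.prems Nil by simp
  next
    case (snoc ys u)
    have st: "straight (w0 # xs @ [x])" "y \<noteq> last xs"
      using straight_snocD[of "w0 # ys" u x y] snoc.prems(1) snoc by simp_all
    have "epath w0 v1 xs x"
      by (rule snoc.IH) (use st snoc.prems snoc in \<open>auto simp: successively_append_iff hd_append\<close>)
    moreover have "mid \<delta> (last xs) x \<noteq> t" "x \<notin> set xs"
      using snoc.prems snoc by (auto simp: successively_append_iff)
    ultimately show ?thesis using epath.step hA st(2) by blast
  qed
qed simp

text \<open>Meeting the target before the end means running along the last edge earlier. In the same
  direction this repeats \<open>last xs\<close>; in the opposite direction the path turns back at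
  its end.\<close>

lemma completed_epath:
  assumes st: "straight (w0 # xs @ [y])" and ne: "xs \<noteq> []" "hd xs = v1" and d: "distinct xs"
    and hA: "successively hA (xs @ [y])" and v1: "v1 \<in> nbrs w0" "mid \<delta> w0 v1 \<noteq> t"
    and t: "mid \<delta> (last xs) y = t"
  shows "epath w0 v1 xs y"
proof (rule straight_epath[OF st ne d hA v1])
  show "successively (\<lambda>u v. mid \<delta> u v \<noteq> t) xs"
  proof (rule ccontr)
    assume "\<not> ?thesis"
    then obtain l u v r where xs: "xs = l @ [u, v] @ r" "\<not> mid \<delta> u v \<noteq> t" by (rule not_successivelyE)
    have uv: "hA u v" using hA unfolding xs(1) by (simp add: successively_append_iff)
    have ly: "hA (last xs) y" using hA ne by (simp add: successively_append_iff)
    from mid_inj[OF \<delta> hA_nbrs[OF uv] hA_nbrs[OF ly]] xs(2) t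
    have "u = last xs \<and> v = y \<or> u = y \<and> v = last xs" by simp
    then show False
    proof
      assume "u = last xs \<and> v = y"
      then show False using d unfolding xs(1) by (cases r rule: rev_cases) auto
    next
      assume *: "u = y \<and> v = last xs"
      then have "r = []" using d unfolding xs(1) by (cases r rule: rev_cases) auto
      then have "w0 # xs @ [y] = (w0 # l) @ [y, v, y] @ []" using xs(1) * by simp
      then show False using st unfolding straight_def by blast
    qed
  qed
qed

definition completed :: "complex list \<Rightarrow> vtx \<Rightarrow> vtx \<Rightarrow> bool" where
  "completed p w0 v1 \<longleftrightarrow> (\<exists>xs y. p = path_list \<delta> w0 xs y \<and> epath w0 v1 xs y \<and> mid \<delta> (last xs) y = t)"

lemma completed_iff:
  "completed p w0 v1 \<longleftrightarrow> (\<exists>z. z \<in> nbrs v1 \<and> z \<noteq> w0 \<and> ends_at p w0 v1 [v1] z)"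
proof
  assume "completed p w0 v1"
  then obtain xs y where p: "p = path_list \<delta> w0 xs y" "epath w0 v1 xs y" "mid \<delta> (last xs) y = t"
    by (auto simp: completed_def)
  obtain us where us: "xs = v1 # us" using epath_props[OF p(2)] by (cases xs) auto
  obtain z r where "us @ [y] = z # r" by (cases us) auto
  then have pre: "prefix ([v1] @ [z]) (xs @ [y])" by (simp add: us)
  have ez: "epath w0 v1 [v1] z" using epath_prefix[OF p(2) pre] by simp
  have "hA v1 z" using epath_last[OF ez] by simp
  moreover have "z \<noteq> w0"
    using straight_snocD(2)[of "[]" w0 v1 z] epath_straight[OF ez] by simp
  ultimately show "\<exists>z. z \<in> nbrs v1 \<and> z \<noteq> w0 \<and> ends_at p w0 v1 [v1] z"
    using p pre hA_nbrs unfolding ends_at_def by blast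
qed (auto simp: completed_def ends_at_def)

text \<open>The third entry fixes the first step, so the events summed over first steps exclude each
  other.\<close>

lemma ends_at_take:
  assumes "ends_at p w0 v1 [v1] z"
  shows "take 3 p = [mid \<delta> w0 v1, pos \<delta> v1, mid \<delta> v1 z]"
proof -
  obtain xs y where p: "p = path_list \<delta> w0 xs y" "prefix ([v1] @ [z]) (xs @ [y])"
    using assms by (auto simp: ends_at_def)
  have "path_list \<delta> w0 [v1] z = [mid \<delta> w0 v1, pos \<delta> v1, mid \<delta> v1 z]"
    using path_list_snoc[of \<delta> w0 "[]" v1 z] by (simp add: path_list_Nil)
  then have "prefix [mid \<delta> w0 v1, pos \<delta> v1, mid \<delta> v1 z] p" using path_list_prefix[OF p(2)] p(1) by metis
  then show ?thesis by (auto simp: prefix_def)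
qed

text \<open>Guarantees that the truncated subtraction of the two or three initially touched faces
  loses nothing.\<close>

lemma completed_face_count:
  assumes "completed p w0 v1"
  shows "card (faces C {v1}) \<le> face_count \<delta> C p"
proof -
  obtain xs y where p: "p = path_list \<delta> w0 xs y" "epath w0 v1 xs y"
    using assms by (auto simp: completed_def)
  have "{v1} \<subseteq> set xs" using epath_props[OF p(2)] by auto
  then show ?thesis unfolding p(1) face_count_path_list[OF p(2)] by (intro card_mono faces_mono finite_faces) simp
qed

end

section \<open>The explorations from both sides\<close>

text \<open>The start near \<open>a\<close> is the centre of the edge from \<open>S\<close> to
  \<open>S'\<close>, with the half-edge at \<open>S\<close> playing the role of \<open>e_a\<close>;
  the mid-edge near \<open>b\<close> is the centre of the edge between \<open>B\<close> and
  \<open>B'\<close>. The conditions on \<open>S\<close> leave exactly one hexagon of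
  \<open>C\<close> at \<open>S\<close>.\<close>

locale radial_setup =
  fixes \<delta> :: real and C :: "(int \<times> int) set" and D :: "complex set" and S S' B B' :: vtx
  assumes \<delta>: "\<delta> > 0" and D: "D = (\<Union>h\<in>C. hexset \<delta> h)"
    and S: "S' \<in> nbrs S" "\<not> edge_in C S S'" "hexs S \<inter> C \<noteq> {}"
    and B: "B' \<in> nbrs B" "hexs B \<subseteq> C" "hexs B' \<subseteq> C"
    and unbounded_outside:
      "\<And>h. h \<notin> C \<Longrightarrow> infinite {h'. (h, h') \<in> {(a, b). a \<notin> C \<and> b \<notin> C \<and> hadj a b}\<^sup>*}"
begin

lemma mid_in_D: "w \<in> nbrs v \<Longrightarrow> mid \<delta> v w \<in> D \<longleftrightarrow> edge_in C v w"
  using mid_mem_hexset[OF \<delta>, of w v] by (auto simp: D edge_in_def)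

lemma edge_point_in_D:
  assumes "w \<in> nbrs v" "0 < r" "r < 1"
  shows "(1 - r) *\<^sub>R pos \<delta> v + r *\<^sub>R pos \<delta> w \<in> D \<longleftrightarrow> edge_in C v w"
  using edge_point_hexset[OF \<delta> assms] assms(1) by (auto simp: D edge_in_def)

lemma half_edge_in_D:
  assumes "w \<in> nbrs v"
  shows "closed_segment (pos \<delta> v) (mid \<delta> v w) \<subseteq> D \<longleftrightarrow> edge_in C v w"
proof
  assume "closed_segment (pos \<delta> v) (mid \<delta> v w) \<subseteq> D"
  then have "mid \<delta> v w \<in> D" by auto
  then show "edge_in C v w" using mid_in_D[OF assms] by simp
next
  assume "edge_in C v w"
  then obtain h where h: "h \<in> C" "h \<in> hexs v" "h \<in> hexs w" by (auto simp: edge_in_def)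
  have "closed_segment (pos \<delta> v) (mid \<delta> v w) \<subseteq> hexset \<delta> h"
    by (rule closed_segment_subset)
      (use h pos_mem_hexset[OF \<delta>] mid_mem_hexset[OF \<delta> assms] convex_hexset in auto)
  then show "closed_segment (pos \<delta> v) (mid \<delta> v w) \<subseteq> D" using h(1) by (auto simp: D)
qed

text \<open>Deliberately not symmetric: the extra half-edge can be used from \<open>S\<close>, while
  the other half of its edge cannot be used from \<open>S'\<close>.\<close>

definition hR :: "vtx \<Rightarrow> vtx \<Rightarrow> bool" where
  "hR y z \<longleftrightarrow> edge_in C y z \<or> y = S \<and> z = S'"

lemma edge_in_B: "edge_in C B B'" "edge_in C B' B"
proof -
  obtain g where "g \<in> hexs B" "g \<in> hexs B'" using common_hex[OF B(1)] by blast
  then show "edge_in C B B'" using B by (auto simp: edge_in_def)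
  then show "edge_in C B' B" by (rule edge_in_sym)
qed

lemma SS': "S \<noteq> S'" "S \<in> nbrs S'" "\<not> edge_in C S' S"
  using S(1,2) nbrs_sym edge_in_sym by auto

lemma BB': "B \<noteq> B'" "B \<in> nbrs B'"
  using B(1) nbrs_sym by auto

lemma mid_eq_b: "w \<in> nbrs v \<Longrightarrow> mid \<delta> v w = mid \<delta> B B' \<longleftrightarrow> v = B \<and> w = B' \<or> v = B' \<and> w = B"
  using mid_inj[OF \<delta> _ B(1), of w v] mid_sym[of \<delta> B B'] by auto

lemma mid_eq_a: "w \<in> nbrs v \<Longrightarrow> mid \<delta> v w = mid \<delta> S S' \<longleftrightarrow> v = S \<and> w = S' \<or> v = S' \<and> w = S"
  using mid_inj[OF \<delta> _ S(1), of w v] mid_sym[of \<delta> S S'] by auto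

lemma edge_in_nbrs: "edge_in C v w \<Longrightarrow> w \<in> nbrs v"
  by (simp add: edge_in_def)

lemma hR_nbrs: "hR v w \<Longrightarrow> w \<in> nbrs v"
  using edge_in_nbrs S(1) by (auto simp: hR_def)

lemma half_edge_in_D_ea:
  assumes z: "z \<in> nbrs y"
  shows "closed_segment (pos \<delta> y) (mid \<delta> y z) \<subseteq> D \<union> closed_segment (mid \<delta> S S') (pos \<delta> S) \<longleftrightarrow> hR y z"
    (is "?seg \<subseteq> D \<union> ?ea \<longleftrightarrow> _")
proof
  assume sub: "?seg \<subseteq> D \<union> ?ea"
  show "hR y z"
  proof (cases "edge_in C y z")
    case False
    have "mid \<delta> y z \<in> ?seg" by simp
    then have "mid \<delta> y z \<in> closed_segment (pos \<delta> S) (mid \<delta> S S')"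
      using sub mid_in_D[OF z] False by (auto simp: closed_segment_commute)
    then have "mid \<delta> y z = mid \<delta> S S'" by (rule mid_on_half_edge[OF \<delta> S(1) z])
    then consider "y = S" "z = S'" | "y = S'" "z = S" using mid_eq_a[OF z] by blast
    then show ?thesis
    proof cases
      case 2
      \<comment> \<open>A point of the half next to \<open>S'\<close> that lies neither in
        \<open>D\<close> nor on the attached half-edge: it is interior to an edge outside the region
        and has distance 3/4 of the mesh from \<open>S\<close>. The end \<open>S'\<close> would not
        do, as it may belong to \<open>D\<close>.\<close>
      define q where "q = (1 - 1 / 4) *\<^sub>R pos \<delta> S' + (1 / 4) *\<^sub>R pos \<delta> S"
      have "q = (1 - 1 / 2) *\<^sub>R pos \<delta> S' + (1 / 2) *\<^sub>R mid \<delta> S' S"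
        by (simp add: q_def mid_def midpoint_def complex_eq_iff field_simps)
      then have "q \<in> ?seg" unfolding 2 closed_segment_def
        by (intro CollectI exI[of _ "1 / 2"]) auto
      moreover have "q \<notin> D"
        unfolding q_def using edge_point_in_D[OF SS'(2), of "1 / 4"] SS'(3) by simp
      ultimately have "q \<in> closed_segment (pos \<delta> S) (mid \<delta> S S')"
        using sub by (auto simp: closed_segment_commute)
      then have "dist (pos \<delta> S) q \<le> \<delta> / 2" by (rule dist_half_edge[OF \<delta> S(1)])
      moreover have "pos \<delta> S - q = (3 / 4) *\<^sub>R (pos \<delta> S - pos \<delta> S')"
        by (simp add: q_def complex_eq_iff field_simps)
      then have "dist (pos \<delta> S) q = 3 / 4 * \<delta>"
        using dist_pos_eq[OF \<delta>, of S S'] S(1) by (simp add: dist_norm)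
      ultimately show ?thesis using \<delta> by simp
    qed (simp add: hR_def)
  qed (simp add: hR_def)
next
  assume "hR y z"
  then show "?seg \<subseteq> D \<union> ?ea"
    using half_edge_in_D[OF z] unfolding hR_def by (auto simp: closed_segment_commute)
qed

text \<open>Exploration towards the mid-edge near \<open>b\<close>, which can be entered from both
  ends of its edge.\<close>

sublocale F: lattice_exploration C "{B, B'}" "edge_in C" \<delta> "mid \<delta> B B'" D
proof
  show "\<And>u w. u \<in> {B, B'} \<Longrightarrow> w \<in> {B, B'} \<Longrightarrow> u \<noteq> w \<Longrightarrow> edge_in C u w" using edge_in_B by blast
  show "\<And>y z. mid \<delta> y z = mid \<delta> B B' \<Longrightarrow> edge_in C y z \<Longrightarrow> z \<in> {B, B'}" using mid_eq_b edge_in_nbrs by blast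
  show "\<And>y z. mid \<delta> y z = mid \<delta> B B' \<Longrightarrow> edge_in C y z \<Longrightarrow> {B, B'} \<subseteq> {y, z}" using mid_eq_b edge_in_nbrs by blast
  show "\<And>y z z'. mid \<delta> y z = mid \<delta> B B' \<Longrightarrow> mid \<delta> y z' = mid \<delta> B B' \<Longrightarrow> z \<in> nbrs y \<Longrightarrow> z' \<in> nbrs y \<Longrightarrow> z = z'"
    using mid_inj2[OF \<delta>] by metis
  show "mid \<delta> B B' \<in> mid_edges \<delta>" using B(1) mid_edges_iff[OF \<delta>] by blast
  show "\<And>u. u \<in> {B, B'} \<longleftrightarrow> (\<exists>w. edge_in C u w \<and> mid \<delta> u w = mid \<delta> B B')"
    using mid_eq_b edge_in_nbrs edge_in_B by blast
qed (use \<delta> edge_in_nbrs unbounded_outside half_edge_in_D in auto)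

text \<open>Exploration towards the mid-edge near \<open>a\<close>; the only entrance is
  \<open>S\<close>, through the attached half-edge.\<close>

sublocale R: lattice_exploration C "{S}" hR \<delta> "mid \<delta> S S'" "D \<union> closed_segment (mid \<delta> S S') (pos \<delta> S)"
proof
  show "\<And>y z. mid \<delta> y z = mid \<delta> S S' \<Longrightarrow> edge_in C y z \<Longrightarrow> z \<in> {S}" using mid_eq_a edge_in_nbrs S SS' by blast
  show "\<And>y z. mid \<delta> y z = mid \<delta> S S' \<Longrightarrow> hR y z \<Longrightarrow> {S} \<subseteq> {y, z}" using mid_eq_a hR_nbrs by blast
  show "\<And>y z z'. mid \<delta> y z = mid \<delta> S S' \<Longrightarrow> mid \<delta> y z' = mid \<delta> S S' \<Longrightarrow> z \<in> nbrs y \<Longrightarrow> z' \<in> nbrs y \<Longrightarrow> z = z'"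
    using mid_inj2[OF \<delta>] by metis
  show "mid \<delta> S S' \<in> mid_edges \<delta>" using S(1) mid_edges_iff[OF \<delta>] by blast
  show "\<And>u. u \<in> {S} \<longleftrightarrow> (\<exists>w. hR u w \<and> mid \<delta> u w = mid \<delta> S S')"
    using mid_eq_a hR_nbrs SS' S(2) unfolding hR_def by blast
  show "\<And>y z. hR y z \<Longrightarrow> hR z y \<Longrightarrow> edge_in C y z" unfolding hR_def using SS' by blast
qed (use \<delta> hR_nbrs hR_def unbounded_outside half_edge_in_D_ea in auto)

abbreviation other :: "vtx \<Rightarrow> vtx" where
  "other v \<equiv> if v = B then B' else B"

text \<open>Reversal exchanges \<open>w0\<close> with \<open>y\<close> and keeps distinctness and
  straightness; \<open>completed_epath\<close> restores that the target is met only at the end.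
  Usability is required of all half-edges but the very first, so the reversed path needs it for one
  new final step: along the attached half-edge, or on the edge between \<open>B\<close> and
  \<open>B'\<close>.\<close>

lemma completed_reverse:
  "F.completed p S' S \<longleftrightarrow> (\<exists>v\<in>{B, B'}. R.completed (rev p) (other v) v)"
proof
  assume "F.completed p S' S"
  then obtain xs y where p: "p = path_list \<delta> S' xs y" and e: "F.epath S' S xs y" and t: "mid \<delta> (last xs) y = mid \<delta> B B'"
    by (auto simp: F.completed_def)
  note pr = F.epath_props[OF e]
  have vy: "last xs \<in> {B, B'}" "y = other (last xs)"
    using t mid_eq_b[OF edge_in_nbrs[OF F.epath_last[OF e]]] BB' by auto
  obtain us where us: "xs = S # us" using pr by (cases xs) auto
  have "R.epath y (last xs) (rev xs) S'"
  proof (rule R.completed_epath)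
    have "y # rev xs @ [S'] = rev (S' # xs @ [y])" by simp
    then show "straight (y # rev xs @ [S'])" using F.epath_straight[OF e] straight_rev by metis
    show "hd (rev xs) = last xs" using pr by (simp add: hd_rev)
    have "successively (edge_in C) xs" using pr by (simp add: successively_append_iff)
    then have "successively (\<lambda>u v. hR v u) xs"
      by (rule successively_mono) (auto simp: hR_def edge_in_sym)
    then have "successively (\<lambda>u v. hR v u) (S' # xs)" by (simp add: us hR_def)
    then show "successively hR (rev xs @ [S'])" using successively_rev[of hR "S' # xs"] by simp
    show "last xs \<in> nbrs y" using edge_in_nbrs[OF edge_in_sym[OF F.epath_last[OF e]]] .
    show "mid \<delta> y (last xs) \<noteq> mid \<delta> S S'"
      using t pr mid_sym[of \<delta> y "last xs"] mid_sym[of \<delta> S S'] by auto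
    show "mid \<delta> (last (rev xs)) S' = mid \<delta> S S'" using us by simp
  qed (use pr in auto)
  moreover have "mid \<delta> (last (rev xs)) S' = mid \<delta> S S'" using us by simp
  ultimately have "R.completed (rev p) (other (last xs)) (last xs)"
    unfolding R.completed_def p rev_path_list vy(2)[symmetric] by blast
  then show "\<exists>v\<in>{B, B'}. R.completed (rev p) (other v) v" using vy(1) by blast
next
  assume "\<exists>v\<in>{B, B'}. R.completed (rev p) (other v) v"
  then obtain v where v: "v \<in> {B, B'}" and "R.completed (rev p) (other v) v" by blast
  then obtain xs y where p: "rev p = path_list \<delta> (other v) xs y"
    and e: "R.epath (other v) v xs y" and t: "mid \<delta> (last xs) y = mid \<delta> S S'"
    unfolding R.completed_def by blast
  note pr = R.epath_props[OF e]
  have ly: "hR (last xs) y" using R.epath_last[OF e] .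
  then have Sy: "last xs = S" "y = S'" using t mid_eq_a[OF hR_nbrs[OF ly]] SS' S(2) by (auto simp: hR_def)
  obtain us where us: "xs = v # us" using pr by (cases xs) auto
  have "F.epath S' S (rev xs) (other v)"
  proof (rule F.completed_epath)
    have "S' # rev xs @ [other v] = rev (other v # xs @ [y])" by (simp add: Sy)
    then show "straight (S' # rev xs @ [other v])" using R.epath_straight[OF e] straight_rev by metis
    show "hd (rev xs) = S" using pr Sy by (simp add: hd_rev)
    have "successively hR xs" using pr by (simp add: successively_append_iff)
    then have "successively (edge_in C) xs"
      by (rule successively_butlast_cong) (use pr Sy in \<open>auto simp: hR_def\<close>)
    then have "successively (\<lambda>u v. edge_in C v u) xs"
      by (rule successively_mono) (auto simp: edge_in_sym)
    then have "successively (\<lambda>u v. edge_in C v u) (other v # xs)" using v edge_in_B by (auto simp: us)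
    then show "successively (edge_in C) (rev xs @ [other v])"
      using successively_rev[of "edge_in C" "other v # xs"] by simp
    show "S \<in> nbrs S'" by (rule SS'(2))
    show "mid \<delta> S' S \<noteq> mid \<delta> B B'"
      using mid_eq_b[OF SS'(2)] edge_in_B S(2) SS'(3) by auto
    show "mid \<delta> (last (rev xs)) (other v) = mid \<delta> B B'" using us v mid_sym by auto
  qed (use pr in auto)
  moreover have "mid \<delta> (last (rev xs)) (other v) = mid \<delta> B B'" using us v mid_sym by auto
  moreover have "p = path_list \<delta> S' (rev xs) (other v)" using p rev_path_list[of \<delta> "other v" xs y] Sy by (metis rev_rev_ident)
  ultimately show "F.completed p S' S" unfolding F.completed_def by blast
qed

lemma spmf_radial_exploration:
  "spmf (radial_exploration \<delta> D (mid \<delta> S S') (pos \<delta> S) (mid \<delta> B B')) p =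
     (if F.completed p S' S then (1 / 2) ^ (face_count \<delta> C p - 1) else 0)"
proof -
  let ?I = "{z \<in> nbrs S. z \<noteq> S'}"
  obtain L R F l r where t: "nbrs S = {S', l, r}" "S' \<noteq> l" "S' \<noteq> r" "l \<noteq> r"
    "hexs S = {L, R, F}" "L \<noteq> R" "L \<noteq> F" "R \<noteq> F"
    "hexs S \<inter> hexs S' = {L, R}" "hexs S \<inter> hexs l = {L, F}" "hexs S \<inter> hexs r = {R, F}"
    by (rule tripod[OF S(1)])
  \<comment> \<open>The edge from \<open>S\<close> to \<open>S'\<close> is not in the region, so
    both hexagons beside it are outside. Hence the start touches exactly two faces, the outer one
    and \<open>F\<close>.\<close>
  have LR: "L \<notin> C" "R \<notin> C" using S(1,2) t(9) by (auto simp: edge_in_def)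
  then have F: "F \<in> C" using S(3) t(5) by auto
  have I: "?I = {l, r}" using t by auto
  have edge_in: "edge_in C S z" if "z \<in> ?I" for z using that t F unfolding I edge_in_def by auto
  have cI: "card ?I = 2" unfolding I using t(4) by simp
  have "faces C {S} = {None, Some F}" using t(5) LR F by (auto simp: faces_def)
  then have cf: "card (faces C {S}) = 2" by simp
  have set: "{m \<in> mid_edges \<delta>. m \<in> D \<and> dist m (mid \<delta> S S') \<le> \<delta> \<and> half_edge \<delta> (pos \<delta> S) m} = mid \<delta> S ` ?I"
  proof (intro equalityI subsetI)
    fix m assume m: "m \<in> {m \<in> mid_edges \<delta>. m \<in> D \<and> dist m (mid \<delta> S S') \<le> \<delta> \<and> half_edge \<delta> (pos \<delta> S) m}"
    then obtain z where "z \<in> nbrs S" "m = mid \<delta> S z" using half_edge_pos_iff[OF \<delta>] by auto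
    then show "m \<in> mid \<delta> S ` ?I" using m mid_in_D S(2) by auto
  next
    fix m assume "m \<in> mid \<delta> S ` ?I"
    then obtain z where z: "z \<in> ?I" "m = mid \<delta> S z" by blast
    then have "z \<in> nbrs S" by simp
    then show "m \<in> {m \<in> mid_edges \<delta>. m \<in> D \<and> dist m (mid \<delta> S S') \<le> \<delta> \<and> half_edge \<delta> (pos \<delta> S) m}"
      using z(2) edge_in[OF z(1)] mid_in_D near_mids[OF \<delta> _ S(1), of z S] half_edge_pos_mid[OF \<delta>] mid_edges_iff[OF \<delta>]
      by auto
  qed
  have inj: "inj_on (mid \<delta> S) ?I"
    using mid_inj2[OF \<delta>, of _ S] by (auto simp: inj_on_def)
  have "spmf (radial_exploration \<delta> D (mid \<delta> S S') (pos \<delta> S) (mid \<delta> B B')) p =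
      (\<Sum>z\<in>?I. spmf (explore \<delta> D (mid \<delta> B B') [mid \<delta> S S', pos \<delta> S, mid \<delta> S z]) p) / 2"
    unfolding radial_exploration_def set spmf_bind integral_spmf_of_set card_image[OF inj] cI
    by (simp add: sum.reindex[OF inj])
  also have "(\<Sum>z\<in>?I. spmf (explore \<delta> D (mid \<delta> B B') [mid \<delta> S S', pos \<delta> S, mid \<delta> S z]) p) =
      (\<Sum>z\<in>?I. if F.ends_at p S' S [S] z then (1 / 2) ^ (face_count \<delta> C p - 2) else 0)"
  proof (rule sum.cong[OF refl])
    fix z assume z: "z \<in> ?I"
    have "F.epath S' S [S] z"
      by (rule F.epath.start) (use z SS' edge_in[OF z] mid_eq_b[OF SS'(2)] edge_in_B S(2) in auto)
    moreover have "z \<notin> set [S]" using z by auto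
    moreover have "[mid \<delta> S S', pos \<delta> S, mid \<delta> S z] = path_list \<delta> S' [S] z"
      using path_list_snoc[of \<delta> S' "[]" S z] by (simp add: path_list_Nil mid_sym)
    ultimately show "spmf (explore \<delta> D (mid \<delta> B B') [mid \<delta> S S', pos \<delta> S, mid \<delta> S z]) p =
        (if F.ends_at p S' S [S] z then (1 / 2) ^ (face_count \<delta> C p - 2) else 0)"
      using F.spmf_explore_path_list[of S' S "[S]" z p] cf by simp
  qed
  also have "\<dots> = (if \<exists>z\<in>?I. F.ends_at p S' S [S] z then (1 / 2) ^ (face_count \<delta> C p - 2) else 0)"
  proof (rule sum_if_unique)
    fix z w assume "z \<in> ?I" "w \<in> ?I" "F.ends_at p S' S [S] z" "F.ends_at p S' S [S] w"
    then show "z = w" using F.ends_at_take[of p S' S z] F.ends_at_take[of p S' S w] mid_inj2[OF \<delta>, of z S w] by simp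
  qed simp
  also have "(\<exists>z\<in>?I. F.ends_at p S' S [S] z) \<longleftrightarrow> F.completed p S' S"
    unfolding F.completed_iff by blast
  finally have *: "spmf (radial_exploration \<delta> D (mid \<delta> S S') (pos \<delta> S) (mid \<delta> B B')) p =
    (if F.completed p S' S then (1 / 2) ^ (face_count \<delta> C p - 2) else 0) / 2" .
  show ?thesis
  proof (cases "F.completed p S' S")
    case True
    then have "face_count \<delta> C p - 1 = Suc (face_count \<delta> C p - 2)"
      using F.completed_face_count[OF True] cf by simp
    then show ?thesis using * True by simp
  qed (use * in simp)
qed

lemma spmf_radial_exploration':
  "spmf (radial_exploration' \<delta> D (mid \<delta> S S') (pos \<delta> S) (mid \<delta> B B')) p =
     (if \<exists>v\<in>{B, B'}. R.completed p (other v) v then (1 / 2) ^ (face_count \<delta> C p - 1) else 0)"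
proof -
  \<comment> \<open>A first step is coded by the end \<open>v\<close> through which the path leaves
    the central edge and by the next vertex \<open>z\<close>, two choices for each.\<close>
  let ?I = "(SIGMA v:{B, B'}. {z \<in> nbrs v. z \<noteq> other v})"
  let ?m = "\<lambda>(v, z). mid \<delta> v z"
  have ov: "other v \<in> nbrs v" "v \<in> nbrs (other v)" "hexs v \<subseteq> C" "mid \<delta> (other v) v = mid \<delta> B B'" if "v \<in> {B, B'}" for v
    using that B BB' mid_sym by auto
  have cI: "card ?I = 4" and finI: "finite ?I"
  proof -
    have "card {z \<in> nbrs v. z \<noteq> other v} = 2" if "v \<in> {B, B'}" for v
    proof (rule tripod[OF ov(1)[OF that]])
      fix l r assume t: "nbrs v = {other v, l, r}" "other v \<noteq> l" "other v \<noteq> r" "l \<noteq> r"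
      have "{z \<in> nbrs v. z \<noteq> other v} = {l, r}" unfolding t(1) using t(2,3) by auto
      then show ?thesis using t(4) by simp
    qed
    then show "card ?I = 4" using BB' by (subst card_SigmaI) auto
    show "finite ?I" by (intro finite_SigmaI) auto
  qed
  have I: "v \<in> {B, B'} \<and> z \<in> nbrs v \<and> z \<noteq> other v \<and> z \<noteq> v" if "(v, z) \<in> ?I" for v z
    using that by auto
  have inj: "inj_on ?m ?I"
  proof (rule inj_onI)
    fix i j assume ij: "i \<in> ?I" "j \<in> ?I" "?m i = ?m j"
    obtain v z v' z' where vz: "i = (v, z)" "j = (v', z')" by (metis surj_pair)
    have a: "(v, z) \<in> ?I" "(v', z') \<in> ?I" "mid \<delta> v z = mid \<delta> v' z'" using ij unfolding vz by simp_all
    have "v = v' \<and> z = z'"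
      using mid_inj[OF \<delta> _ _ a(3)] I[OF a(1)] I[OF a(2)] by (auto split: if_splits)
    then show "i = j" unfolding vz by simp
  qed
  have set: "{m \<in> mid_edges \<delta>. m \<noteq> mid \<delta> B B' \<and> dist m (mid \<delta> B B') \<le> \<delta>} = ?m ` ?I"
  proof (intro equalityI subsetI)
    fix m assume m: "m \<in> {m \<in> mid_edges \<delta>. m \<noteq> mid \<delta> B B' \<and> dist m (mid \<delta> B B') \<le> \<delta>}"
    then obtain x y where xy: "y \<in> nbrs x" "m = mid \<delta> x y" using mid_edges_iff[OF \<delta>] by auto
    have "x = B \<or> x = B' \<or> y = B \<or> y = B'" using near_mids[OF \<delta> xy(1) B(1)] m xy(2) by auto
    moreover have "\<not> (x = B \<and> y = B' \<or> x = B' \<and> y = B)" using m xy mid_eq_b[OF xy(1)] by auto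
    ultimately have "(x, y) \<in> ?I \<or> (y, x) \<in> ?I" using xy(1) nbrs_sym[OF xy(1)] by auto
    then show "m \<in> ?m ` ?I" using xy(2) mid_sym[of \<delta> x y] by (force simp: image_iff)
  next
    fix m assume "m \<in> ?m ` ?I"
    then obtain v z where vz: "(v, z) \<in> ?I" "m = mid \<delta> v z" by auto
    note i = I[OF vz(1)]
    then have nb: "z \<in> nbrs v" by blast
    show "m \<in> {m \<in> mid_edges \<delta>. m \<noteq> mid \<delta> B B' \<and> dist m (mid \<delta> B B') \<le> \<delta>}"
      using i vz(2) near_mids[OF \<delta> nb B(1)] mid_eq_b[OF nb] mid_edges_iff[OF \<delta>] by (auto split: if_splits)
  qed
  have the: "(THE u. half_edge \<delta> u (mid \<delta> B B') \<and> half_edge \<delta> u (mid \<delta> v z)) = pos \<delta> v" if "(v, z) \<in> ?I" for v z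
  proof (rule the_equality)
    note i = I[OF that]
    then have nb: "z \<in> nbrs v" by blast
    show "half_edge \<delta> (pos \<delta> v) (mid \<delta> B B') \<and> half_edge \<delta> (pos \<delta> v) (mid \<delta> v z)"
      using i half_edge_mid_iff[OF \<delta> B(1)] half_edge_pos_mid[OF \<delta> nb] by auto
    fix u assume "half_edge \<delta> u (mid \<delta> B B') \<and> half_edge \<delta> u (mid \<delta> v z)"
    then show "u = pos \<delta> v"
      using i half_edge_mid_iff[OF \<delta> B(1)] half_edge_mid_iff[OF \<delta> nb] pos_inj[of \<delta>] \<delta>
      by (auto split: if_splits)
  qed
  have cf: "card (faces C {v}) = 3" if "v \<in> {B, B'}" for v
  proof -
    have "faces C {v} = Some ` hexs v" using ov(3)[OF that] by (auto simp: faces_def)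
    then show ?thesis by (simp add: card_image card_hexs)
  qed
  let ?A = "D \<union> closed_segment (mid \<delta> S S') (pos \<delta> S)"
  let ?b = "mid \<delta> B B'"
  have "spmf (radial_exploration' \<delta> D (mid \<delta> S S') (pos \<delta> S) ?b) p =
      (\<Sum>(v, z)\<in>?I. spmf (explore \<delta> ?A (mid \<delta> S S')
        [?b, (THE u. half_edge \<delta> u ?b \<and> half_edge \<delta> u (mid \<delta> v z)), mid \<delta> v z]) p) / 4"
    unfolding radial_exploration'_def set spmf_bind integral_spmf_of_set card_image[OF inj] cI
      sum.reindex[OF inj]
    by (simp add: case_prod_unfold)
  also have "(\<Sum>(v, z)\<in>?I. spmf (explore \<delta> ?A (mid \<delta> S S')
        [?b, (THE u. half_edge \<delta> u ?b \<and> half_edge \<delta> u (mid \<delta> v z)), mid \<delta> v z]) p) =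
      (\<Sum>i\<in>?I. if (case i of (v, z) \<Rightarrow> R.ends_at p (other v) v [v] z) then (1 / 2) ^ (face_count \<delta> C p - 3) else 0)"
  proof (rule sum.cong[OF refl])
    fix vz assume vz': "vz \<in> ?I"
    obtain v z where vz_eq: "vz = (v, z)" by (cases vz)
    have vz: "(v, z) \<in> ?I" using vz' unfolding vz_eq .
    note i = I[OF vz]
    have "edge_in C v z" using ov(3)[of v] i common_hex[of z v] by (auto simp: edge_in_def)
    moreover have "mid \<delta> (other v) v \<noteq> mid \<delta> S S'"
      using ov(4)[of v] i mid_eq_a[OF B(1)] edge_in_B S(2) SS'(3) by auto
    ultimately have "R.epath (other v) v [v] z"
      using i ov(2)[of v] by (intro R.epath.start) (auto simp: hR_def)
    moreover have "z \<notin> set [v]" using i by auto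
    moreover have "[?b, (THE u. half_edge \<delta> u ?b \<and> half_edge \<delta> u (mid \<delta> v z)), mid \<delta> v z] = path_list \<delta> (other v) [v] z"
      unfolding the[OF vz] using path_list_snoc[of \<delta> "other v" "[]" v z] ov(4)[of v] i by (simp add: path_list_Nil)
    ultimately show "(case vz of (v, z) \<Rightarrow> spmf (explore \<delta> ?A (mid \<delta> S S')
        [?b, (THE u. half_edge \<delta> u ?b \<and> half_edge \<delta> u (mid \<delta> v z)), mid \<delta> v z]) p) =
        (if (case vz of (v, z) \<Rightarrow> R.ends_at p (other v) v [v] z) then (1 / 2) ^ (face_count \<delta> C p - 3) else 0)"
      using R.spmf_explore_path_list[of "other v" v "[v]" z p] cf[of v] i unfolding vz_eq prod.case by simp
  qed
  also have "\<dots> = (if \<exists>i\<in>?I. (case i of (v, z) \<Rightarrow> R.ends_at p (other v) v [v] z)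
      then (1 / 2) ^ (face_count \<delta> C p - 3) else 0)"
  proof (rule sum_if_unique[OF finI])
    fix i j
    assume ij: "i \<in> ?I" "j \<in> ?I" and e: "case i of (v, z) \<Rightarrow> R.ends_at p (other v) v [v] z"
      "case j of (v, z) \<Rightarrow> R.ends_at p (other v) v [v] z"
    obtain v z v' z' where vz: "i = (v, z)" "j = (v', z')" by (metis surj_pair)
    have "mid \<delta> v z = mid \<delta> v' z'"
      using R.ends_at_take[OF e(1)[unfolded vz prod.case]] R.ends_at_take[OF e(2)[unfolded vz prod.case]] by simp
    then show "i = j" using inj_onD[OF inj _ ij] unfolding vz by simp
  qed
  also have "(\<exists>i\<in>?I. (case i of (v, z) \<Rightarrow> R.ends_at p (other v) v [v] z)) \<longleftrightarrow>
      (\<exists>v\<in>{B, B'}. R.completed p (other v) v)"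
    unfolding R.completed_iff by auto
  finally have *: "spmf (radial_exploration' \<delta> D (mid \<delta> S S') (pos \<delta> S) ?b) p =
      (if \<exists>v\<in>{B, B'}. R.completed p (other v) v then (1 / 2) ^ (face_count \<delta> C p - 3) else 0) / 4" .
  show ?thesis
  proof (cases "\<exists>v\<in>{B, B'}. R.completed p (other v) v")
    case True
    then obtain v where "v \<in> {B, B'}" "R.completed p (other v) v" by blast
    then have "3 \<le> face_count \<delta> C p" using R.completed_face_count[of p "other v" v] cf[of v] by simp
    then have "face_count \<delta> C p - 1 = Suc (Suc (face_count \<delta> C p - 3))" by simp
    then show ?thesis using * True by simp
  qed (use * in simp)
qed

text \<open>Both laws are evaluated at a single list: \<open>completed_reverse\<close> matches the
  supports, and the exponents agree because the face count does not see the order.\<close>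

theorem radial_exploration_reversible:
  "radial_exploration \<delta> D (mid \<delta> S S') (pos \<delta> S) (mid \<delta> B B') =
   map_spmf rev (radial_exploration' \<delta> D (mid \<delta> S S') (pos \<delta> S) (mid \<delta> B B'))"
proof (rule spmf_eqI)
  fix p
  have "inj (rev :: complex list \<Rightarrow> _)" by (simp add: inj_def)
  from spmf_map_inj'[OF this, of _ "rev p"]
  have "spmf (map_spmf rev (radial_exploration' \<delta> D (mid \<delta> S S') (pos \<delta> S) (mid \<delta> B B'))) p =
    spmf (radial_exploration' \<delta> D (mid \<delta> S S') (pos \<delta> S) (mid \<delta> B B')) (rev p)" by simp
  then show "spmf (radial_exploration \<delta> D (mid \<delta> S S') (pos \<delta> S) (mid \<delta> B B')) p =
    spmf (map_spmf rev (radial_exploration' \<delta> D (mid \<delta> S S') (pos \<delta> S) (mid \<delta> B B'))) p"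
    unfolding spmf_radial_exploration spmf_radial_exploration' completed_reverse
    by (simp add: face_count_def)
qed

end

theorem lemma1:
  fixes D :: "complex set" and a b a\<^sub>\<delta> b\<^sub>\<delta> s :: complex and \<delta> :: real
    and C :: "complex set set" and D\<^sub>\<delta> :: "complex set"
  assumes "open D" and "connected D" and "simply_connected D"
    and "a \<in> frontier D" and "b \<in> D"
    and "\<delta> > 0"
    and "largest_hex_component \<delta> D C" and "D\<^sub>\<delta> = \<Union> C"
    and "is_arg_min (\<lambda>m. dist m a)
           (\<lambda>m. m \<in> mid_edges \<delta> \<and> m \<notin> D\<^sub>\<delta> \<and> infdist m (frontier D\<^sub>\<delta>) \<le> \<delta> / 2) a\<^sub>\<delta>"
    and "is_arg_min (\<lambda>m. dist m b) (\<lambda>m. m \<in> mid_edges \<delta> \<and> m \<in> D\<^sub>\<delta>) b\<^sub>\<delta>"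
    and "half_edge \<delta> s a\<^sub>\<delta>" and "s \<in> D\<^sub>\<delta>"
    and "\<forall>h \<in> hexagons \<delta>. infdist b\<^sub>\<delta> h \<le> \<delta> \<longrightarrow> h \<in> C"
  shows "radial_exploration \<delta> D\<^sub>\<delta> a\<^sub>\<delta> s b\<^sub>\<delta> = map_spmf rev (radial_exploration' \<delta> D\<^sub>\<delta> a\<^sub>\<delta> s b\<^sub>\<delta>)"
proof -
  note \<delta> = assms(6)
  have comp: "hex_component \<delta> D C" using assms(7) by (simp add: largest_hex_component_def)
  define H where "H = {h. hexset \<delta> h \<in> C}"
  have D\<delta>: "D\<^sub>\<delta> = (\<Union>h\<in>H. hexset \<delta> h)"
    using hex_component_hexagons[OF comp] unfolding assms(8) H_def hexagons_in_def hexagons_hexset by blast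
  obtain S S' where S: "S' \<in> nbrs S" "s = pos \<delta> S" "a\<^sub>\<delta> = mid \<delta> S S'"
    using assms(11) by (rule half_edgeE[OF \<delta>])
  have "a\<^sub>\<delta> \<notin> D\<^sub>\<delta>" using assms(9) by (simp add: is_arg_min_def)
  then have aS: "\<not> edge_in H S S'" using mid_mem_hexset[OF \<delta> S(1)] unfolding D\<delta> S(3) edge_in_def by blast
  have sS: "hexs S \<inter> H \<noteq> {}" using assms(12) pos_mem_hexset[OF \<delta>] unfolding D\<delta> S(2) by blast
  have "b\<^sub>\<delta> \<in> mid_edges \<delta>" using assms(10) by (simp add: is_arg_min_def)
  then obtain B B' where B: "B' \<in> nbrs B" "b\<^sub>\<delta> = mid \<delta> B B'" using mid_edges_iff[OF \<delta>] by blast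
  \<comment> \<open>The ends of the edge near \<open>b\<close> are at half the mesh from its centre,
    so every hexagon at them is within the distance covered by the hypothesis on hexagons.\<close>
  have near: "hexs v \<subseteq> H" if "dist b\<^sub>\<delta> (pos \<delta> v) = \<delta> / 2" for v
  proof
    fix h assume "h \<in> hexs v"
    then have "infdist b\<^sub>\<delta> (hexset \<delta> h) \<le> \<delta> / 2"
      using infdist_le[of "pos \<delta> v" "hexset \<delta> h" b\<^sub>\<delta>] pos_mem_hexset[OF \<delta>] that by simp
    then have "infdist b\<^sub>\<delta> (hexset \<delta> h) \<le> \<delta>" using \<delta> by linarith
    then have "hexset \<delta> h \<in> C" using assms(13) by (simp only: hexagons_hexset ball_simps)
    then show "h \<in> H" by (simp add: H_def)
  qed
  have "hexs B \<subseteq> H" "hexs B' \<subseteq> H"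
    using near dist_mid[OF \<delta> B(1)] dist_mid[OF \<delta> nbrs_sym[OF B(1)]]
    by (simp_all add: B(2) dist_commute mid_sym)
  note ab = S(2,3) B(2)
  from \<open>hexs B \<subseteq> H\<close> \<open>hexs B' \<subseteq> H\<close> interpret radial_setup \<delta> H D\<^sub>\<delta> S S' B B'
    using \<delta> D\<delta> S(1) aS sS B(1) unbounded_outside_component[OF \<delta> assms(1,3) comp H_def]
    by unfold_locales auto
  show ?thesis unfolding ab by (rule radial_exploration_reversible)
qed

end
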